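(* Fix $p\in(1,\infty)$. Let either $\delta\in[0,1]$ and $D=[\delta,1]$, or $\delta\in[0,1)$ and $D=(\delta,1]$, and let $F:D\to[0,1]$ be concave, nondecreasing, with $F(u)\le u$ for all $u\in D$. Then: (a) there exists a nondoubling metric measure space $\mathfrak Z$ such that $\mathfrak c(p,q,r,\mathfrak Z)<\infty$ if and only if $1/q\in D$ and $1/r\le F(1/q)$; (b) there exists a nondoubling metric measure space $\mathfrak Z'$ such that $\mathfrak c(p,q,r,\mathfrak Z')<\infty$ if and only if $1/q\in D$ and $1/r<F(1/q)$. Here $q,r$ range over $[1,\infty]$ with $1/\infty=0$.
   Context: Metric measure space $(X,\rho,\mu)$: nonempty set, metric, nonnegative Borel measure, every open ball of positive finite measure; doubling means $\mu(B(x,2s))\le C\mu(B(x,s))$ uniformly. Lorentz quasinorm: $d_f(t)=\mu(\{|f|>t\})$, $\|f\|_{p,q}=p^{1/q}(\int_0^\infty(t d_f(t)^{1/p})^q dt/t)^{1/q}$ for $q<\infty$, $\|f\|_{p,\infty}=\sup_{t>0}t d_f(t)^{1/p}$. $\mathcal M^{\rm c}_{\mathfrak X}f(x)=\sup_{s>0}\mu(B(x,s))^{-1}\int_{B(x,s)}|f|d\mu$. $\mathfrak c(p,q,r,\mathfrak X)$ is the smallest $c$ with $\|\mathcal M^{\rm c}_{\mathfrak X}f\|_{p,r}\le c\|f\|_{p,q}$ for all $f\in L^{p,q}(\mathfrak X)$ ($\infty$ if none). *)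

theory Defs
  imports "HOL-Analysis.Analysis"
begin

text \<open>Metric measure spaces are represented concretely on the carrier type real:
  a set X of reals, an abstract metric rho on X (not the usual one), and a measure M.\<close>

definition ball_in :: "real set \<Rightarrow> (real \<Rightarrow> real \<Rightarrow> real) \<Rightarrow> real \<Rightarrow> real \<Rightarrow> real set" where
  "ball_in X \<rho> x s = {y \<in> X. \<rho> x y < s}"

definition metric_measure_space ::
  "real set \<Rightarrow> (real \<Rightarrow> real \<Rightarrow> real) \<Rightarrow> real measure \<Rightarrow> bool" where
  "metric_measure_space X \<rho> M \<longleftrightarrow>
     X \<noteq> {} \<and> Metric_space X \<rho> \<and> space M = X \<and>
     sets M = sigma_sets X {U. openin (Metric_space.mtopology X \<rho>) U} \<and>
     (\<forall>x\<in>X. \<forall>s>0. 0 < emeasure M (ball_in X \<rho> x s) \<and> emeasure M (ball_in X \<rho> x s) < \<infinity>)"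

definition doubling :: "real set \<Rightarrow> (real \<Rightarrow> real \<Rightarrow> real) \<Rightarrow> real measure \<Rightarrow> bool" where
  "doubling X \<rho> M \<longleftrightarrow> (\<exists>C::real. \<forall>x\<in>X. \<forall>s>0.
     emeasure M (ball_in X \<rho> x (2 * s)) \<le> ennreal C * emeasure M (ball_in X \<rho> x s))"

definition epow :: "ennreal \<Rightarrow> real \<Rightarrow> ennreal" where
  "epow x a = (if x = \<infinity> then \<infinity> else ennreal (enn2real x powr a))"

text \<open>Distribution function d_g(t) = mu({|g| > t}) (outer measure, in case of nonmeasurability).\<close>
definition distrib :: "real measure \<Rightarrow> (real \<Rightarrow> ennreal) \<Rightarrow> real \<Rightarrow> ennreal" where
  "distrib M g t = outer_measure_of M {x \<in> space M. g x > ennreal t}"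

definition lorentz_norm :: "real measure \<Rightarrow> real \<Rightarrow> ennreal \<Rightarrow> (real \<Rightarrow> ennreal) \<Rightarrow> ennreal" where
  "lorentz_norm M p q g =
     (if q = \<infinity> then (SUP t\<in>{0<..}. ennreal t * epow (distrib M g t) (1/p))
      else ennreal (p powr (1 / enn2real q)) *
        epow (\<integral>\<^sup>+ t. indicator {0<..} t *
                 (epow (ennreal t * epow (distrib M g t) (1/p)) (enn2real q) / ennreal t) \<partial>lborel)
             (1 / enn2real q))"

definition max_c :: "real set \<Rightarrow> (real \<Rightarrow> real \<Rightarrow> real) \<Rightarrow> real measure \<Rightarrow> (real \<Rightarrow> real) \<Rightarrow> real \<Rightarrow> ennreal" where
  "max_c X \<rho> M f x = (SUP s\<in>{0<..}.
      (\<integral>\<^sup>+ y\<in>ball_in X \<rho> x s. ennreal \<bar>f y\<bar> \<partial>M) / emeasure M (ball_in X \<rho> x s))"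

text \<open>Smallest constant c(p,q,r,X): infimum over admissible constants (Inf {} = \<infinity>).\<close>
definition max_const :: "real \<Rightarrow> ennreal \<Rightarrow> ennreal \<Rightarrow> real set \<Rightarrow> (real \<Rightarrow> real \<Rightarrow> real) \<Rightarrow> real measure \<Rightarrow> ennreal" where
  "max_const p q r X \<rho> M = Inf {c. \<forall>f. f \<in> borel_measurable M \<and>
        lorentz_norm M p q (\<lambda>x. ennreal \<bar>f x\<bar>) < \<infinity> \<longrightarrow>
        lorentz_norm M p r (max_c X \<rho> M f) \<le> c * lorentz_norm M p q (\<lambda>x. ennreal \<bar>f x\<bar>)}"

definition recip :: "ennreal \<Rightarrow> real" where
  "recip q = (if q = \<infinity> then 0 else 1 / enn2real q)"

end

theory Submission
  imports Defs
begin

text \<open>The space is a sequence of finite groups of atoms. Atoms of a group have equal mass, and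
  the masses grow so fast with the group that the Lorentz norm is an \<open>l\<^sup>q\<close> sum over the
  groups and, inside a group, over dyadic order statistics. A target group has balls which contain,
  besides their centre, one atom from each of \<open>n\<close> source groups, equidistributed in each of them. The
  masses are tuned so that these averages act on normalised functions of the sources as \<open>A\<close> times
  the arithmetic mean over the sources, which has norm \<open>A n\<^sup>-\<^sup>1\<^sup>/\<^sup>q\<close>, whatever \<open>r \<ge> q\<close> is; \<open>m\<close> target
  groups sharing the sources give the norm \<open>A m\<^sup>1\<^sup>/\<^sup>r n\<^sup>-\<^sup>1\<^sup>/\<^sup>q\<close>. All other balls are harmless:
  they contain the whole group of their centre. Hence the constant is finite if and only if
  \<open>1/r \<le> 1/q\<close> and the blocks \<open>(m\<^sub>i, n\<^sub>i, A\<^sub>i)\<close> satisfy \<open>sup\<^sub>i A\<^sub>i m\<^sub>i\<^sup>1\<^sup>/\<^sup>r n\<^sub>i\<^sup>-\<^sup>1\<^sup>/\<^sup>q < \<infinity>\<close>. Logarithms of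
  these weights are affine functions of \<open>(1/q, 1/r)\<close>, and a countable family of them is bounded
  exactly on the prescribed convex region.\<close>

section \<open>Sums of powers\<close>

text \<open>Strict inequalities and open endpoints can be encoded because the bound on the block
  weights may depend on the exponents: if K <= ln m, then K m^(-x) equals K at x = 0 but is at most
  1/x for all x > 0, so blocks with growing K blow up on an excluded edge and nowhere inside.
  Uncountably many exponents must be excluded with countably many groups; hence all triples (m, n,
  A) with rational A that respect one fixed budget on the region are used at once. The obstacle in
  the upper bound is that a link average adds many sources, each with its own order statistics.
  Equidistribution makes a level set of a source occupy the same fraction of the target, so cutting
  every source at its own levels turns the average into a convolution over dyadic levels with ratio
  2^(1/p-1), summable because p > 1. Hoelder's inequality over the sources then gives exactly the
  factor n^(1-1/q). Requiring (group mass)^(1/p) = \<beta> * (atom mass) determines the atom mass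
  from the group size and \<beta>; only the sizes remain to be chosen, recursively and
  large.\<close>

lemma sum_atMost_rev: "(\<Sum>i\<le>n. f (n - i)) = (\<Sum>i\<le>n::nat. f i)"
  by (rule sum.reindex_bij_witness[where i="\<lambda>i. n - i" and j="\<lambda>i. n - i"]) auto

text \<open>Jensen's inequality for the weights w / W. It follows from Young's inequality in which
  the second factor is the mean M = A / W; the two terms on the right then add up to W * M.\<close>

lemma powr_sum_le_weighted:
  fixes w x :: "'i \<Rightarrow> real"
  assumes "finite I" "\<And>i. i \<in> I \<Longrightarrow> 0 \<le> w i" "\<And>i. i \<in> I \<Longrightarrow> 0 \<le> x i"
    and W: "(\<Sum>i\<in>I. w i) \<le> W" "0 < W" and q: "1 \<le> q"
  shows "(\<Sum>i\<in>I. w i * x i) powr q \<le> W powr (q - 1) * (\<Sum>i\<in>I. w i * x i powr q)"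
proof -
  define A where "A = (\<Sum>i\<in>I. w i * x i powr q)"
  have A0: "0 \<le> A" unfolding A_def using assms by (auto intro!: sum_nonneg)
  show ?thesis
  proof (cases "A = 0")
    case True
    have "w i * x i = 0" if "i \<in> I" for i
    proof -
      have "w i * x i powr q = 0"
        using True assms that unfolding A_def by (subst (asm) sum_nonneg_eq_0_iff) auto
      then show ?thesis by auto
    qed
    then have "(\<Sum>i\<in>I. w i * x i) = 0" by (auto intro!: sum.neutral)
    then show ?thesis using A0 unfolding A_def by (simp add: W)
  next
    case False
    define M where "M = A / W"
    have M: "0 < M" using False A0 W by (simp add: M_def)
    have y: "x i * M powr (1 - 1/q) \<le> x i powr q / q + (1 - 1/q) * M" if "i \<in> I" for i
    proof (cases "x i = 0")
      case True
      then show ?thesis using M q by simp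
    next
      case False
      then have "0 < x i" using assms(3)[OF that] by simp
      then have "(x i powr q) powr (1/q) * M powr (1 - 1/q) \<le> (1/q) * x i powr q + (1 - 1/q) * M"
        using q M by (intro Youngs_inequality_0) auto
      moreover have "(x i powr q) powr (1/q) = x i" using q assms(3)[OF that] by (simp add: powr_powr)
      ultimately show ?thesis by simp
    qed
    have "(\<Sum>i\<in>I. w i * x i) * M powr (1 - 1/q) = (\<Sum>i\<in>I. w i * (x i * M powr (1 - 1/q)))"
      by (simp add: sum_distrib_right mult.assoc)
    also have "\<dots> \<le> (\<Sum>i\<in>I. w i * (x i powr q / q + (1 - 1/q) * M))"
      using y assms by (intro sum_mono mult_left_mono) auto
    also have "\<dots> = A / q + (\<Sum>i\<in>I. w i) * ((1 - 1/q) * M)"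
      unfolding A_def by (simp add: distrib_left sum.distrib sum_divide_distrib sum_distrib_right)
    also have "\<dots> \<le> A / q + W * ((1 - 1/q) * M)"
      using W q M by (intro add_left_mono mult_right_mono) auto
    also have "\<dots> = W * M" using W q by (simp add: M_def field_simps)
    also have "\<dots> = (W * M powr (1/q)) * M powr (1 - 1/q)"
      using M by (simp add: mult.assoc flip: powr_add)
    finally have "(\<Sum>i\<in>I. w i * x i) \<le> W * M powr (1/q)"
      using M by simp
    then have "(\<Sum>i\<in>I. w i * x i) powr q \<le> (W * M powr (1/q)) powr q"
      using q assms by (intro powr_mono2) (auto intro!: sum_nonneg)
    also have "\<dots> = W powr q * M" using W M q by (simp add: powr_mult powr_powr)
    also have "\<dots> = W powr (q - 1) * A" using W by (simp add: M_def powr_diff)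
    finally show ?thesis by (simp add: A_def)
  qed
qed

lemma powr_sum_le_card:
  fixes x :: "'i \<Rightarrow> real"
  assumes "finite I" "\<And>i. i \<in> I \<Longrightarrow> 0 \<le> x i" "1 \<le> q"
  shows "(\<Sum>i\<in>I. x i) powr q \<le> real (card I) powr (q - 1) * (\<Sum>i\<in>I. x i powr q)"
proof (cases "I = {}")
  case False
  then show ?thesis
    using powr_sum_le_weighted[of I "\<lambda>_. 1" x "real (card I)" q] assms by (simp add: card_gt_0_iff)
qed simp

lemma powr_add3_le:
  fixes a b c :: real
  assumes "0 \<le> a" "0 \<le> b" "0 \<le> c" "1 \<le> q"
  shows "(a + b + c) powr q \<le> 3 powr (q - 1) * (a powr q + b powr q + c powr q)"
proof -
  have "(\<Sum>i\<in>{0,1,2::nat}. (if i = 0 then a else if i = 1 then b else c)) powr q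
     \<le> real (card {0,1,2::nat}) powr (q - 1) * (\<Sum>i\<in>{0,1,2::nat}. (if i = 0 then a else if i = 1 then b else c) powr q)"
    using assms by (intro powr_sum_le_card) auto
  then show ?thesis by (simp add: add.assoc)
qed

lemma geometric_sum_le:
  fixes x :: real
  assumes "0 \<le> x" "x < 1"
  shows "(\<Sum>i<n. x ^ i) \<le> 1 / (1 - x)"
proof -
  have "(\<Sum>i<n. x ^ i) \<le> (\<Sum>i. x ^ i)"
    using assms by (intro sum_le_suminf summable_geometric) auto
  then show ?thesis using assms by (simp add: suminf_geometric)
qed

lemma geometric_sum_shift_le:
  fixes x :: real
  assumes "0 \<le> x" "x < 1"
  shows "(\<Sum>i=e..N. x ^ (i - e)) \<le> 1 / (1 - x)"
proof -
  have "(\<Sum>i=e..N. x ^ (i - e)) = (\<Sum>i\<in>(\<lambda>i. i - e) ` {e..N}. x ^ i)"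
    by (subst sum.reindex) (auto simp: inj_on_def)
  also have "\<dots> \<le> (\<Sum>i<Suc N. x ^ i)"
    using assms by (intro sum_mono2) auto
  also have "\<dots> \<le> 1 / (1 - x)" using assms by (intro geometric_sum_le) auto
  finally show ?thesis .
qed

text \<open>Rows and columns of the geometric kernel both sum to at most 1 / (1 - \<beta>). The row
  sums enter through Jensen's inequality, the column sums after the two summations are
  exchanged.\<close>

lemma sum_powr_convolution_le:
  fixes Z :: "nat \<Rightarrow> real"
  assumes "0 < \<beta>" "\<beta> < 1" "\<And>i. 0 \<le> Z i" "1 \<le> r"
  shows "(\<Sum>e\<le>N. (\<Sum>i=e..N. \<beta> ^ (i - e) * Z i) powr r) \<le> (1 / (1 - \<beta>)) powr r * (\<Sum>i\<le>N. Z i powr r)"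
proof -
  let ?W = "1 / (1 - \<beta>)"
  have W: "0 < ?W" using assms by simp
  have g: "(\<Sum>i=e..N. \<beta> ^ (i - e)) \<le> ?W" for e
    using assms by (intro geometric_sum_shift_le) auto
  have g': "(\<Sum>e\<le>i. \<beta> ^ (i - e)) \<le> ?W" for i
  proof -
    have "(\<Sum>e\<le>i. \<beta> ^ (i - e)) = (\<Sum>e<Suc i. \<beta> ^ e)"
      using sum.nat_diff_reindex[of "\<lambda>e. \<beta> ^ e" "Suc i"] by (simp add: lessThan_Suc_atMost)
    also have "\<dots> \<le> ?W" using assms by (intro geometric_sum_le) auto
    finally show ?thesis .
  qed
  have "(\<Sum>e\<le>N. (\<Sum>i=e..N. \<beta> ^ (i - e) * Z i) powr r)
      \<le> (\<Sum>e\<le>N. ?W powr (r - 1) * (\<Sum>i=e..N. \<beta> ^ (i - e) * Z i powr r))"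
    using assms g W by (intro sum_mono powr_sum_le_weighted) auto
  also have "\<dots> = ?W powr (r - 1) * (\<Sum>e\<le>N. \<Sum>i=e..N. \<beta> ^ (i - e) * Z i powr r)"
    by (simp add: sum_distrib_left)
  also have "(\<Sum>e\<le>N. \<Sum>i=e..N. \<beta> ^ (i - e) * Z i powr r)
     = (\<Sum>i\<le>N. \<Sum>e\<le>i. \<beta> ^ (i - e) * Z i powr r)"
  proof -
    have "(\<Sum>e\<le>N. \<Sum>i=e..N. \<beta> ^ (i - e) * Z i powr r) = (\<Sum>e\<le>N. \<Sum>i\<in>{i. i \<in> {..N} \<and> e \<le> i}. \<beta> ^ (i - e) * Z i powr r)"
      by (intro sum.cong) auto
    also have "\<dots> = (\<Sum>i\<le>N. \<Sum>e\<in>{e. e \<in> {..N} \<and> e \<le> i}. \<beta> ^ (i - e) * Z i powr r)"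
      by (rule sum.swap_restrict) auto
    also have "\<dots> = (\<Sum>i\<le>N. \<Sum>e\<le>i. \<beta> ^ (i - e) * Z i powr r)"
      by (intro sum.cong) auto
    finally show ?thesis .
  qed
  also have "\<dots> \<le> (\<Sum>i\<le>N. ?W * Z i powr r)"
    unfolding sum_distrib_right[symmetric] using g' by (intro sum_mono mult_right_mono) auto
  also have "?W powr (r - 1) * \<dots> = ?W powr r * (\<Sum>i\<le>N. Z i powr r)"
  proof -
    have "?W powr (r - 1) * ?W = ?W powr r" using W by (simp add: powr_diff)
    then have "?W powr (r - 1) * (?W * z) = ?W powr r * z" for z by (simp only: mult.assoc[symmetric])
    then show ?thesis by (simp only: sum_distrib_left)
  qed
  finally show ?thesis using W by (simp add: mult_left_mono)
qed

section \<open>Order statistics on a finite set\<close>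

text \<open>With multiplicity; junk unless \<open>1 \<le> n \<le> card G\<close>.\<close>
definition nth_largest :: "'a set \<Rightarrow> ('a \<Rightarrow> real) \<Rightarrow> nat \<Rightarrow> real" where
  "nth_largest G g n = Max {t \<in> g ` G. n \<le> card {x \<in> G. t \<le> g x}}"

lemma nth_largest_set:
  fixes g :: "'a \<Rightarrow> real"
  assumes "finite G" "1 \<le> n" "n \<le> card G"
  shows "finite {t \<in> g ` G. n \<le> card {x \<in> G. t \<le> g x}}" "{t \<in> g ` G. n \<le> card {x \<in> G. t \<le> g x}} \<noteq> {}"
proof -
  have ne: "G \<noteq> {}" using assms by auto
  have "{x \<in> G. Min (g ` G) \<le> g x} = G" using assms by auto
  then have "Min (g ` G) \<in> {t \<in> g ` G. n \<le> card {x \<in> G. t \<le> g x}}"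
    using assms ne by simp
  then show "{t \<in> g ` G. n \<le> card {x \<in> G. t \<le> g x}} \<noteq> {}" by blast
qed (use assms in auto)

text \<open>The order statistic is the generalised inverse of the counting function. This
  equivalence later converts integrals over thresholds into order statistics.\<close>

lemma less_nth_largest_iff:
  assumes "finite G" "1 \<le> n" "n \<le> card G"
  shows "t < nth_largest G g n \<longleftrightarrow> n \<le> card {x \<in> G. t < g x}"
proof
  let ?T = "{t \<in> g ` G. n \<le> card {x \<in> G. t \<le> g x}}"
  note T = nth_largest_set[OF assms, of g]
  assume "t < nth_largest G g n"
  moreover have "nth_largest G g n \<in> ?T"
    unfolding nth_largest_def using T by (rule Max_in)
  moreover have "card {x \<in> G. nth_largest G g n \<le> g x} \<le> card {x \<in> G. t < g x}"
    using assms calculation(1) by (intro card_mono) auto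
  ultimately show "n \<le> card {x \<in> G. t < g x}" by auto
next
  let ?T = "{t \<in> g ` G. n \<le> card {x \<in> G. t \<le> g x}}"
  note T = nth_largest_set[OF assms, of g]
  assume *: "n \<le> card {x \<in> G. t < g x}"
  let ?B = "{x \<in> G. t < g x}"
  have "0 < card ?B" using * assms(2) by linarith
  then have B: "finite ?B" "?B \<noteq> {}" unfolding card_gt_0_iff by simp_all
  define s where "s = Min (g ` ?B)"
  have "s \<in> g ` ?B" unfolding s_def using B by (intro Min_in) auto
  moreover have "?B \<subseteq> {x \<in> G. s \<le> g x}" unfolding s_def using B by auto
  then have "n \<le> card {x \<in> G. s \<le> g x}"
    using * assms by (intro order_trans[OF *] card_mono) auto
  ultimately have "s \<in> ?T" "t < s" by auto
  then show "t < nth_largest G g n"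
    unfolding nth_largest_def using T(1) by (meson Max_ge less_le_trans)
qed

lemma card_above_nth_largest:
  assumes "finite G" "1 \<le> n" "n \<le> card G"
  shows "card {x \<in> G. nth_largest G g n < g x} < n"
  using less_nth_largest_iff[OF assms, of "nth_largest G g n" g] by auto

lemma nth_largest_in:
  assumes "finite G" "1 \<le> n" "n \<le> card G"
  shows "nth_largest G g n \<in> g ` G"
  using Max_in[OF nth_largest_set[OF assms, of g]] unfolding nth_largest_def by blast

lemma le_nth_largest_1:
  assumes "finite G" "x \<in> G"
  shows "g x \<le> nth_largest G g 1"
proof (rule ccontr)
  assume "\<not> ?thesis"
  moreover have "1 \<le> card G" using assms by (metis One_nat_def Suc_leI card_gt_0_iff empty_iff)
  moreover have "card {x \<in> G. nth_largest G g 1 < g x} < 1"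
    using assms calculation by (intro card_above_nth_largest) auto
  ultimately show False using assms by auto
qed

lemma nth_largest_cmult:
  assumes "finite G" "1 \<le> n" "n \<le> card G" "0 < c"
  shows "nth_largest G (\<lambda>x. c * g x) n = c * nth_largest G g n"
proof -
  have "t < nth_largest G (\<lambda>x. c * g x) n \<longleftrightarrow> t < c * nth_largest G g n" for t
    using less_nth_largest_iff[OF assms(1-3), of "t / c" g] less_nth_largest_iff[OF assms(1-3), of t "\<lambda>x. c * g x"]
      \<open>0 < c\<close> by (simp add: pos_divide_less_eq mult.commute)
  then show ?thesis by (metis less_irrefl linorder_neqE)
qed

text \<open>If i is the last index with \<open>\<tau> i < t\<close>, then
  \<open>t \<le> \<tau> (Suc i)\<close>, and this is one of the summands.\<close>

lemma level_decomposition: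
  fixes \<tau> :: "nat \<Rightarrow> real"
  assumes "\<And>i. 0 \<le> \<tau> i" "t \<le> \<tau> a" "e \<le> a"
  shows "t \<le> \<tau> e + (\<Sum>i=e..<a. \<tau> (Suc i) * (if \<tau> i < t then 1 else 0))" (is "_ \<le> _ + ?S")
proof (cases "t \<le> \<tau> e")
  case True
  have "0 \<le> ?S" using assms by (intro sum_nonneg) auto
  then show ?thesis using True by simp
next
  case False
  define i where "i = Max {i \<in> {e..a}. \<tau> i < t}"
  have "i \<in> {i \<in> {e..a}. \<tau> i < t}"
    unfolding i_def using False \<open>e \<le> a\<close> by (intro Max_in) (auto intro!: exI[of _ e])
  then have i: "e \<le> i" "i \<le> a" "\<tau> i < t" by auto
  with assms(2) have "i < a" by (metis linorder_not_le order_le_imp_less_or_eq)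
  have "\<not> \<tau> (Suc i) < t"
  proof
    assume "\<tau> (Suc i) < t"
    then have "Suc i \<le> i" unfolding i_def using i \<open>i < a\<close> by (intro Max_ge) (auto simp: i_def)
    then show False by simp
  qed
  then have "t \<le> \<tau> (Suc i) * (if \<tau> i < t then 1 else 0)" using i by simp
  also have "\<dots> \<le> ?S"
    using i \<open>i < a\<close> assms by (intro member_le_sum) auto
  finally show ?thesis using assms(1)[of e] by linarith
qed

text \<open>Pointwise decomposition into levels, summed over Y. The factor 2 arises because the
  increment \<open>\<tau> (Suc i)\<close> is paid on the set above \<open>\<tau> i\<close>, whose
  bound 2^(a-i) is twice the one belonging to Suc i.\<close>

lemma sum_le_levels:
  fixes \<tau> :: "nat \<Rightarrow> real"
  assumes "finite Y" "card Y = 2 ^ a" and nn: "\<And>i. 0 \<le> \<tau> i"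
    and lev: "\<And>i. i < a \<Longrightarrow> card {x \<in> Y. \<tau> i < g x} \<le> 2 ^ (a - i)"
    and top: "\<And>x. x \<in> Y \<Longrightarrow> g x \<le> \<tau> a"
  shows "(\<Sum>x\<in>Y. g x) \<le> 2 * (\<Sum>i\<le>a. 2 ^ (a - i) * \<tau> i)"
proof -
  have "(\<Sum>x\<in>Y. g x) \<le> (\<Sum>x\<in>Y. \<tau> 0 + (\<Sum>i=0..<a. \<tau> (Suc i) * (if \<tau> i < g x then 1 else 0)))"
    using nn top by (intro sum_mono level_decomposition) auto
  also have "\<dots> = 2 ^ a * \<tau> 0 + (\<Sum>i=0..<a. \<Sum>x\<in>Y. \<tau> (Suc i) * (if \<tau> i < g x then 1 else 0))"
    using assms(2) by (simp add: sum.distrib) (rule sum.swap)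
  also have "\<dots> = 2 ^ a * \<tau> 0 + (\<Sum>i=0..<a. \<tau> (Suc i) * card {x \<in> Y. \<tau> i < g x})"
    using assms(1) by (simp add: sum.If_cases Int_def flip: sum_distrib_left)
  also have "\<dots> \<le> 2 ^ a * \<tau> 0 + (\<Sum>i=0..<a. \<tau> (Suc i) * 2 ^ (a - i))"
    using lev nn by (intro add_left_mono sum_mono mult_left_mono) auto
  also have "(\<Sum>i=0..<a. \<tau> (Suc i) * 2 ^ (a - i)) = (\<Sum>i<a. 2 * (2 ^ (a - Suc i) * \<tau> (Suc i)))"
  proof -
    have "\<tau> (Suc i) * 2 ^ (a - i) = 2 * (2 ^ (a - Suc i) * \<tau> (Suc i))" if "i < a" for i
      using that by (simp add: Suc_diff_Suc flip: power_Suc)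
    then show ?thesis unfolding atLeast0LessThan by (intro sum.cong) auto
  qed
  also have "2 ^ a * \<tau> 0 + \<dots> \<le> 2 * (2 ^ a * \<tau> 0 + (\<Sum>i<a. 2 ^ (a - Suc i) * \<tau> (Suc i)))"
    using nn[of 0] by (simp flip: sum_distrib_left)
  also have "2 ^ a * \<tau> 0 + (\<Sum>i<a. 2 ^ (a - Suc i) * \<tau> (Suc i)) = (\<Sum>i\<le>a. 2 ^ (a - i) * \<tau> i)"
    unfolding lessThan_Suc_atMost[symmetric] sum.lessThan_Suc_shift by simp
  finally show ?thesis .
qed

text \<open>The level \<open>\<tau> \<iota> i\<close> is exceeded by \<open>g \<iota>\<close> on at most the fraction \<open>2\<^sup>-\<^sup>i\<close> of \<open>Y\<close>. Cutting each
  summand at its own level, and not all of them at a common one, is what keeps the bound linear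
  in the levels.\<close>
lemma nth_largest_sum_le:
  fixes g :: "'i \<Rightarrow> 'a \<Rightarrow> real" and \<tau> :: "'i \<Rightarrow> nat \<Rightarrow> real"
  assumes "finite Y" "card Y = 2 ^ a" "finite I" "e \<le> a"
    and H: "\<And>x. x \<in> Y \<Longrightarrow> H x \<le> (\<Sum>\<iota>\<in>I. g \<iota> x)"
    and nn: "\<And>\<iota> i. \<iota> \<in> I \<Longrightarrow> 0 \<le> \<tau> \<iota> i"
    and lev: "\<And>\<iota> i. \<iota> \<in> I \<Longrightarrow> i < a \<Longrightarrow> card {x \<in> Y. \<tau> \<iota> i < g \<iota> x} \<le> 2 ^ (a - i)"
    and top: "\<And>\<iota> x. \<iota> \<in> I \<Longrightarrow> x \<in> Y \<Longrightarrow> g \<iota> x \<le> \<tau> \<iota> a"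
  shows "nth_largest Y H (2 ^ (a - e)) \<le> 2 * (\<Sum>i=e..a. (1/2) ^ (i - e) * (\<Sum>\<iota>\<in>I. \<tau> \<iota> i))"
proof (rule ccontr)
  define T where "T i = (\<Sum>\<iota>\<in>I. \<tau> \<iota> i)" for i
  have T0: "0 \<le> T i" for i unfolding T_def using nn by (auto intro!: sum_nonneg)
  define B where "B = 2 * (\<Sum>i=e..a. (1/2) ^ (i - e) * T i)"
  define A where "A = {x \<in> Y. B < H x}"
  define R where "R x = (\<Sum>\<iota>\<in>I. \<Sum>i=e..<a. \<tau> \<iota> (Suc i) * (if \<tau> \<iota> i < g \<iota> x then 1 else 0))" for x
  assume "\<not> ?thesis"
  then have cA: "2 ^ (a - e) \<le> card A"
    using less_nth_largest_iff[of Y "2 ^ (a - e)" B H] assms(1,2)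
    by (simp add: A_def B_def T_def power_increasing not_le)
  have "0 < card A" by (rule less_le_trans[OF _ cA]) simp
  then have A: "finite A" "A \<subseteq> Y" "A \<noteq> {}" unfolding card_gt_0_iff by (auto simp: A_def)
  have pt: "g \<iota> x \<le> \<tau> \<iota> e + (\<Sum>i=e..<a. \<tau> \<iota> (Suc i) * (if \<tau> \<iota> i < g \<iota> x then 1 else 0))"
    if "\<iota> \<in> I" "x \<in> Y" for \<iota> x
    using nn top \<open>e \<le> a\<close> that by (intro level_decomposition) auto
  have HR: "H x \<le> T e + R x" if "x \<in> Y" for x
  proof -
    have "H x \<le> (\<Sum>\<iota>\<in>I. \<tau> \<iota> e + (\<Sum>i=e..<a. \<tau> \<iota> (Suc i) * (if \<tau> \<iota> i < g \<iota> x then 1 else 0)))"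
      using H[OF that] pt that by (meson order_trans sum_mono)
    then show ?thesis by (simp add: T_def R_def sum.distrib)
  qed
  have "(\<Sum>x\<in>Y. R x) = (\<Sum>\<iota>\<in>I. \<Sum>i=e..<a. \<Sum>x\<in>Y. \<tau> \<iota> (Suc i) * (if \<tau> \<iota> i < g \<iota> x then 1 else 0))"
    unfolding R_def by (subst sum.swap, subst (2) sum.swap) simp
  also have "\<dots> = (\<Sum>\<iota>\<in>I. \<Sum>i=e..<a. \<tau> \<iota> (Suc i) * card {x \<in> Y. \<tau> \<iota> i < g \<iota> x})"
    using assms(1) by (simp add: sum.If_cases Int_def flip: sum_distrib_left)
  also have "\<dots> \<le> (\<Sum>\<iota>\<in>I. \<Sum>i=e..<a. \<tau> \<iota> (Suc i) * 2 ^ (a - i))"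
  proof (intro sum_mono mult_left_mono)
    fix \<iota> i assume "\<iota> \<in> I" "i \<in> {e..<a}"
    then have "card {x \<in> Y. \<tau> \<iota> i < g \<iota> x} \<le> 2 ^ (a - i)" using lev by auto
    then show "real (card {x \<in> Y. \<tau> \<iota> i < g \<iota> x}) \<le> 2 ^ (a - i)"
      by (metis of_nat_le_iff of_nat_numeral of_nat_power)
  qed (use nn in auto)
  also have "\<dots> = (\<Sum>i=e..<a. T (Suc i) * 2 ^ (a - i))"
    by (subst sum.swap) (simp add: T_def sum_distrib_right)
  also have "\<dots> = 2 ^ (a - e) * (2 * (\<Sum>i=e..<a. (1/2) ^ (Suc i - e) * T (Suc i)))"
  proof -
    have "T (Suc i) * 2 ^ (a - i) = 2 ^ (a - e) * (2 * ((1/2) ^ (Suc i - e) * T (Suc i)))"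
      if "i \<in> {e..<a}" for i
    proof -
      have "(2::real) ^ (a - e) = 2 ^ (a - i) * 2 ^ (i - e)" using that by (simp flip: power_add)
      then show ?thesis using that by (simp add: Suc_diff_le power_divide)
    qed
    then show ?thesis unfolding sum_distrib_left by (intro sum.cong) auto
  qed
  finally have RY: "(\<Sum>x\<in>Y. R x) \<le> 2 ^ (a - e) * (2 * (\<Sum>i=e..<a. (1/2) ^ (Suc i - e) * T (Suc i)))" .
  have Beq: "B = 2 * T e + 2 * (\<Sum>i=e..<a. (1/2) ^ (Suc i - e) * T (Suc i))"
  proof -
    have "(\<Sum>i=e..a. (1/2) ^ (i - e) * T i) = T e + (\<Sum>i=Suc e..a. (1/2) ^ (i - e) * T i)"
      using \<open>e \<le> a\<close> by (subst sum.atLeast_Suc_atMost) auto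
    also have "(\<Sum>i=Suc e..a. (1/2) ^ (i - e) * T i) = (\<Sum>i=e..<a. (1/2) ^ (Suc i - e) * T (Suc i))"
      by (simp only: atLeastLessThanSuc_atLeastAtMost[symmetric] sum.shift_bounds_Suc_ivl)
    finally show ?thesis by (simp add: B_def)
  qed
  \<comment> \<open>Markov's inequality on A, which has at least 2^(a-e) points: the excess of B
    over T e, taken card A times, already covers the sum of R over all of Y.\<close>
  have "card A * B < (\<Sum>x\<in>A. H x)"
    using A by (subst sum_constant[symmetric]) (rule sum_strict_mono, auto simp: A_def)
  also have "\<dots> \<le> (\<Sum>x\<in>A. T e + R x)" using HR A by (intro sum_mono) auto
  also have "\<dots> = card A * T e + (\<Sum>x\<in>A. R x)" by (simp add: sum.distrib)
  also have "(\<Sum>x\<in>A. R x) \<le> (\<Sum>x\<in>Y. R x)"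
    using assms(1) A nn by (intro sum_mono2) (auto simp: R_def intro!: sum_nonneg)
  also note RY
  also have "2 ^ (a - e) * (2 * (\<Sum>i=e..<a. (1/2) ^ (Suc i - e) * T (Suc i))) \<le> card A * (B - T e)"
  proof (rule mult_mono)
    show "2 ^ (a - e) \<le> real (card A)" using cA by (metis of_nat_le_iff of_nat_numeral of_nat_power)
    show "2 * (\<Sum>i=e..<a. (1/2) ^ (Suc i - e) * T (Suc i)) \<le> B - T e" using Beq T0[of e] by linarith
  qed (use T0 in \<open>auto intro!: sum_nonneg\<close>)
  finally show False by (simp add: algebra_simps)
qed

text \<open>Every residue modulo M occurs exactly k times below M * k. This is what makes links
  equidistributed in their source groups.\<close>

lemma card_mod_le:
  "card {j. j < M * k \<and> P (j mod M)} = k * card {j. j < M \<and> P j}" for M k :: nat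
proof (induction k)
  case (Suc k)
  have "{j. j < M * Suc k \<and> P (j mod M)} = {j. j < M * k \<and> P (j mod M)} \<union> (\<lambda>j. M * k + j) ` {j. j < M \<and> P j}"
  proof (intro set_eqI iffI)
    fix j assume "j \<in> {j. j < M * Suc k \<and> P (j mod M)}"
    then have j: "j < M * Suc k" "P (j mod M)" by auto
    show "j \<in> {j. j < M * k \<and> P (j mod M)} \<union> (\<lambda>j. M * k + j) ` {j. j < M \<and> P j}"
    proof (cases "j < M * k")
      case False
      then have "j = M * k + (j - M * k)" "j - M * k < M" using j by auto
      moreover from this have "j mod M = j - M * k" by (metis mod_less mod_mult_self4)
      ultimately show ?thesis using j by auto
    qed (use j in auto)
  qed (auto intro: less_le_trans)
  then have "card {j. j < M * Suc k \<and> P (j mod M)}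
      = card {j. j < M * k \<and> P (j mod M)} + card ((\<lambda>j. M * k + j) ` {j. j < M \<and> P j})"
    by (subst card_Un_disjoint[symmetric]) auto
  then show ?case using Suc by (simp add: card_image)
qed simp

section \<open>Lacunary families of atoms\<close>

text \<open>The carrier of a space has to be a set of reals, so atom j of group k is coded by a
  natural number; the floor in \<open>grp\<close> and \<open>idx\<close> recovers the code.\<close>

definition pt :: "nat \<Rightarrow> nat \<Rightarrow> real" where
  "pt k j = real (prod_encode (k, j))"

definition grp :: "real \<Rightarrow> nat" where
  "grp x = fst (prod_decode (nat \<lfloor>x\<rfloor>))"

definition idx :: "real \<Rightarrow> nat" where
  "idx x = snd (prod_decode (nat \<lfloor>x\<rfloor>))"

lemma grp_pt [simp]: "grp (pt k j) = k"
  and idx_pt [simp]: "idx (pt k j) = j"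
  by (simp_all add: grp_def idx_def pt_def)

lemma inj_pt: "inj (pt k)"
  by (rule injI) (metis idx_pt)

section \<open>Dyadic sums and geometric series\<close>

lemma geometric_tail_le:
  fixes y :: real
  assumes "0 \<le> y" "y < 1"
  shows "real k * y ^ k \<le> 1 / (1 - y)"
proof -
  have "real k * y ^ k = (\<Sum>j<k. y ^ k)" by simp
  also have "\<dots> \<le> (\<Sum>j<k. y ^ j)" using assms by (intro sum_mono power_decreasing) auto
  also have "\<dots> \<le> 1 / (1 - y)" using assms by (rule geometric_sum_le)
  finally show ?thesis .
qed

lemma obtain_max_power:
  assumes "1 \<le> n" "n \<le> (2::nat) ^ a"
  obtains c where "c \<le> a" "2 ^ c \<le> n" "n < 2 * 2 ^ c" "\<And>c'. 2 ^ c' \<le> n \<Longrightarrow> c' \<le> c"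
proof -
  obtain c where c: "2 ^ c \<le> n" "n < 2 ^ (c + 1)"
    using ex_power_ivl1[of 2 n] assms by auto
  have "c' \<le> c" if "2 ^ c' \<le> n" for c'
  proof -
    have "(2::nat) ^ c' < 2 ^ (c + 1)" using that c by simp
    then show ?thesis by (subst (asm) power_strict_increasing_iff) auto
  qed
  moreover have "c \<le> a"
  proof -
    have "(2::nat) ^ c \<le> 2 ^ a" using c(1) assms(2) by (rule order_trans)
    then show ?thesis by simp
  qed
  ultimately show ?thesis using c that by simp
qed

text \<open>The terms grow geometrically in c, so the sum is comparable to its last term, whose
  index is the integer part of the binary logarithm of n.\<close>

lemma dyadic_powr_sum_le:
  fixes w \<alpha> :: real
  assumes "0 < w" "0 < \<alpha>" "n \<le> 2 ^ a"
  shows "(\<Sum>c\<le>a. if 2 ^ c \<le> n then (w * 2 ^ c) powr \<alpha> else 0)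
     \<le> 1 / (1 - 2 powr - \<alpha>) * (w * real n) powr \<alpha>"
proof (cases "n = 0")
  case False
  then have "1 \<le> n" by simp
  obtain m where m: "m \<le> a" "2 ^ m \<le> n" "n < 2 * 2 ^ m" "\<And>c'. 2 ^ c' \<le> n \<Longrightarrow> c' \<le> m"
    using obtain_max_power[OF \<open>1 \<le> n\<close> assms(3)] by blast
  define x :: real where "x = 2 powr - \<alpha>"
  have x: "0 < x" "x < 1" using assms by (auto simp: x_def powr_less_one)
  have eq: "(w * 2 ^ c) powr \<alpha> = (w * 2 ^ m) powr \<alpha> * x ^ (m - c)" if "c \<le> m" for c
  proof -
    have "x ^ (m - c) = ((1/2) ^ (m - c)) powr \<alpha>"
      by (simp add: x_def powr_minus powr_powr powr_divide power_one_over inverse_eq_divide flip: powr_realpow powr_power)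
    moreover have "(w * 2 ^ m) * (1/2) ^ (m - c) = w * 2 ^ c"
    proof -
      have "(2::real) ^ m = 2 ^ c * 2 ^ (m - c)" using that by (simp flip: power_add)
      then show ?thesis by (simp add: power_one_over field_simps)
    qed
    ultimately have "(w * 2 ^ c) powr \<alpha> = (w * 2 ^ m) powr \<alpha> * ((1/2) ^ (m - c)) powr \<alpha>"
      using assms(1) by (metis powr_mult)
    then show ?thesis by (simp only: \<open>x ^ (m - c) = ((1/2) ^ (m - c)) powr \<alpha>\<close>)
  qed
  have "(\<Sum>c\<le>a. if 2 ^ c \<le> n then (w * 2 ^ c) powr \<alpha> else 0)
      = (\<Sum>c\<le>a. if c \<le> m then (w * 2 ^ c) powr \<alpha> else 0)"
  proof (intro sum.cong refl)
    fix c
    have "2 ^ c \<le> n \<longleftrightarrow> c \<le> m"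
      using m(2,4) by (meson le_trans one_le_numeral power_increasing)
    then show "(if 2 ^ c \<le> n then (w * 2 ^ c) powr \<alpha> else 0) = (if c \<le> m then (w * 2 ^ c) powr \<alpha> else 0)"
      by simp
  qed
  also have "\<dots> = (\<Sum>c\<in>{c \<in> {..a}. c \<le> m}. (w * 2 ^ c) powr \<alpha>)"
    by (rule sum.inter_filter[symmetric]) simp
  also have "{c \<in> {..a}. c \<le> m} = {..m}" using m(1) by auto
  also have "(\<Sum>c\<le>m. (w * 2 ^ c) powr \<alpha>) = (\<Sum>c\<le>m. (w * 2 ^ m) powr \<alpha> * x ^ (m - c))"
    by (intro sum.cong refl eq) simp
  also have "\<dots> = (w * 2 ^ m) powr \<alpha> * (\<Sum>c<Suc m. x ^ c)"
    using sum.nat_diff_reindex[of "\<lambda>e. x ^ e" "Suc m"]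
    by (simp add: lessThan_Suc_atMost flip: sum_distrib_left)
  also have "\<dots> \<le> (w * real n) powr \<alpha> * (1 / (1 - x))"
  proof (rule mult_mono)
    have "(2::real) ^ m \<le> real n" using m(2) by simp
    then show "(w * 2 ^ m) powr \<alpha> \<le> (w * real n) powr \<alpha>"
      using assms by (intro powr_mono2) auto
    show "(\<Sum>c<Suc m. x ^ c) \<le> 1 / (1 - x)" using x by (intro geometric_sum_le) auto
    show "0 \<le> (\<Sum>c<Suc m. x ^ c)" using x by (intro sum_nonneg) auto
  qed simp
  finally show ?thesis by (simp add: x_def mult.commute)
qed (use assms in simp)

section \<open>Powers of extended nonnegative reals\<close>

lemma epow_mono: "x \<le> y \<Longrightarrow> 0 \<le> s \<Longrightarrow> epow x s \<le> epow y s"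
  by (cases x; cases y) (auto simp: epow_def top_unique intro!: ennreal_leI powr_mono2)

lemma epow_ennreal [simp]: "0 \<le> r \<Longrightarrow> epow (ennreal r) s = ennreal (r powr s)"
  by (simp add: epow_def)

lemma epow_top [simp]: "epow top s = top"
  by (simp add: epow_def)

text \<open>Continuity from below. It is needed because distribution functions are computed as
  suprema over the first K groups.\<close>

lemma epow_SUP:
  fixes d :: "nat \<Rightarrow> real"
  assumes "\<And>K. 0 \<le> d K" "0 < \<alpha>"
  shows "epow (SUP K. ennreal (d K)) \<alpha> = (SUP K. ennreal (d K powr \<alpha>))"
proof (rule antisym)
  show "(SUP K. ennreal (d K powr \<alpha>)) \<le> epow (SUP K. ennreal (d K)) \<alpha>"
  proof (rule SUP_least)
    fix K
    have "epow (ennreal (d K)) \<alpha> \<le> epow (SUP K. ennreal (d K)) \<alpha>"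
      using assms by (intro epow_mono SUP_upper) auto
    then show "ennreal (d K powr \<alpha>) \<le> epow (SUP K. ennreal (d K)) \<alpha>" using assms by simp
  qed
  show "epow (SUP K. ennreal (d K)) \<alpha> \<le> (SUP K. ennreal (d K powr \<alpha>))"
  proof (rule dense_le)
    fix y assume y: "y < epow (SUP K. ennreal (d K)) \<alpha>"
    then have "y \<noteq> top" by auto
    then obtain z where z: "y = ennreal z" "0 \<le> z" by (cases y) auto
    have "ennreal (z powr (1/\<alpha>)) < (SUP K. ennreal (d K))"
    proof (cases "(SUP K. ennreal (d K))")
      case (real r)
      then have "z < r powr \<alpha>" using y z by (simp add: ennreal_less_iff)
      then have "z powr (1/\<alpha>) < (r powr \<alpha>) powr (1/\<alpha>)"
        using z assms by (intro powr_less_mono2) auto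
      then show ?thesis using real assms by (simp add: powr_powr ennreal_less_iff)
    qed (simp only: ennreal_less_top)
    then obtain K where "ennreal (z powr (1/\<alpha>)) < ennreal (d K)" by (auto simp: less_SUP_iff)
    then have "z powr (1/\<alpha>) < d K" by (simp add: ennreal_less_iff)
    then have "(z powr (1/\<alpha>)) powr \<alpha> \<le> d K powr \<alpha>" using assms by (intro powr_mono2) auto
    then have "y \<le> ennreal (d K powr \<alpha>)" using z assms by (simp add: powr_powr ennreal_leI)
    then show "y \<le> (SUP K. ennreal (d K powr \<alpha>))" by (rule SUP_upper2[rotated]) simp
  qed
qed

lemma nn_integral_powr_from_0:
  assumes "0 \<le> L" "1 \<le> Q"
  shows "(\<integral>\<^sup>+t. ennreal (indicator {0<..<L} t * t powr (Q - 1)) \<partial>lborel) = ennreal (L powr Q / Q)"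
proof (rule nn_integral_has_integral_lborel)
  have "((\<lambda>x. x powr (Q - 1)) has_integral (L powr Q / Q)) {0..L}"
    using has_integral_powr_from_0[of "Q - 1" L] assms by simp
  then have "((\<lambda>x. x powr (Q - 1)) has_integral (L powr Q / Q)) {0<..<L}"
    by (simp add: has_integral_Icc_iff_Ioo)
  then have "((\<lambda>x. if x \<in> {0<..<L} then x powr (Q - 1) else 0) has_integral (L powr Q / Q)) UNIV"
    by (simp only: has_integral_restrict_UNIV)
  then show "((\<lambda>t. indicator {0<..<L} t * t powr (Q - 1)) has_integral (L powr Q / Q)) UNIV"
    by (rule has_integral_eq[rotated]) (auto simp: indicator_def)
qed auto

text \<open>By \<open>lac\<close>, one atom of group K outweighs each earlier group as a whole by
  the factor 4^K, which leaves room for summing over all K earlier groups.\<close>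

locale lacunary_atoms =
  fixes p :: real and a :: "nat \<Rightarrow> nat" and w :: "nat \<Rightarrow> real"
  assumes p: "1 < p"
    and w_pos: "\<And>k. 0 < w k"
    and lac: "\<And>k K. k < K \<Longrightarrow> 2 ^ a k * w k * 4 ^ K \<le> w K"
begin

definition G :: "nat \<Rightarrow> real set" where "G k = pt k ` {..<2 ^ a k}"

definition X :: "real set" where "X = (\<Union>k. G k)"

definition M :: "real measure" where "M = point_measure X (\<lambda>x. ennreal (w (grp x)))"

text \<open>The quantity t * d(t)^(1/p) at a dyadic order statistic t, with d(t) replaced by the
  mass of 2^c atoms of the group.\<close>

definition lev :: "(real \<Rightarrow> real) \<Rightarrow> nat \<Rightarrow> nat \<Rightarrow> real" where
  "lev g k c = (w k * 2 ^ c) powr (1/p) * nth_largest (G k) g (2 ^ c)"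

abbreviation lev_sum :: "real \<Rightarrow> (real \<Rightarrow> real) \<Rightarrow> nat \<Rightarrow> real" where
  "lev_sum s g K \<equiv> (\<Sum>k<K. \<Sum>c\<le>a k. lev g k c powr s)"

text \<open>The discrete quasinorm is given only through its upper bounds and partial sums, so that
  all arithmetic stays in the reals and infinite values never occur.\<close>

definition lev_norm_le :: "ennreal \<Rightarrow> (real \<Rightarrow> real) \<Rightarrow> real \<Rightarrow> bool" where
  "lev_norm_le q g B \<longleftrightarrow>
     (if q = \<infinity> then \<forall>k. \<forall>c\<le>a k. lev g k c \<le> B
      else \<forall>K. lev_sum (enn2real q) g K \<le> B powr enn2real q)"

lemma finite_G [simp]: "finite (G k)" and card_G [simp]: "card (G k) = 2 ^ a k"
  unfolding G_def using inj_pt[of k] by (auto simp: card_image inj_on_subset)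

lemma grp_G [simp]: "x \<in> G k \<Longrightarrow> grp x = k"
  by (auto simp: G_def)

lemma mem_X_iff: "x \<in> X \<longleftrightarrow> x \<in> G (grp x)"
  by (auto simp: X_def)

lemma G_subset_X: "G k \<subseteq> X" by (auto simp: X_def)

lemma space_M [simp]: "space M = X" and sets_M [simp]: "sets M = Pow X"
  by (simp_all add: M_def space_point_measure sets_point_measure)

lemma emeasure_M_finite:
  "A \<subseteq> X \<Longrightarrow> finite A \<Longrightarrow> emeasure M A = ennreal (\<Sum>x\<in>A. w (grp x))"
  unfolding M_def using w_pos by (simp add: emeasure_point_measure_finite2 less_imp_le)

section \<open>Measures of superlevel sets and their dyadic substitutes\<close>

definition mass :: "(nat \<Rightarrow> nat) \<Rightarrow> nat \<Rightarrow> real" where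
  "mass n K = (\<Sum>k<K. w k * real (n k))"

text \<open>For n = \<open>count g t\<close>, \<open>mass n K\<close> is the measure of {g > t}
  within the first K groups, and this is a substitute for its power \<alpha> that is additive over
  groups and dyadic counts.\<close>

definition levels_mass :: "real \<Rightarrow> (nat \<Rightarrow> nat) \<Rightarrow> nat \<Rightarrow> real" where
  "levels_mass \<alpha> n K = (\<Sum>k<K. \<Sum>c\<le>a k. if 2 ^ c \<le> n k then (w k * 2 ^ c) powr \<alpha> else 0)"

definition count :: "(real \<Rightarrow> real) \<Rightarrow> real \<Rightarrow> nat \<Rightarrow> nat" where
  "count g t k = card {x \<in> G k. t < g x}"

lemma count_le: "count g t k \<le> 2 ^ a k"
  unfolding count_def using card_mono[OF finite_G, of "{x \<in> G k. t < g x}" k] by auto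

lemma count_ge_iff: "c \<le> a k \<Longrightarrow> 2 ^ c \<le> count g t k \<longleftrightarrow> t < nth_largest (G k) g (2 ^ c)"
  unfolding count_def by (subst less_nth_largest_iff) (auto simp: power_increasing)

lemma mass_nonneg [simp]: "0 \<le> mass n K"
  unfolding mass_def using w_pos by (auto intro!: sum_nonneg simp: less_imp_le)

lemma levels_mass_nonneg [simp]: "0 \<le> levels_mass \<alpha> n K"
  unfolding levels_mass_def by (auto intro!: sum_nonneg)

lemma mass_restrict:
  assumes "k < K" "\<And>k'. k < k' \<Longrightarrow> k' < K \<Longrightarrow> n k' = 0"
  shows "mass n K = mass n k + w k * real (n k)"
    and "levels_mass \<alpha> n K = levels_mass \<alpha> n k + (\<Sum>c\<le>a k. if 2 ^ c \<le> n k then (w k * 2 ^ c) powr \<alpha> else 0)"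
proof -
  have *: "(\<Sum>k<K. f k) = (\<Sum>k<k. f k) + f k" if "\<And>k'. k < k' \<Longrightarrow> k' < K \<Longrightarrow> f k' = 0" for f :: "nat \<Rightarrow> real"
  proof -
    have "(\<Sum>k<K. f k) = (\<Sum>k<Suc k. f k)"
      using assms(1) that by (intro sum.mono_neutral_right) (auto simp: not_less Suc_le_eq)
    then show ?thesis by simp
  qed
  show "mass n K = mass n k + w k * real (n k)"
    unfolding mass_def by (rule *) (use assms in auto)
  show "levels_mass \<alpha> n K = levels_mass \<alpha> n k + (\<Sum>c\<le>a k. if 2 ^ c \<le> n k then (w k * 2 ^ c) powr \<alpha> else 0)"
    unfolding levels_mass_def by (rule *) (use assms in auto)
qed

lemma last_group:
  fixes n :: "nat \<Rightarrow> nat"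
  assumes "k0 < K" "n k0 \<noteq> 0"
  obtains k where "k < K" "n k \<noteq> 0" "\<And>k'. k < k' \<Longrightarrow> k' < K \<Longrightarrow> n k' = 0"
proof -
  let ?S = "{k. k < K \<and> n k \<noteq> 0}"
  have "finite ?S" by (rule finite_subset[of _ "{..<K}"]) auto
  moreover have "?S \<noteq> {}" using assms by auto
  ultimately have "Max ?S \<in> ?S" "\<And>k'. k' \<in> ?S \<Longrightarrow> k' \<le> Max ?S" by (auto intro: Max_in simp del: Collect_empty_eq mem_Collect_eq)
  then obtain m where m: "m \<in> ?S" "\<And>k'. k' \<in> ?S \<Longrightarrow> k' \<le> m" by blast
  show ?thesis
  proof (rule that[of m])
    show "n k' = 0" if "m < k'" "k' < K" for k'
      using m(2)[of k'] that by (cases "n k' = 0") auto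
  qed (use m(1) in auto)
qed

lemma group_le: "k < K \<Longrightarrow> 2 ^ a k * w k \<le> w K * (1/4) ^ K"
  using lac[of k K] by (simp add: power_one_over field_simps)

lemma mass_below_le:
  assumes "\<And>k. n k \<le> 2 ^ a k"
  shows "mass n k \<le> w k"
proof -
  have "mass n k \<le> (\<Sum>k'<k. w k * (1/4) ^ k)"
    unfolding mass_def
  proof (intro sum_mono)
    fix i assume i: "i \<in> {..<k}"
    have "real (n i) \<le> 2 ^ a i" using assms[of i] by simp
    then have "w i * real (n i) \<le> 2 ^ a i * w i"
      using w_pos[of i] by (subst mult.commute) (auto intro!: mult_right_mono)
    also have "\<dots> \<le> w k * (1/4) ^ k" using i group_le by auto
    finally show "w i * real (n i) \<le> w k * (1/4) ^ k" .
  qed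
  also have "\<dots> = w k * (real k * (1/4) ^ k)" by simp
  also have "\<dots> \<le> w k * 1"
  proof (intro mult_left_mono)
    have "real k \<le> 4 ^ k" using of_nat_less_two_power[of k] 
      by (smt (verit) power_mono)
    then show "real k * (1/4) ^ k \<le> 1" by (simp add: power_one_over field_simps)
  qed (use w_pos[of k] in auto)
  finally show ?thesis by simp
qed

text \<open>The last nonempty group k dominates: everything below it weighs at most one of its
  atoms, and rounding its count down to a power of 2 costs a factor 2. Together this gives
  3.\<close>

lemma mass_le_level:
  assumes n: "\<And>k. n k \<le> 2 ^ a k" and "0 < mass n K"
  obtains k c where "k < K" "c \<le> a k" "2 ^ c \<le> n k" "mass n K \<le> 3 * (w k * 2 ^ c)"
proof -
  obtain k0 where "k0 < K" "n k0 \<noteq> 0"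
  proof -
    have "\<not> (\<forall>k0<K. n k0 = 0)"
    proof
      assume "\<forall>k0<K. n k0 = 0"
      then have "mass n K = 0" unfolding mass_def by (intro sum.neutral) auto
      then show False using assms(2) by simp
    qed
    then show ?thesis using that by blast
  qed
  then obtain k where k: "k < K" "n k \<noteq> 0" "\<And>k'. k < k' \<Longrightarrow> k' < K \<Longrightarrow> n k' = 0"
    using last_group[of k0 K n] by blast
  obtain c where c: "c \<le> a k" "2 ^ c \<le> n k" "n k < 2 * 2 ^ c"
    using obtain_max_power[of "n k" "a k"] k(2) n by (metis One_nat_def Suc_leI neq0_conv)
  have "mass n K = mass n k + w k * real (n k)" using k by (intro mass_restrict)
  also have "\<dots> \<le> w k * 1 + w k * (2 * 2 ^ c)"
  proof (intro add_mono mult_left_mono)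
    show "real (n k) \<le> 2 * 2 ^ c" using of_nat_mono[OF less_imp_le[OF c(3)], where 'a=real] by simp
  qed (use mass_below_le[OF n] w_pos[of k] in auto)
  also have "\<dots> \<le> 3 * (w k * 2 ^ c)"
  proof -
    have "w k * 1 \<le> w k * 2 ^ c" using w_pos[of k] by (intro mult_left_mono) auto
    then show ?thesis by simp
  qed
  finally show ?thesis using that k c by blast
qed

lemma mass_powr_le:
  assumes n: "\<And>k. n k \<le> 2 ^ a k" and "0 < \<alpha>"
  shows "mass n K powr \<alpha> \<le> 3 powr \<alpha> * levels_mass \<alpha> n K"
proof (cases "mass n K = 0")
  case False
  then have "0 < mass n K" using mass_nonneg[of n K] by linarith
  then obtain k c where k: "k < K" "c \<le> a k" "2 ^ c \<le> n k" "mass n K \<le> 3 * (w k * 2 ^ c)"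
    using mass_le_level[OF n] by blast
  have "mass n K powr \<alpha> \<le> (3 * (w k * 2 ^ c)) powr \<alpha>" using k(4) assms by (intro powr_mono2) auto
  also have "\<dots> = 3 powr \<alpha> * (if 2 ^ c \<le> n k then (w k * 2 ^ c) powr \<alpha> else 0)" using k w_pos[of k] by (simp add: powr_mult)
  also have "\<dots> \<le> 3 powr \<alpha> * (\<Sum>c\<le>a k. if 2 ^ c \<le> n k then (w k * 2 ^ c) powr \<alpha> else 0)"
    using k by (intro mult_left_mono member_le_sum) auto
  also have "\<dots> \<le> 3 powr \<alpha> * levels_mass \<alpha> n K"
    unfolding levels_mass_def using k(1)
    by (intro mult_left_mono member_le_sum[where f="\<lambda>k. \<Sum>c\<le>a k. if 2 ^ c \<le> n k then (w k * 2 ^ c) powr \<alpha> else 0"])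
      (auto intro!: sum_nonneg)
  finally show ?thesis .
qed simp

text \<open>The first factor sums the dyadic counts inside one group. In the bracket, 1 stands for
  the last nonempty group k and the fraction for the k earlier ones, each smaller by
  ((1/4)^\<alpha>)^k.\<close>

definition level_const :: "real \<Rightarrow> real" where
  "level_const \<alpha> = 1 / (1 - 2 powr - \<alpha>) * (1 + 1 / (1 - (1/4) powr \<alpha>))"

lemma level_const_pos: "0 < \<alpha> \<Longrightarrow> 0 < level_const \<alpha>"
  unfolding level_const_def
  by (intro mult_pos_pos add_pos_pos divide_pos_pos) (auto simp: powr_less_one powr01_less_one)

lemma levels_mass_le:
  assumes n: "\<And>k. n k \<le> 2 ^ a k" and \<alpha>: "0 < \<alpha>"
  shows "levels_mass \<alpha> n K \<le> level_const \<alpha> * mass n K powr \<alpha>"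
proof (cases "\<exists>k0<K. n k0 \<noteq> 0")
  case False
  then have "levels_mass \<alpha> n K = 0"
    unfolding levels_mass_def by (auto intro!: sum.neutral)
  then show ?thesis using level_const_pos[OF \<alpha>] by (auto intro!: mult_nonneg_nonneg)
next
  case True
  then obtain k0 where "k0 < K" "n k0 \<noteq> 0" by blast
  then obtain k where k: "k < K" "n k \<noteq> 0" "\<And>k'. k < k' \<Longrightarrow> k' < K \<Longrightarrow> n k' = 0"
    using last_group[of k0 K n] by blast
  define A where "A = 1 / (1 - (2::real) powr - \<alpha>)"
  have A: "0 < A" unfolding A_def using \<alpha> by (auto simp: powr_less_one)
  define y :: real where "y = (1/4) powr \<alpha>"
  have y: "0 < y" "y < 1" using \<alpha> by (auto simp: y_def powr01_less_one)
  have "levels_mass \<alpha> n k \<le> (\<Sum>k'<k. A * (w k powr \<alpha> * y ^ k))"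
    unfolding levels_mass_def
  proof (intro sum_mono)
    fix i assume i: "i \<in> {..<k}"
    have "(\<Sum>c\<le>a i. if 2 ^ c \<le> n i then (w i * 2 ^ c) powr \<alpha> else 0) \<le> A * (w i * real (n i)) powr \<alpha>"
      unfolding A_def using n w_pos \<alpha> by (intro dyadic_powr_sum_le) auto
    also have "\<dots> \<le> A * (w k * (1/4) ^ k) powr \<alpha>"
    proof (intro mult_left_mono powr_mono2)
      have "real (n i) \<le> 2 ^ a i" using n[of i] by simp
      then have "w i * real (n i) \<le> 2 ^ a i * w i"
        using w_pos[of i] by (subst mult.commute) (auto intro!: mult_right_mono)
      also have "\<dots> \<le> w k * (1/4) ^ k" using i group_le by auto
      finally show "w i * real (n i) \<le> w k * (1/4) ^ k" .
      show "0 \<le> w i * real (n i)" using w_pos[of i] by simp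
    qed (use A \<alpha> in auto)
    also have "(w k * (1/4) ^ k) powr \<alpha> = w k powr \<alpha> * y ^ k"
    proof -
      have "((1/4::real) ^ k) powr \<alpha> = y ^ k"
        by (simp add: y_def powr_powr powr_power mult.commute flip: powr_realpow)
      then show ?thesis using w_pos[of k] by (simp add: powr_mult)
    qed
    finally show "(\<Sum>c\<le>a i. if 2 ^ c \<le> n i then (w i * 2 ^ c) powr \<alpha> else 0) \<le> A * (w k powr \<alpha> * y ^ k)" .
  qed
  also have "\<dots> = A * w k powr \<alpha> * (real k * y ^ k)" by simp
  also have "\<dots> \<le> A * w k powr \<alpha> * (1 / (1 - y))"
    using A y by (intro mult_left_mono geometric_tail_le) auto
  also have "\<dots> \<le> A * (w k * real (n k)) powr \<alpha> * (1 / (1 - y))"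
  proof -
    have "w k * 1 \<le> w k * real (n k)" using w_pos[of k] k(2) by (intro mult_left_mono) auto
    then have "w k powr \<alpha> \<le> (w k * real (n k)) powr \<alpha>" using w_pos[of k] \<alpha> by (intro powr_mono2) auto
    then show ?thesis using A y by (intro mult_right_mono mult_left_mono) auto
  qed
  finally have 1: "levels_mass \<alpha> n k \<le> A * (w k * real (n k)) powr \<alpha> * (1 / (1 - y))" .
  have 2: "(\<Sum>c\<le>a k. if 2 ^ c \<le> n k then (w k * 2 ^ c) powr \<alpha> else 0) \<le> A * (w k * real (n k)) powr \<alpha>"
    unfolding A_def using n w_pos \<alpha> by (intro dyadic_powr_sum_le) auto
  have "levels_mass \<alpha> n K \<le> A * (w k * real (n k)) powr \<alpha> * (1 / (1 - y)) + A * (w k * real (n k)) powr \<alpha>"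
    using mass_restrict(2)[OF k(1,3)] 1 2 by simp
  also have "\<dots> = level_const \<alpha> * (w k * real (n k)) powr \<alpha>"
    by (simp add: level_const_def A_def y_def algebra_simps)
  also have "\<dots> \<le> level_const \<alpha> * mass n K powr \<alpha>"
    using mass_restrict(1)[OF k(1,3)] w_pos[of k] \<alpha> level_const_pos[OF \<alpha>]
    by (intro mult_left_mono powr_mono2) auto
  finally show ?thesis .
qed

section \<open>Layer-cake formulas\<close>

lemma nth_largest_nonneg:
  assumes "\<And>x. x \<in> X \<Longrightarrow> 0 \<le> h x" "c \<le> a k"
  shows "0 \<le> nth_largest (G k) h (2 ^ c)"
proof -
  have "nth_largest (G k) h (2 ^ c) \<in> h ` G k"
    using assms by (intro nth_largest_in) (auto simp: power_increasing)
  then show ?thesis using assms(1) G_subset_X[of k] by auto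
qed

lemma lev_nonneg:
  assumes "\<And>x. x \<in> X \<Longrightarrow> 0 \<le> h x" "c \<le> a k"
  shows "0 \<le> lev h k c"
  using nth_largest_nonneg[OF assms] by (simp add: lev_def)

abbreviation layer :: "real \<Rightarrow> real \<Rightarrow> real \<Rightarrow> ennreal" where
  "layer Q t z \<equiv> indicator {0<..} t * ennreal (t powr (Q - 1) * z)"

text \<open>By \<open>count_ge_iff\<close>, the condition on a dyadic count says that t is below an
  order statistic L. Each summand therefore integrates t^(Q-1) over (0, L) and becomes lev^Q /
  Q.\<close>

lemma levels_mass_integral:
  assumes "\<And>x. x \<in> X \<Longrightarrow> 0 \<le> g x" "1 \<le> Q"
  shows "(\<integral>\<^sup>+t. layer Q t (levels_mass (Q/p) (count g t) K) \<partial>lborel)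
     = ennreal (lev_sum Q g K / Q)"
proof -
  have L0: "0 \<le> nth_largest (G k) g (2 ^ c)" if "c \<le> a k" for k c
    using assms(1) that by (rule nth_largest_nonneg)
  have eq: "layer Q t (levels_mass (Q/p) (count g t) K)
     = (\<Sum>k<K. \<Sum>c\<le>a k. ennreal ((w k * 2 ^ c) powr (Q/p)) *
          ennreal (indicator {0<..<nth_largest (G k) g (2 ^ c)} t * t powr (Q - 1)))" for t
  proof (cases "0 < t")
    case True
    have "t powr (Q - 1) * levels_mass (Q/p) (count g t) K
      = (\<Sum>k<K. \<Sum>c\<le>a k. (w k * 2 ^ c) powr (Q/p) * (indicator {0<..<nth_largest (G k) g (2 ^ c)} t * t powr (Q - 1)))"
      unfolding levels_mass_def sum_distrib_left using True
      by (intro sum.cong refl) (simp add: count_ge_iff indicator_def)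
    then show ?thesis using True
      by (simp add: sum_nonneg flip: sum_ennreal ennreal_mult'')
  qed simp
  have "(\<integral>\<^sup>+t. layer Q t (levels_mass (Q/p) (count g t) K) \<partial>lborel)
     = (\<Sum>k<K. \<Sum>c\<le>a k. ennreal ((w k * 2 ^ c) powr (Q/p)) *
         (\<integral>\<^sup>+t. ennreal (indicator {0<..<nth_largest (G k) g (2 ^ c)} t * t powr (Q - 1)) \<partial>lborel))"
    unfolding eq by (simp add: nn_integral_sum nn_integral_cmult)
  also have "\<dots> = (\<Sum>k<K. \<Sum>c\<le>a k. ennreal (lev g k c powr Q / Q))"
  proof (intro sum.cong refl)
    fix k c assume "c \<in> {..a k}"
    then have "0 \<le> nth_largest (G k) g (2 ^ c)" using L0 by simp
    then show "ennreal ((w k * 2 ^ c) powr (Q/p)) *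
         (\<integral>\<^sup>+t. ennreal (indicator {0<..<nth_largest (G k) g (2 ^ c)} t * t powr (Q - 1)) \<partial>lborel)
        = ennreal (lev g k c powr Q / Q)"
      using assms(2) w_pos[of k] unfolding lev_def
      by (simp add: nn_integral_powr_from_0 powr_mult powr_powr flip: ennreal_mult)
  qed
  also have "\<dots> = ennreal (lev_sum Q g K / Q)"
    using assms(2) by (simp add: sum_nonneg sum_divide_distrib flip: sum_ennreal)
  finally show ?thesis .
qed

text \<open>All subsets of X are measurable, so the outer measure is the measure, and the groups
  exhaust X from below.\<close>

lemma distrib_eq_SUP:
  assumes "\<And>x. x \<in> X \<Longrightarrow> 0 \<le> g x" "0 \<le> t"
  shows "distrib M (\<lambda>x. ennreal (g x)) t = (SUP K. ennreal (mass (count g t) K))"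
proof -
  define A where "A K = (\<Union>k<K. {x \<in> G k. t < g x})" for K
  have "{x \<in> space M. ennreal t < ennreal (g x)} = {x \<in> X. t < g x}"
    using assms by (auto simp: ennreal_less_iff)
  moreover have "\<dots> = (\<Union>K. A K)" by (auto simp: A_def X_def)
  moreover have "A K \<subseteq> X" for K using G_subset_X by (auto simp: A_def)
  ultimately have "distrib M (\<lambda>x. ennreal (g x)) t = emeasure M (\<Union>K. A K)"
    unfolding distrib_def by (simp add: UN_least)
  also have "\<dots> = (SUP K. emeasure M (A K))"
    using G_subset_X by (intro SUP_emeasure_incseq[symmetric]) (auto simp: A_def incseq_def intro: less_le_trans)
  also have "\<dots> = (SUP K. ennreal (mass (count g t) K))"
  proof (intro SUP_cong refl)
    fix K
    have "(\<Sum>x\<in>A K. w (grp x)) = (\<Sum>k<K. \<Sum>x\<in>{x \<in> G k. t < g x}. w (grp x))"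
      unfolding A_def
    proof (intro sum.UNION_disjoint ballI impI)
      fix i j :: nat assume "i \<noteq> j"
      then show "{x \<in> G i. t < g x} \<inter> {x \<in> G j. t < g x} = {}"
        using grp_G by blast
    qed auto
    also have "\<dots> = mass (count g t) K"
      unfolding mass_def count_def
    proof (intro sum.cong refl)
      fix k
      have "(\<Sum>x\<in>{x \<in> G k. t < g x}. w (grp x)) = (\<Sum>x\<in>{x \<in> G k. t < g x}. w k)"
        by (intro sum.cong) auto
      then show "(\<Sum>x\<in>{x \<in> G k. t < g x}. w (grp x)) = w k * real (card {x \<in> G k. t < g x})"
        by (simp add: mult.commute)
    qed
    finally show "emeasure M (A K) = ennreal (mass (count g t) K)"
      using \<open>\<And>K. A K \<subseteq> X\<close> by (simp add: emeasure_M_finite A_def)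
  qed
  finally show ?thesis .
qed

abbreviation lorentz_le :: "ennreal \<Rightarrow> (real \<Rightarrow> real) \<Rightarrow> real \<Rightarrow> bool" where
  "lorentz_le q g B \<equiv> lorentz_norm M p q (\<lambda>x. ennreal (g x)) \<le> ennreal B"

lemma lorentz_integrand:
  assumes "0 < t" "1 \<le> Q"
  shows "epow (ennreal t * epow d (1/p)) Q / ennreal t = ennreal (t powr (Q - 1)) * epow d (Q/p)"
proof (cases d)
  case (real r)
  have "t powr Q / t = t powr (Q - 1)" using assms by (simp add: powr_diff)
  then show ?thesis
    using real assms p by (simp add: powr_mult powr_powr divide_ennreal flip: ennreal_mult times_divide_eq_left) simp
next
  case top
  then show ?thesis using assms by (simp add: ennreal_mult_top ennreal_top_divide)
qed

lemma measurable_mass: "(\<lambda>t. mass (count g t) K) \<in> borel_measurable borel"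
proof -
  have "real (count g t k) = (\<Sum>x\<in>G k. if t < g x then 1 else 0)" for t k
    by (simp add: count_def sum.If_cases Int_def)
  then show ?thesis unfolding mass_def by simp
qed

text \<open>Truncation to K groups makes the distribution function real-valued; monotone convergence
  removes the truncation.\<close>

lemma lorentz_norm_eq_SUP:
  assumes g: "\<And>x. x \<in> X \<Longrightarrow> 0 \<le> g x" and q: "q \<noteq> \<infinity>" "1 \<le> enn2real q"
  defines "Q \<equiv> enn2real q"
  shows "lorentz_norm M p q (\<lambda>x. ennreal (g x)) = ennreal (p powr (1/Q)) *
     epow (SUP K. \<integral>\<^sup>+t. layer Q t (mass (count g t) K powr (Q/p)) \<partial>lborel) (1/Q)"
proof -
  have "(\<integral>\<^sup>+ t. indicator {0 <..} t *
           (epow (ennreal t * epow (distrib M (\<lambda>x. ennreal (g x)) t) (1/p)) Q / ennreal t) \<partial>lborel)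
     = (\<integral>\<^sup>+ t. (SUP K. layer Q t (mass (count g t) K powr (Q/p))) \<partial>lborel)"
  proof (intro nn_integral_cong)
    fix t :: real
    show "indicator {0 <..} t *
           (epow (ennreal t * epow (distrib M (\<lambda>x. ennreal (g x)) t) (1/p)) Q / ennreal t)
       = (SUP K. layer Q t (mass (count g t) K powr (Q/p)))"
    proof (cases "0 < t")
      case True
      then have "epow (ennreal t * epow (distrib M (\<lambda>x. ennreal (g x)) t) (1/p)) Q / ennreal t
        = ennreal (t powr (Q - 1)) * (SUP K. ennreal (mass (count g t) K powr (Q/p)))"
        using g q p by (subst lorentz_integrand) (auto simp: Q_def distrib_eq_SUP epow_SUP)
      then show ?thesis using True by (simp add: SUP_mult_left_ennreal flip: ennreal_mult)
    qed simp
  qed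
  also have "\<dots> = (SUP K. \<integral>\<^sup>+ t. layer Q t (mass (count g t) K powr (Q/p)) \<partial>lborel)"
  proof (rule nn_integral_monotone_convergence_SUP)
    show "incseq (\<lambda>K t. layer Q t (mass (count g t) K powr (Q/p)))"
    proof (intro incseq_SucI le_funI mult_left_mono ennreal_leI powr_mono2)
      show "mass (count g t) K \<le> mass (count g t) (Suc K)" for K t
        using w_pos[of K] by (simp add: mass_def)
    qed (use p q Q_def in auto)
    show "(\<lambda>t. layer Q t (mass (count g t) K powr (Q/p))) \<in> borel_measurable lborel" for K
      using measurable_mass[of g K] by measurable
  qed
  finally show ?thesis using q unfolding lorentz_norm_def Q_def by simp
qed

section \<open>Equivalence of the Lorentz quasinorm with the level sums\<close>

lemma lorentz_norm_le_of_lev_norm_le_fin: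
  assumes q: "q \<noteq> \<infinity>" "1 \<le> enn2real q"
  shows "\<exists>C>0. \<forall>g B. (\<forall>x\<in>X. 0 \<le> g x) \<longrightarrow> 0 \<le> B \<longrightarrow> lev_norm_le q g B \<longrightarrow>
     lorentz_le q g (C * B)"
proof -
  define Q where "Q = enn2real q"
  have Q: "1 \<le> Q" using q by (simp add: Q_def)
  define D where "D = 3 powr (Q/p) / Q"
  have D: "0 < D" using Q by (simp add: D_def)
  show ?thesis
  proof (intro exI[of _ "p powr (1/Q) * D powr (1/Q)"] conjI allI impI)
    fix g B assume g: "\<forall>x\<in>X. 0 \<le> g x" and B: "0 \<le> B" "lev_norm_le q g B"
    have "(\<integral>\<^sup>+t. layer Q t (mass (count g t) K powr (Q/p)) \<partial>lborel)
       \<le> ennreal (D * B powr Q)" for K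
    proof -
      have "(\<integral>\<^sup>+t. layer Q t (mass (count g t) K powr (Q/p)) \<partial>lborel)
        \<le> (\<integral>\<^sup>+t. ennreal (3 powr (Q/p)) * (layer Q t (levels_mass (Q/p) (count g t) K)) \<partial>lborel)"
      proof (intro nn_integral_mono)
        fix t :: real
        have "t powr (Q - 1) * mass (count g t) K powr (Q/p) \<le> 3 powr (Q/p) * (t powr (Q - 1) * levels_mass (Q/p) (count g t) K)"
          using mass_powr_le[of "count g t", OF count_le, of "Q/p" K] Q p by (simp add: mult_left_mono mult.left_commute)
        then have "ennreal (t powr (Q - 1) * mass (count g t) K powr (Q/p)) \<le> ennreal (3 powr (Q/p)) * ennreal (t powr (Q - 1) * levels_mass (Q/p) (count g t) K)"
          by (simp add: ennreal_leI flip: ennreal_mult)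
        then show "layer Q t (mass (count g t) K powr (Q/p))
           \<le> ennreal (3 powr (Q/p)) * (layer Q t (levels_mass (Q/p) (count g t) K))"
          by (simp add: indicator_def)
      qed
      also have "\<dots> = ennreal (3 powr (Q/p)) * (\<integral>\<^sup>+t. layer Q t (levels_mass (Q/p) (count g t) K) \<partial>lborel)"
      proof (rule nn_integral_cmult)
        have "levels_mass (Q/p) (count g t) K = (\<Sum>k<K. \<Sum>c\<le>a k. if t < nth_largest (G k) g (2 ^ c) then (w k * 2 ^ c) powr (Q/p) else 0)" for t
          unfolding levels_mass_def by (intro sum.cong refl) (simp add: count_ge_iff)
        then show "(\<lambda>t. layer Q t (levels_mass (Q/p) (count g t) K)) \<in> borel_measurable lborel"
          by simp
      qed
      also have "\<dots> = ennreal (3 powr (Q/p)) * ennreal (lev_sum Q g K / Q)"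
        using g Q by (simp add: levels_mass_integral)
      also have "\<dots> \<le> ennreal (3 powr (Q/p)) * ennreal (B powr Q / Q)"
        using B q Q by (intro mult_left_mono ennreal_leI divide_right_mono) (auto simp: lev_norm_le_def Q_def)
      also have "\<dots> = ennreal (D * B powr Q)"
        using Q by (simp add: D_def flip: ennreal_mult)
      finally show ?thesis .
    qed
    then have "(SUP K. \<integral>\<^sup>+t. layer Q t (mass (count g t) K powr (Q/p)) \<partial>lborel)
       \<le> ennreal (D * B powr Q)" by (rule SUP_least)
    then have "lorentz_norm M p q (\<lambda>x. ennreal (g x)) \<le> ennreal (p powr (1/Q)) * epow (ennreal (D * B powr Q)) (1/Q)"
      using g q Q unfolding Q_def by (subst lorentz_norm_eq_SUP) (auto intro!: mult_left_mono epow_mono)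
    also have "\<dots> = ennreal (p powr (1/Q) * D powr (1/Q) * B)"
      using D Q B p by (simp add: powr_mult powr_powr mult.assoc flip: ennreal_mult)
    finally show "lorentz_le q g (p powr (1/Q) * D powr (1/Q) * B)" .
  qed (use p D in auto)
qed

lemma lev_norm_le_of_lorentz_norm_le_fin:
  assumes q: "q \<noteq> \<infinity>" "1 \<le> enn2real q"
  shows "\<exists>C>0. \<forall>g B. (\<forall>x\<in>X. 0 \<le> g x) \<longrightarrow> 0 \<le> B \<longrightarrow>
     lorentz_le q g B \<longrightarrow> lev_norm_le q g (C * B)"
proof -
  define Q where "Q = enn2real q"
  have Q: "1 \<le> Q" using q by (simp add: Q_def)
  define A where "A = level_const (Q/p)"
  have A: "0 < A" using Q p by (auto simp: A_def intro!: level_const_pos)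
  define D where "D = A * Q / p"
  have D: "0 < D" using Q p A by (simp add: D_def)
  show ?thesis
  proof (intro exI[of _ "D powr (1/Q)"] conjI allI impI)
    fix g B assume g: "\<forall>x\<in>X. 0 \<le> g x" and B: "0 \<le> B" "lorentz_le q g B"
    define I where "I = (SUP K. \<integral>\<^sup>+t. layer Q t (mass (count g t) K powr (Q/p)) \<partial>lborel)"
    have I: "ennreal (p powr (1/Q)) * epow I (1/Q) \<le> ennreal B"
      using B(2) g q unfolding I_def Q_def by (simp add: lorentz_norm_eq_SUP)
    obtain i where i: "I = ennreal i" "0 \<le> i"
    proof (cases I)
      case top
      then have False using I p by (simp add: ennreal_mult_top top_unique)
      then show ?thesis ..
    qed
    have "p powr (1/Q) * i powr (1/Q) \<le> B"
      using I i B by (simp flip: ennreal_mult)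
    then have "(p powr (1/Q) * i powr (1/Q)) powr Q \<le> B powr Q"
      using Q by (intro powr_mono2) auto
    then have pi: "p * i \<le> B powr Q" using p i Q by (simp add: powr_mult powr_powr)
    have "lev_sum Q g K \<le> (D powr (1/Q) * B) powr Q" for K
    proof -
      have "ennreal (lev_sum Q g K / Q)
        = (\<integral>\<^sup>+t. layer Q t (levels_mass (Q/p) (count g t) K) \<partial>lborel)"
        using g Q by (simp add: levels_mass_integral)
      also have "\<dots> \<le> (\<integral>\<^sup>+t. ennreal A * (layer Q t (mass (count g t) K powr (Q/p))) \<partial>lborel)"
      proof (intro nn_integral_mono)
        fix t :: real
        have "t powr (Q - 1) * levels_mass (Q/p) (count g t) K \<le> A * (t powr (Q - 1) * mass (count g t) K powr (Q/p))"
          using mult_left_mono[OF levels_mass_le[of "count g t", OF count_le, of "Q/p" K], of "t powr (Q - 1)"] Q p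
          by (simp add: A_def mult.left_commute)
        then have "ennreal (t powr (Q - 1) * levels_mass (Q/p) (count g t) K) \<le> ennreal A * ennreal (t powr (Q - 1) * mass (count g t) K powr (Q/p))"
          using A by (simp add: ennreal_leI flip: ennreal_mult)
        then show "layer Q t (levels_mass (Q/p) (count g t) K)
          \<le> ennreal A * (layer Q t (mass (count g t) K powr (Q/p)))"
          by (simp add: indicator_def)
      qed
      also have "\<dots> = ennreal A * (\<integral>\<^sup>+t. layer Q t (mass (count g t) K powr (Q/p)) \<partial>lborel)"
      proof (rule nn_integral_cmult)
        show "(\<lambda>t. layer Q t (mass (count g t) K powr (Q/p))) \<in> borel_measurable lborel"
          using measurable_mass[of g K] by measurable
      qed
      also have "\<dots> \<le> ennreal A * I" unfolding I_def by (intro mult_left_mono SUP_upper) auto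
      also have "\<dots> = ennreal (A * i)" using i A by (simp add: ennreal_mult)
      finally have "lev_sum Q g K / Q \<le> A * i"
        using A i by (simp add: ennreal_le_iff)
      then have "lev_sum Q g K \<le> D * (p * i)"
        using Q p by (simp add: D_def field_simps)
      also have "\<dots> \<le> D * B powr Q" using pi D by simp
      also have "\<dots> = (D powr (1/Q) * B) powr Q" using D B Q by (simp add: powr_mult powr_powr)
      finally show ?thesis .
    qed
    then show "lev_norm_le q g (D powr (1/Q) * B)" using q by (simp add: lev_norm_le_def Q_def)
  qed (use D in simp)
qed

lemma lorentz_norm_le_of_lev_norm_le_top:
  "\<exists>C>0. \<forall>g B. (\<forall>x\<in>X. 0 \<le> g x) \<longrightarrow> 0 \<le> B \<longrightarrow> lev_norm_le \<infinity> g B \<longrightarrow>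
     lorentz_le \<infinity> g (C * B)"
proof (intro exI[of _ "3 powr (1/p)"] conjI allI impI)
  fix g B assume g: "\<forall>x\<in>X. 0 \<le> g x" and B: "0 \<le> B" "lev_norm_le \<infinity> g B"
  have "ennreal t * epow (distrib M (\<lambda>x. ennreal (g x)) t) (1/p) \<le> ennreal (3 powr (1/p) * B)" if t: "0 < t" for t
  proof -
    have "ennreal t * ennreal (mass (count g t) K powr (1/p)) \<le> ennreal (3 powr (1/p) * B)" for K
    proof (cases "mass (count g t) K = 0")
      case False
      then have "0 < mass (count g t) K" using mass_nonneg[of "count g t" K] by linarith
      then obtain k c where k: "k < K" "c \<le> a k" "2 ^ c \<le> count g t k" "mass (count g t) K \<le> 3 * (w k * 2 ^ c)"
        using mass_le_level[of "count g t" K, OF count_le] by blast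
      have "t * mass (count g t) K powr (1/p) \<le> nth_largest (G k) g (2 ^ c) * (3 * (w k * 2 ^ c)) powr (1/p)"
        using k t p by (intro mult_mono powr_mono2) (auto simp: count_ge_iff)
      also have "\<dots> = 3 powr (1/p) * lev g k c" using w_pos[of k] by (simp add: lev_def powr_mult)
      also have "\<dots> \<le> 3 powr (1/p) * B" using B k by (intro mult_left_mono) (auto simp: lev_norm_le_def)
      finally show ?thesis using t by (simp add: ennreal_leI flip: ennreal_mult)
    qed simp
    then show ?thesis using t g p by (simp add: distrib_eq_SUP epow_SUP SUP_mult_left_ennreal SUP_least)
  qed
  then show "lorentz_le \<infinity> g (3 powr (1/p) * B)"
    unfolding lorentz_norm_def by (auto intro!: SUP_least)
qed simp

lemma lev_norm_le_of_lorentz_norm_le_top: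
  assumes g: "\<And>x. x \<in> X \<Longrightarrow> 0 \<le> g x" and B: "0 \<le> B" "lorentz_le \<infinity> g B"
  shows "lev_norm_le \<infinity> g B"
proof -
  have "lev g k c \<le> B" if c: "c \<le> a k" for k c
  proof (rule ccontr)
    assume "\<not> ?thesis"
    define L where "L = nth_largest (G k) g (2 ^ c)"
    define s where "s = (w k * 2 ^ c) powr (1/p)"
    have s: "0 < s" using w_pos[of k] by (simp add: s_def)
    have "B / s < L" using \<open>\<not> lev g k c \<le> B\<close> s by (simp add: lev_def L_def s_def field_simps)
    \<comment> \<open>A threshold slightly below the order statistic is exceeded by at least 2^c
      atoms, and t > B / s then contradicts the weak bound.\<close>
    then obtain t where t: "B / s < t" "t < L" using dense by blast
    then have t0: "0 < t" using B s by (smt (verit) divide_nonneg_pos)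
    have "2 ^ c \<le> count g t k" using t c by (simp add: count_ge_iff L_def)
    then have "2 ^ c \<le> real (count g t k)" by simp
    then have "w k * 2 ^ c \<le> w k * real (count g t k)" using w_pos[of k] by (intro mult_left_mono) auto
    also have "\<dots> \<le> mass (count g t) (Suc k)" using mass_nonneg[of "count g t" k] by (simp add: mass_def)
    finally have "ennreal (w k * 2 ^ c) \<le> distrib M (\<lambda>x. ennreal (g x)) t"
      using g t0 by (subst distrib_eq_SUP) (auto intro!: SUP_upper2[of "Suc k"] ennreal_leI)
    then have "epow (ennreal (w k * 2 ^ c)) (1/p) \<le> epow (distrib M (\<lambda>x. ennreal (g x)) t) (1/p)"
      using p by (intro epow_mono) auto
    then have "ennreal t * ennreal s \<le> ennreal t * epow (distrib M (\<lambda>x. ennreal (g x)) t) (1/p)"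
      using w_pos[of k] by (intro mult_left_mono) (simp_all add: s_def)
    also have "\<dots> \<le> ennreal B"
      using B(2) t0 unfolding lorentz_norm_def by (auto simp: SUP_le_iff)
    finally have "t * s \<le> B" using t0 s B by (simp flip: ennreal_mult)
    then show False using t s by (simp add: field_simps)
  qed
  then show ?thesis by (simp add: lev_norm_le_def)
qed

lemma one_le_enn2real: "1 \<le> q \<Longrightarrow> q \<noteq> \<infinity> \<Longrightarrow> 1 \<le> enn2real q"
  by (cases q) auto

lemma lorentz_norm_le_of_lev_norm_le:
  assumes "1 \<le> q"
  shows "\<exists>C>0. \<forall>g B. (\<forall>x\<in>X. 0 \<le> g x) \<longrightarrow> 0 \<le> B \<longrightarrow> lev_norm_le q g B \<longrightarrow>
     lorentz_le q g (C * B)"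
  using lorentz_norm_le_of_lev_norm_le_fin[of q] lorentz_norm_le_of_lev_norm_le_top one_le_enn2real[OF assms] by blast

lemma lev_norm_le_of_lorentz_norm_le:
  assumes "1 \<le> q"
  shows "\<exists>C>0. \<forall>g B. (\<forall>x\<in>X. 0 \<le> g x) \<longrightarrow> 0 \<le> B \<longrightarrow>
     lorentz_le q g B \<longrightarrow> lev_norm_le q g (C * B)"
proof (cases "q = \<infinity>")
  case True
  then show ?thesis using lev_norm_le_of_lorentz_norm_le_top by (intro exI[of _ 1]) auto
qed (use lev_norm_le_of_lorentz_norm_le_fin one_le_enn2real[OF assms] in blast)

end

section \<open>The metric and the maximal operator\<close>

text \<open>\<open>S k\<close> is the set of sources of group \<open>k\<close>, empty unless it is a target. The condition \<open>\<beta> = 1\<close> makes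
  all sources contribute equally to a link average although their masses differ widely.\<close>
locale linked_atoms = lacunary_atoms +
  fixes S :: "nat \<Rightarrow> nat set" and \<beta> :: "nat \<Rightarrow> real"
  assumes S_less: "\<And>k k'. k' \<in> S k \<Longrightarrow> k' < k"
    and a_mono: "\<And>k k'. k' \<in> S k \<Longrightarrow> a k' \<le> a k"
    and \<beta>_pos: "\<And>k. 0 < \<beta> k"
    and group_mass: "\<And>k. (2 ^ a k * w k) powr (1/p) = \<beta> k * w k"
    and \<beta>_source: "\<And>k k'. k' \<in> S k \<Longrightarrow> \<beta> k' = 1"
    and a_ge: "\<And>k. k \<le> a k"
    and lac_powr: "\<And>k K. k < K \<Longrightarrow> (2 ^ a k * w k / w K) powr (1/p) \<le> (1/4) ^ K"
    and lac_powr': "\<And>k K. k < K \<Longrightarrow> (2 ^ a k * w k / w K) powr (1 - 1/p) \<le> (1/4) ^ K"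
begin

text \<open>Here x is the source and y the target. Group sizes are powers of 2, so reducing the
  index modulo the size of the source group gives every source atom equally many targets.\<close>

definition linked :: "real \<Rightarrow> real \<Rightarrow> bool" where
  "linked x y \<longleftrightarrow> grp x \<in> S (grp y) \<and> idx x = idx y mod 2 ^ a (grp x)"

text \<open>The distance from a point to the atoms of its own and of lower groups takes only two values, so a
  ball that contains an unlinked atom contains all of these groups.\<close>
definition \<rho> :: "real \<Rightarrow> real \<Rightarrow> real" where
  "\<rho> x y = (if x = y then 0
    else real (max (grp x) (grp y)) + (if linked x y \<or> linked y x then 1 else 2))"

lemma finite_S [simp]: "finite (S k)"
  using S_less by (intro finite_subset[of "S k" "{..<k}"]) auto

lemma linked_less: "linked x y \<Longrightarrow> grp x < grp y"
  using S_less by (auto simp: linked_def)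

lemma mem_G_grp: "x \<in> X \<Longrightarrow> x \<in> G (grp x)"
  by (simp only: mem_X_iff)

lemma \<rho>_commute: "\<rho> x y = \<rho> y x"
  unfolding \<rho>_def by (auto simp: max.commute)

lemma \<rho>_le: "\<rho> x y \<le> real (max (grp x) (grp y)) + 2"
  unfolding \<rho>_def by auto

lemma \<rho>_ge: "x \<noteq> y \<Longrightarrow> real (max (grp x) (grp y)) + 1 \<le> \<rho> x y"
  unfolding \<rho>_def by auto

text \<open>Two nonzero distances along a path from x to z contribute at least 1 + 1 on top of the
  larger group number of x and z, and a distance never exceeds that number plus 2.\<close>

lemma Metric_space_\<rho>: "Metric_space X \<rho>"
proof
  show "\<rho> x z \<le> \<rho> x y + \<rho> y z" for x y z
  proof (cases "x = y \<or> y = z")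
    case True
    then show ?thesis by (auto simp: \<rho>_def)
  next
    case False
    then show ?thesis
      using \<rho>_le[of x z] \<rho>_ge[of x y] \<rho>_ge[of y z] by (auto simp: max_def split: if_splits)
  qed
qed (auto simp: \<rho>_commute, auto simp: \<rho>_def split: if_splits)

section \<open>Shapes of the balls\<close>

lemma ball_singleton:
  assumes "x \<in> G k" "0 < s" "s \<le> real k + 1"
  shows "ball_in X \<rho> x s = {x}"
proof -
  have "s \<le> \<rho> x y" if "x \<noteq> y" for y
    using \<rho>_ge[OF that] assms by (auto simp: max_def split: if_splits)
  then show ?thesis using assms G_subset_X by (force simp: ball_in_def \<rho>_def)
qed

lemma pt_mem_G: "j < 2 ^ a k \<Longrightarrow> pt k j \<in> G k"
  by (simp add: G_def)

lemma pt_mem_X: "j < 2 ^ a k \<Longrightarrow> pt k j \<in> X"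
  using pt_mem_G G_subset_X by blast

definition links :: "real \<Rightarrow> real set" where
  "links x = (\<lambda>k'. pt k' (idx x mod 2 ^ a k')) ` S (grp x)"

lemma links_subset: "links x \<subseteq> X"
  unfolding links_def using pt_mem_X by auto

lemma finite_links [simp]: "finite (links x)"
  by (simp add: links_def)

lemma self_notin_links: "x \<notin> links x"
proof
  assume "x \<in> links x"
  then obtain k' where "k' \<in> S (grp x)" "x = pt k' (idx x mod 2 ^ a k')" unfolding links_def by blast
  then have "grp x \<in> S (grp x)" by (metis grp_pt)
  then show False using S_less by blast
qed

lemma mem_G_eq: "x \<in> G k \<Longrightarrow> x = pt k (idx x)"
  by (auto simp: G_def)

lemma linked_iff:
  assumes "y \<in> X"
  shows "linked y x \<longleftrightarrow> y \<in> links x"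
proof
  have y: "y = pt (grp y) (idx y)" using assms by (intro mem_G_eq mem_G_grp)
  assume l: "linked y x"
  then have "pt (grp y) (idx y) = pt (grp y) (idx x mod 2 ^ a (grp y))" by (simp add: linked_def)
  with y have "y = pt (grp y) (idx x mod 2 ^ a (grp y))" by (rule trans)
  then show "y \<in> links x" unfolding links_def by (rule image_eqI) (use l in \<open>simp add: linked_def\<close>)
next
  show "y \<in> links x \<Longrightarrow> linked y x"
    unfolding linked_def links_def by auto
qed

lemma sum_links: "(\<Sum>y\<in>links x. h y) = (\<Sum>k'\<in>S (grp x). h (pt k' (idx x mod 2 ^ a k')))"
proof -
  have "inj_on (\<lambda>k'. pt k' (idx x mod 2 ^ a k')) (S (grp x))"
    by (rule inj_onI) (metis grp_pt)
  then show ?thesis unfolding links_def by (simp add: sum.reindex)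
qed

text \<open>Sources of x lie in lower groups, hence at distance k + 1. A target linked to x lies in
  a higher group, at distance at least k + 2, and is excluded by the bound on s.\<close>

lemma ball_links:
  assumes "x \<in> G k" "real k + 1 < s" "s \<le> real k + 2"
  shows "ball_in X \<rho> x s = insert x (links x)"
proof -
  have g: "grp x = k" using assms by simp
  have "\<rho> x y < s \<longleftrightarrow> linked y x" if y: "y \<in> X" "x \<noteq> y" for y
  proof (cases "linked y x")
    case True
    then show ?thesis using linked_less[OF True] assms y by (auto simp: \<rho>_def max_def)
  next
    case False
    show ?thesis
    proof (cases "linked x y")
      case True
      then show ?thesis using linked_less[OF True] assms y False by (auto simp: \<rho>_def max_def)
    next
      case nl: False
      have "real k \<le> real (max (grp x) (grp y))" using g by simp
      then show ?thesis using assms y False nl by (simp add: \<rho>_def)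
    qed
  qed
  moreover have "x \<in> X" "\<rho> x x < s" using assms G_subset_X by (auto simp: \<rho>_def)
  ultimately show ?thesis
    using linked_iff[of _ x] links_subset[of x] self_notin_links[of x] unfolding ball_in_def by auto
qed

text \<open>Groups up to K lie within distance K + 2 of x, groups beyond K + 1 at distance at least
  K + 3. Group K + 1 may be met in part.\<close>

lemma ball_large:
  assumes "x \<in> G k" "k \<le> K" "real K + 2 < s" "s \<le> real K + 3"
  shows "(\<Union>i\<le>K. G i) \<subseteq> ball_in X \<rho> x s" "ball_in X \<rho> x s \<subseteq> (\<Union>i\<le>Suc K. G i)"
proof -
  have g: "grp x = k" using assms by simp
  show "(\<Union>i\<le>K. G i) \<subseteq> ball_in X \<rho> x s"
  proof
    fix y assume "y \<in> (\<Union>i\<le>K. G i)"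
    then have y: "grp y \<le> K" "y \<in> X" using G_subset_X by auto
    have "max (grp x) (grp y) \<le> K" using y g assms(2) by simp
    then have "\<rho> x y \<le> real K + 2" using \<rho>_le[of x y] of_nat_mono[of "max (grp x) (grp y)" K] by (smt (verit))
    then show "y \<in> ball_in X \<rho> x s" using y assms by (simp add: ball_in_def)
  qed
  show "ball_in X \<rho> x s \<subseteq> (\<Union>i\<le>Suc K. G i)"
  proof
    fix y assume "y \<in> ball_in X \<rho> x s"
    then have y: "y \<in> X" "\<rho> x y < s" by (auto simp: ball_in_def)
    have "grp y \<le> Suc K"
    proof (cases "x = y")
      case False
      have "real (grp y) \<le> real (max (grp x) (grp y))" by simp
      then have "real (grp y) < real (Suc (Suc K))" using \<rho>_ge[OF False] y(2) assms(4) by simp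
      then show ?thesis by simp
    qed (use g assms(2) in auto)
    then show "y \<in> (\<Union>i\<le>Suc K. G i)" using mem_G_grp[OF y(1)] by blast
  qed
qed

lemma ball_cases:
  assumes "0 < s"
  obtains "s \<le> real k + 1" | "real k + 1 < s" "s \<le> real k + 2"
    | K where "k \<le> K" "real K + 2 < s" "s \<le> real K + 3"
proof -
  have "\<exists>K\<ge>k. real K + 2 < s \<and> s \<le> real K + 3" if "real k + 2 < s"
  proof -
    define K where "K = nat (\<lceil>s\<rceil> - 3)"
    have "real K + 2 < s" "s \<le> real K + 3" "k \<le> K" using that by (auto simp: K_def) linarith+
    then show ?thesis by blast
  qed
  then show ?thesis using that by force
qed

lemma finite_ball:
  assumes "x \<in> X" "0 < s"
  shows "finite (ball_in X \<rho> x s)"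
proof -
  have x: "x \<in> G (grp x)" using assms(1) by (rule mem_G_grp)
  from assms(2) show ?thesis
  proof (cases rule: ball_cases[of s "grp x"])
    case (3 K)
    show ?thesis using ball_large(2)[OF x 3] by (rule finite_subset) simp
  qed (simp_all only: ball_singleton[OF x assms(2)] ball_links[OF x], simp_all)
qed

lemma ball_subset: "ball_in X \<rho> x s \<subseteq> X"
  by (auto simp: ball_in_def)

lemma emeasure_ball_pos:
  assumes "x \<in> X" "0 < s"
  shows "0 < (\<Sum>y\<in>ball_in X \<rho> x s. w (grp y))"
  using assms w_pos by (intro sum_pos finite_ball) (auto simp: ball_in_def \<rho>_def)

lemma emeasure_ball:
  assumes "x \<in> X" "0 < s"
  shows "emeasure M (ball_in X \<rho> x s) = ennreal (\<Sum>y\<in>ball_in X \<rho> x s. w (grp y))"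
  using assms by (intro emeasure_M_finite finite_ball ball_subset)

section \<open>A metric measure space that is not doubling\<close>

lemma metric_measure_space_X: "metric_measure_space X \<rho> M"
  unfolding metric_measure_space_def
proof (intro conjI ballI allI impI)
  show "X \<noteq> {}" using pt_mem_X[of 0 0] by auto
  show "Metric_space X \<rho>" by (rule Metric_space_\<rho>)
  interpret Metric_space X \<rho> by (rule Metric_space_\<rho>)
  \<comment> \<open>Distinct points are at distance at least 1, so the topology is discrete and the
    Borel sets are all subsets.\<close>
  have "openin mtopology U" if "U \<subseteq> X" for U
    unfolding openin_mtopology
  proof (intro conjI allI impI that exI[of _ 1])
    fix x assume "x \<in> U"
    have "mball x 1 \<subseteq> {x}"
    proof
      fix y assume "y \<in> mball x 1"
      then have "\<rho> x y < 1" by simp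
      then show "y \<in> {x}" using \<rho>_ge[of x y] by (cases "x = y") auto
    qed
    then show "mball x 1 \<subseteq> U" using \<open>x \<in> U\<close> by auto
  qed auto
  moreover have "U \<subseteq> X" if "openin mtopology U" for U using that openin_mtopology by auto
  ultimately have "{U. openin mtopology U} = Pow X" by auto
  then show "sets M = sigma_sets X {U. openin mtopology U}"
    by (simp add: sigma_algebra.sigma_sets_eq sigma_algebra_Pow)
next
  fix x s :: real assume "x \<in> X" "0 < s"
  then show "0 < emeasure M (ball_in X \<rho> x s)" "emeasure M (ball_in X \<rho> x s) < \<infinity>"
    using emeasure_ball_pos emeasure_ball by auto
qed simp

lemma sum_sources_le: "(\<Sum>k'\<in>S k. w k') \<le> w k"
proof -
  have "(\<Sum>k'\<in>S k. w k') \<le> (\<Sum>k'<k. w k')"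
    using S_less w_pos by (intro sum_mono2) (auto simp: less_imp_le)
  also have "\<dots> = mass (\<lambda>_. 1) k" by (simp add: mass_def)
  also have "\<dots> \<le> w k" by (rule mass_below_le) simp
  finally show ?thesis .
qed

lemma sum_sources_nonneg: "0 \<le> (\<Sum>k'\<in>S k. w k')"
  using w_pos by (intro sum_nonneg) (simp add: less_imp_le)

lemma measure_ball_links:
  assumes "x \<in> G k"
  shows "(\<Sum>y\<in>insert x (links x). w (grp y)) = w k + (\<Sum>k'\<in>S k. w k')"
  using assms self_notin_links[of x] by (simp add: sum_links)

text \<open>A ball of radius k + 2 around an atom of group k weighs at most two such atoms, while
  the ball of twice the radius contains all 2^(a k) atoms of the group, and a k >= k is
  unbounded.\<close>

lemma not_doubling_X: "\<not> doubling X \<rho> M"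
proof
  assume "doubling X \<rho> M"
  then obtain C where C: "\<And>x s. x \<in> X \<Longrightarrow> 0 < s \<Longrightarrow>
     emeasure M (ball_in X \<rho> x (2 * s)) \<le> ennreal C * emeasure M (ball_in X \<rho> x s)"
    unfolding doubling_def by blast
  obtain k :: nat where k: "2 * max C 0 < 2 ^ k"
    using real_arch_pow[of 2 "2 * max C 0"] by auto
  define x where "x = pt k 0"
  have x: "x \<in> G k" "x \<in> X" by (simp_all add: x_def pt_mem_G pt_mem_X)
  define s where "s = real k + 2"
  have s: "0 < s" "real (2 * k + 1) + 2 < 2 * s" "2 * s \<le> real (2 * k + 1) + 3" by (auto simp: s_def)
  have "G k \<subseteq> (\<Union>i\<le>2 * k + 1. G i)" by (rule UN_upper) simp
  also have "\<dots> \<subseteq> ball_in X \<rho> x (2 * s)" by (rule ball_large(1)[OF x(1) _ s(2,3)]) simp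
  finally have sub: "G k \<subseteq> ball_in X \<rho> x (2 * s)" .
  have "2 ^ a k * w k = (\<Sum>y\<in>G k. w (grp y))" by simp
  also have "\<dots> \<le> (\<Sum>y\<in>ball_in X \<rho> x (2 * s). w (grp y))"
    using sub w_pos s x by (intro sum_mono2 finite_ball) (auto simp: less_imp_le)
  finally have 1: "2 ^ a k * w k \<le> (\<Sum>y\<in>ball_in X \<rho> x (2 * s). w (grp y))" .
  have "ball_in X \<rho> x s = insert x (links x)" using x by (intro ball_links) (auto simp: s_def)
  then have 2: "(\<Sum>y\<in>ball_in X \<rho> x s. w (grp y)) \<le> 2 * w k"
    using measure_ball_links[OF x(1)] sum_sources_le[of k] by simp
  have "ennreal (2 ^ a k * w k) \<le> ennreal (max C 0) * ennreal (2 * w k)"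
  proof -
    have "ennreal (2 ^ a k * w k) \<le> emeasure M (ball_in X \<rho> x (2 * s))"
      using 1 x s by (simp add: emeasure_ball ennreal_leI)
    also have "\<dots> \<le> ennreal C * emeasure M (ball_in X \<rho> x s)" using C x s by auto
    also have "\<dots> \<le> ennreal (max C 0) * ennreal (2 * w k)"
      using 2 x s by (intro mult_mono ennreal_leI) (auto simp: emeasure_ball ennreal_leI)
    finally show ?thesis .
  qed
  then have "2 ^ a k * w k \<le> max C 0 * (2 * w k)"
    using w_pos[of k] by (simp add: less_imp_le flip: ennreal_mult)
  then have "2 ^ a k \<le> 2 * max C 0" using w_pos[of k] by (simp add: mult.left_commute)
  moreover have "(2::real) ^ k \<le> 2 ^ a k" using a_ge by (intro power_increasing) auto
  ultimately show False using k by linarith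
qed

section \<open>Averages over balls\<close>

lemma nn_integral_finite:
  assumes "B \<subseteq> X" "finite B"
  shows "(\<integral>\<^sup>+y\<in>B. ennreal \<bar>f y\<bar> \<partial>M) = ennreal (\<Sum>y\<in>B. w (grp y) * \<bar>f y\<bar>)"
proof -
  have fin: "finite {x \<in> X. 0 < ennreal (w (grp x)) \<and> 0 < ennreal \<bar>f x\<bar> * indicator B x}"
    using assms(2) by (rule rev_finite_subset) (auto simp: indicator_def split: if_splits)
  have "(\<integral>\<^sup>+y\<in>B. ennreal \<bar>f y\<bar> \<partial>M) =
     (\<Sum>y | y \<in> X \<and> 0 < ennreal (w (grp y)) \<and> 0 < ennreal \<bar>f y\<bar> * indicator B y.
        ennreal (w (grp y)) * (ennreal \<bar>f y\<bar> * indicator B y))"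
    unfolding M_def by (rule nn_integral_point_measure[OF fin])
  also have "\<dots> = (\<Sum>y\<in>B. ennreal (w (grp y)) * ennreal \<bar>f y\<bar>)"
    using assms w_pos by (intro sum.mono_neutral_cong_left) (auto simp: indicator_def split: if_splits)
  also have "\<dots> = ennreal (\<Sum>y\<in>B. w (grp y) * \<bar>f y\<bar>)"
    using w_pos by (simp add: less_imp_le flip: ennreal_mult sum_ennreal)
  finally show ?thesis .
qed

definition ball_avg :: "(real \<Rightarrow> real) \<Rightarrow> real \<Rightarrow> real \<Rightarrow> real" where
  "ball_avg f x s = (\<Sum>y\<in>ball_in X \<rho> x s. w (grp y) * \<bar>f y\<bar>) / (\<Sum>y\<in>ball_in X \<rho> x s. w (grp y))"

lemma max_c_eq:
  assumes "x \<in> X"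
  shows "max_c X \<rho> M f x = (SUP s\<in>{0<..}. ennreal (ball_avg f x s))"
  unfolding max_c_def
proof (intro SUP_cong refl)
  fix s :: real assume "s \<in> {0<..}"
  then have s: "0 < s" by simp
  show "(\<integral>\<^sup>+y\<in>ball_in X \<rho> x s. ennreal \<bar>f y\<bar> \<partial>M) / emeasure M (ball_in X \<rho> x s) = ennreal (ball_avg f x s)"
    unfolding nn_integral_finite[OF ball_subset finite_ball[OF assms s]] emeasure_ball[OF assms s] ball_avg_def
    using emeasure_ball_pos[OF assms s] w_pos
    by (intro divide_ennreal sum_nonneg mult_nonneg_nonneg) (auto simp: less_imp_le)
qed

text \<open>The average over the ball of linked atoms without the value at the centre, normalised by
  the mass of the centre alone. By \<open>sum_sources_le\<close> the ball weighs at most twice as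
  much.\<close>

definition link_avg :: "(real \<Rightarrow> real) \<Rightarrow> real \<Rightarrow> real" where
  "link_avg f x = (\<Sum>k'\<in>S (grp x). w k' * \<bar>f (pt k' (idx x mod 2 ^ a k'))\<bar>) / w (grp x)"

lemma link_avg_nonneg: "0 \<le> link_avg f x"
  unfolding link_avg_def using w_pos by (intro divide_nonneg_pos sum_nonneg mult_nonneg_nonneg) (auto simp: less_imp_le)

lemma le_max_c:
  assumes "x \<in> X"
  shows "ennreal \<bar>f x\<bar> \<le> max_c X \<rho> M f x"
proof -
  have x: "x \<in> G (grp x)" using assms by (rule mem_G_grp)
  have "ball_avg f x 1 = \<bar>f x\<bar>"
    using ball_singleton[OF x, of 1] w_pos[of "grp x"] by (simp add: ball_avg_def)
  then show ?thesis unfolding max_c_eq[OF assms] by (intro SUP_upper2[of 1]) auto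
qed

lemma link_avg_le_max_c:
  assumes "x \<in> X"
  shows "ennreal (link_avg f x / 2) \<le> max_c X \<rho> M f x"
proof -
  define k where "k = grp x"
  have x: "x \<in> G k" using assms unfolding k_def by (rule mem_G_grp)
  define V where "V = (\<Sum>k'\<in>S k. w k' * \<bar>f (pt k' (idx x mod 2 ^ a k'))\<bar>)"
  have V: "0 \<le> V" unfolding V_def using w_pos by (intro sum_nonneg mult_nonneg_nonneg) (auto simp: less_imp_le)
  have b: "ball_in X \<rho> x (real k + 2) = insert x (links x)" using x by (intro ball_links) auto
  have "link_avg f x / 2 = V / (2 * w k)" by (simp add: link_avg_def V_def k_def)
  also have "\<dots> \<le> (w k * \<bar>f x\<bar> + V) / (w k + (\<Sum>k'\<in>S k. w k'))"
    using V w_pos[of k] sum_sources_le[of k] sum_sources_nonneg[of k] by (intro frac_le) auto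
  also have "\<dots> = ball_avg f x (real k + 2)"
    unfolding ball_avg_def b measure_ball_links[OF x]
    using self_notin_links[of x] by (simp add: sum_links V_def k_def)
  finally show ?thesis
    unfolding max_c_eq[OF assms] by (intro SUP_upper2[of "real k + 2"]) (auto intro: ennreal_leI)
qed

text \<open>The three summands correspond to the three kinds of balls in \<open>ball_cases\<close>:
  a single atom, an atom with its links, and the large balls, whose averages are bounded by
  U.\<close>

lemma max_c_le:
  assumes x: "x \<in> G k"
    and U: "\<And>K z. k \<le> K \<Longrightarrow> z \<in> G (Suc K) \<Longrightarrow>
      (\<Sum>i\<le>K. w i * (\<Sum>y\<in>G i. \<bar>f y\<bar>)) / (2 ^ a K * w K) + \<bar>f z\<bar> \<le> U"
  shows "max_c X \<rho> M f x \<le> ennreal (\<bar>f x\<bar> + link_avg f x + U)"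
proof -
  have xX: "x \<in> X" and g: "grp x = k" using x G_subset_X by auto
  have U0: "0 \<le> U"
  proof -
    have "pt (Suc k) 0 \<in> G (Suc k)" by (auto simp: G_def)
    from U[OF order_refl this] show ?thesis
      using w_pos by (smt (verit) divide_nonneg_pos mult_nonneg_nonneg sum_nonneg zero_less_mult_iff zero_less_power)
  qed
  have "ball_avg f x s \<le> \<bar>f x\<bar> + link_avg f x + U" if "0 < s" for s
    using that
  proof (cases rule: ball_cases[of s k])
    case 1
    have "ball_avg f x s = \<bar>f x\<bar>"
      using ball_singleton[OF x that 1] w_pos[of k] g by (simp add: ball_avg_def)
    then show ?thesis using U0 link_avg_nonneg[of f x] by simp
  next
    case 2
    define V where "V = (\<Sum>k'\<in>S k. w k' * \<bar>f (pt k' (idx x mod 2 ^ a k'))\<bar>)"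
    have V: "0 \<le> V" unfolding V_def using w_pos by (intro sum_nonneg mult_nonneg_nonneg) (auto simp: less_imp_le)
    have "ball_avg f x s = (w k * \<bar>f x\<bar> + V) / (w k + (\<Sum>k'\<in>S k. w k'))"
      unfolding ball_avg_def ball_links[OF x 2] measure_ball_links[OF x]
      using self_notin_links[of x] g by (simp add: sum_links V_def)
    also have "\<dots> \<le> (w k * \<bar>f x\<bar> + V) / w k"
      using V w_pos[of k] sum_sources_nonneg[of k] by (intro divide_left_mono) (auto intro: add_pos_nonneg)
    also have "\<dots> = \<bar>f x\<bar> + link_avg f x" using w_pos[of k] g by (simp add: add_divide_distrib V_def link_avg_def)
    finally show ?thesis using U0 by simp
  next
    case (3 K)
    let ?B = "ball_in X \<rho> x s"
    let ?I = "?B \<inter> G (Suc K)"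
    have fin: "finite ?B" using xX that by (rule finite_ball)
    note B = ball_large[OF x 3]
    \<comment> \<open>Which atoms of group K + 1 belong to the ball is left open, so the values
      there are estimated by their maximum, attained at z.\<close>
    define m where "m = Max ((\<lambda>y. \<bar>f y\<bar>) ` G (Suc K))"
    have ne: "G (Suc K) \<noteq> {}" using pt_mem_G[of 0 "Suc K"] by auto
    have "m \<in> (\<lambda>y. \<bar>f y\<bar>) ` G (Suc K)" unfolding m_def using ne by (intro Max_in) auto
    then obtain z where z: "z \<in> G (Suc K)" "m = \<bar>f z\<bar>" by auto
    have mle: "\<bar>f y\<bar> \<le> m" if "y \<in> G (Suc K)" for y unfolding m_def using that by simp
    define T where "T = (\<Sum>i\<le>K. w i * (\<Sum>y\<in>G i. \<bar>f y\<bar>))"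
    have T0: "0 \<le> T" unfolding T_def using w_pos by (intro sum_nonneg mult_nonneg_nonneg) (auto simp: less_imp_le)
    define \<mu> where "\<mu> = (\<Sum>y\<in>?B. w (grp y))"
    have \<mu>1: "2 ^ a K * w K \<le> \<mu>"
    proof -
      have "2 ^ a K * w K = (\<Sum>y\<in>G K. w (grp y))" by simp
      also have "\<dots> \<le> \<mu>" unfolding \<mu>_def using B(1) fin w_pos by (intro sum_mono2) (auto simp: less_imp_le)
      finally show ?thesis .
    qed
    have gm: "0 < 2 ^ a K * w K" using w_pos[of K] by simp
    have \<mu>2: "(\<Sum>y\<in>?I. w (grp y)) \<le> \<mu>"
      unfolding \<mu>_def using fin w_pos by (intro sum_mono2) (auto simp: less_imp_le)
    have "(\<Sum>y\<in>?B. w (grp y) * \<bar>f y\<bar>) = (\<Sum>y\<in>(\<Union>i\<le>K. G i) \<union> ?I. w (grp y) * \<bar>f y\<bar>)"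
    proof -
      have "?B = (\<Union>i\<le>K. G i) \<union> ?I" using B by (auto simp: atMost_Suc)
      then show ?thesis by simp
    qed
    also have "\<dots> = (\<Sum>y\<in>(\<Union>i\<le>K. G i). w (grp y) * \<bar>f y\<bar>) + (\<Sum>y\<in>?I. w (grp y) * \<bar>f y\<bar>)"
    proof (intro sum.union_disjoint)
      show "(\<Union>i\<le>K. G i) \<inter> ?I = {}" by (auto dest!: grp_G)
    qed (use fin in auto)
    also have "(\<Sum>y\<in>(\<Union>i\<le>K. G i). w (grp y) * \<bar>f y\<bar>) = (\<Sum>i\<le>K. \<Sum>y\<in>G i. w (grp y) * \<bar>f y\<bar>)"
    proof (intro sum.UNION_disjoint ballI impI)
      fix i j :: nat assume "i \<noteq> j"
      then show "G i \<inter> G j = {}" using grp_G by blast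
    qed auto
    also have "\<dots> = T" unfolding T_def by (intro sum.cong refl) (simp add: sum_distrib_left)
    also have "(\<Sum>y\<in>?I. w (grp y) * \<bar>f y\<bar>) \<le> (\<Sum>y\<in>?I. w (grp y) * m)"
      using mle w_pos by (intro sum_mono mult_left_mono) (auto simp: less_imp_le)
    also have "\<dots> = (\<Sum>y\<in>?I. w (grp y)) * m" by (simp add: sum_distrib_right)
    also have "\<dots> \<le> \<mu> * m" using \<mu>2 z by (intro mult_right_mono) auto
    finally have "(\<Sum>y\<in>?B. w (grp y) * \<bar>f y\<bar>) \<le> T + \<mu> * m" by simp
    then have "ball_avg f x s \<le> (T + \<mu> * m) / \<mu>"
      unfolding ball_avg_def \<mu>_def[symmetric] using gm \<mu>1 by (intro divide_right_mono) auto
    also have "\<dots> = T / \<mu> + m" using gm \<mu>1 by (simp add: add_divide_distrib)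
    also have "\<dots> \<le> T / (2 ^ a K * w K) + m"
      using gm \<mu>1 T0 by (intro add_right_mono divide_left_mono) auto
    also have "\<dots> \<le> U" using U[OF 3(1) z(1)] z(2) by (simp add: T_def)
    finally show ?thesis using link_avg_nonneg[of f x] by simp
  qed
  then show ?thesis unfolding max_c_eq[OF xX] by (auto intro!: SUP_least ennreal_leI)
qed

end

section \<open>Upper bounds for the maximal operator\<close>

context lacunary_atoms
begin

definition gm :: "nat \<Rightarrow> real" where
  "gm k = 2 ^ a k * w k"

lemma gm_pos: "0 < gm k"
  using w_pos[of k] by (simp add: gm_def)

text \<open>For nonnegative h, up to constants, the weak L^p quasinorm of h on group k.\<close>

definition top_lev :: "(real \<Rightarrow> real) \<Rightarrow> nat \<Rightarrow> real" where
  "top_lev h k = Max (lev h k ` {..a k})"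

lemma lev_le_top_lev: "c \<le> a k \<Longrightarrow> lev h k c \<le> top_lev h k"
  unfolding top_lev_def by auto

lemma top_lev_attained: "\<exists>c\<le>a k. top_lev h k = lev h k c"
proof -
  have "top_lev h k \<in> lev h k ` {..a k}" unfolding top_lev_def by (intro Max_in) auto
  then show ?thesis by auto
qed

lemma top_lev_nonneg:
  assumes "\<And>x. x \<in> X \<Longrightarrow> 0 \<le> h x"
  shows "0 \<le> top_lev h k"
  using lev_nonneg[OF assms] lev_le_top_lev by (meson order_trans zero_le)

lemma card_above_level:
  "c \<le> a k \<Longrightarrow> card {x \<in> G k. nth_largest (G k) h (2 ^ c) < h x} \<le> 2 ^ c"
  using card_above_nth_largest[of "G k" "2 ^ c" h] by (simp add: power_increasing)

lemma gm_powr_le: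
  assumes "i < K" "0 < s" "(gm i / w K) powr s \<le> (1/4) ^ K"
  shows "gm i powr s \<le> (1/4) ^ K * w K powr s"
  using assms gm_pos[of i] w_pos[of K] by (simp add: powr_divide field_simps)

lemma w_le_gm: "w k \<le> gm k"
  using w_pos[of k] by (simp add: gm_def)

text \<open>Hoelder's inequality on a group between weak L^p and the group mass. Since 1 - 1/p > 0,
  the dyadic sum is governed by its largest index.\<close>

lemma group_integral_le:
  assumes h: "\<And>x. x \<in> X \<Longrightarrow> 0 \<le> h x"
  shows "w k * (\<Sum>y\<in>G k. h y) \<le> 2 / (1 - 2 powr (1/p - 1)) * gm k powr (1 - 1/p) * top_lev h k"
proof -
  have s: "0 < 1 - 1/p" using p by simp
  have "(\<Sum>y\<in>G k. h y) \<le> 2 * (\<Sum>i\<le>a k. 2 ^ (a k - i) * nth_largest (G k) h (2 ^ (a k - i)))"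
  proof (rule sum_le_levels)
    show "h x \<le> nth_largest (G k) h (2 ^ (a k - a k))" if "x \<in> G k" for x
      using le_nth_largest_1[OF finite_G that] by simp
  qed (use h in \<open>auto intro!: nth_largest_nonneg card_above_level\<close>)
  also have "(\<Sum>i\<le>a k. 2 ^ (a k - i) * nth_largest (G k) h (2 ^ (a k - i))) = (\<Sum>c\<le>a k. 2 ^ c * nth_largest (G k) h (2 ^ c))"
    by (rule sum_atMost_rev)
  finally have "w k * (\<Sum>y\<in>G k. h y) \<le> w k * (2 * (\<Sum>c\<le>a k. 2 ^ c * nth_largest (G k) h (2 ^ c)))"
    using w_pos[of k] by (intro mult_left_mono) auto
  also have "\<dots> = 2 * (\<Sum>c\<le>a k. (w k * 2 ^ c) powr (1 - 1/p) * lev h k c)"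
  proof -
    have "w k * (2 ^ c * nth_largest (G k) h (2 ^ c)) = (w k * 2 ^ c) powr (1 - 1/p) * lev h k c" for c
      using w_pos[of k] unfolding lev_def by (simp flip: powr_add mult.assoc)
    then have "(\<Sum>c\<le>a k. w k * (2 ^ c * nth_largest (G k) h (2 ^ c))) = (\<Sum>c\<le>a k. (w k * 2 ^ c) powr (1 - 1/p) * lev h k c)"
      by (intro sum.cong refl)
    then show ?thesis by (simp only: sum_distrib_left[symmetric] mult.left_commute[of "w k" 2])
  qed
  also have "\<dots> \<le> 2 * (\<Sum>c\<le>a k. (w k * 2 ^ c) powr (1 - 1/p) * top_lev h k)"
    by (intro mult_left_mono sum_mono lev_le_top_lev) auto
  also have "\<dots> = 2 * (\<Sum>c\<le>a k. (w k * 2 ^ c) powr (1 - 1/p)) * top_lev h k"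
    by (simp add: sum_distrib_right)
  also have "\<dots> \<le> 2 * (1 / (1 - 2 powr - (1 - 1/p)) * gm k powr (1 - 1/p)) * top_lev h k"
  proof (intro mult_right_mono mult_left_mono)
    have "(\<Sum>c\<le>a k. (w k * 2 ^ c) powr (1 - 1/p)) = (\<Sum>c\<le>a k. if 2 ^ c \<le> (2::nat) ^ a k then (w k * 2 ^ c) powr (1 - 1/p) else 0)"
      by (intro sum.cong) auto
    also have "\<dots> \<le> 1 / (1 - 2 powr - (1 - 1/p)) * (w k * real (2 ^ a k)) powr (1 - 1/p)"
      using w_pos s by (intro dyadic_powr_sum_le) auto
    finally show "(\<Sum>c\<le>a k. (w k * 2 ^ c) powr (1 - 1/p)) \<le> 1 / (1 - 2 powr - (1 - 1/p)) * gm k powr (1 - 1/p)"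
      by (simp add: gm_def mult.commute)
  qed (use top_lev_nonneg[OF h] in auto)
  finally show ?thesis by simp
qed

end

context linked_atoms
begin

text \<open>Twice the constant of \<open>group_integral_le\<close>, plus 1 for the value at z in
  \<open>far_bound\<close>.\<close>

definition far_const :: real where
  "far_const = 4 / (1 - 2 powr (1/p - 1)) + 1"

lemma far_const_pos: "0 < far_const"
proof -
  have "2 powr (1/p - 1) < (1::real)" using p by (intro powr_less_one) auto
  then show ?thesis by (simp add: far_const_def add_pos_pos)
qed

text \<open>gm^(-1/p) is the height at which a constant function on the group has top level 1. The
  term (1/2)^k collects the contributions of other groups and is summable in k; it makes
  \<open>far\<close> inhomogeneous, so that it serves normalised functions only.\<close>

definition far :: "(real \<Rightarrow> real) \<Rightarrow> nat \<Rightarrow> real" where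
  "far h k = far_const * gm k powr - (1/p) * (top_lev h k + (1/2) ^ k)"

text \<open>Lacunarity makes group K dominate the integral over the groups up to K. For K > k the
  scale gm K^(-1/p) is smaller than gm k^(-1/p) by at least (1/2)^k, and so is the height of a
  normalised function on group K + 1.\<close>

lemma far_bound:
  assumes h: "\<And>x. x \<in> X \<Longrightarrow> 0 \<le> h x" and le1: "\<And>k c. c \<le> a k \<Longrightarrow> lev h k c \<le> 1"
    and K: "k \<le> K" "z \<in> G (Suc K)"
  shows "(\<Sum>i\<le>K. w i * (\<Sum>y\<in>G i. h y)) / gm K + h z \<le> far h k"
proof -
  let ?t = "\<lambda>k. top_lev h k + (1/2) ^ k" and ?S = "\<Sum>i\<le>K. w i * (\<Sum>y\<in>G i. h y)"
  define A where "A = 2 / (1 - 2 powr (1/p - 1))"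
  have A: "0 < A" using p by (auto simp: A_def powr_less_one)
  have top0: "0 \<le> top_lev h k" for k by (rule top_lev_nonneg[OF h])
  have top1: "top_lev h k \<le> 1" for k using top_lev_attained[of k h] le1 by auto
  have quarter: "(1/4) ^ n \<le> (1/2::real) ^ n" for n by (intro power_mono) auto
  have "?S \<le> (\<Sum>i\<le>K. A * gm i powr (1 - 1/p) * top_lev h i)"
    unfolding A_def by (intro sum_mono group_integral_le h)
  also have "\<dots> = A * (gm K powr (1 - 1/p) * top_lev h K) + (\<Sum>i<K. A * gm i powr (1 - 1/p) * top_lev h i)"
    by (simp flip: lessThan_Suc_atMost)
  also have "\<dots> \<le> A * (gm K powr (1 - 1/p) * top_lev h K) + (\<Sum>i<K. A * ((1/4) ^ K * gm K powr (1 - 1/p)))"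
  proof (intro add_left_mono sum_mono)
    fix i assume "i \<in> {..<K}"
    then have "gm i powr (1 - 1/p) \<le> (1/4) ^ K * w K powr (1 - 1/p)"
      using lac_powr'[of i K] p by (intro gm_powr_le) (auto simp: gm_def)
    also have "\<dots> \<le> (1/4) ^ K * gm K powr (1 - 1/p)"
      using w_le_gm[of K] w_pos[of K] p by (intro mult_left_mono powr_mono2) auto
    finally have "gm i powr (1 - 1/p) * top_lev h i \<le> (1/4) ^ K * gm K powr (1 - 1/p) * 1"
      using top1[of i] top0[of i] by (intro mult_mono) auto
    then show "A * gm i powr (1 - 1/p) * top_lev h i \<le> A * ((1/4) ^ K * gm K powr (1 - 1/p))"
      using A by (simp add: mult.assoc)
  qed
  also have "\<dots> = A * gm K powr (1 - 1/p) * (top_lev h K + real K * (1/4) ^ K)"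
    by (simp add: algebra_simps)
  also have "\<dots> \<le> A * gm K powr (1 - 1/p) * ?t K"
  proof (intro mult_left_mono add_left_mono)
    have "real K \<le> 2 ^ K" using of_nat_less_two_power[of K] by (simp add: less_imp_le)
    then have "real K * (1/4) ^ K \<le> 2 ^ K * (1/4) ^ K" by (intro mult_right_mono) auto
    also have "\<dots> = (1/2) ^ K" by (simp flip: power_mult_distrib)
    finally show "real K * (1/4) ^ K \<le> (1/2) ^ K" .
  qed (use A in auto)
  finally have "?S / gm K \<le> A * gm K powr (1 - 1/p) * ?t K / gm K"
    using gm_pos[of K] by (intro divide_right_mono) auto
  also have "\<dots> = A * gm K powr - (1/p) * ?t K"
    using gm_pos[of K] by (simp add: powr_diff powr_minus field_simps)
  also have "\<dots> \<le> 2 * A * gm k powr - (1/p) * ?t k"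
  proof (cases "K = k")
    case True
    then show ?thesis using A top0 by (simp add: mult_right_mono add_nonneg_nonneg)
  next
    case False
    then have "k < K" using K by simp
    have e: "gm K powr - (1/p) \<le> gm k powr - (1/p) * (1/2) ^ k"
    proof -
      have "gm k powr (1/p) \<le> (1/4) ^ K * w K powr (1/p)"
        using lac_powr[OF \<open>k < K\<close>] \<open>k < K\<close> p by (intro gm_powr_le) (auto simp: gm_def)
      also have "\<dots> \<le> (1/2) ^ k * gm K powr (1/p)"
      proof (intro mult_mono powr_mono2)
        have "(1/2) ^ K \<le> (1/2::real) ^ k" using K by (intro power_decreasing) auto
        then show "(1/4) ^ K \<le> (1/2::real) ^ k" using quarter[of K] by linarith
      qed (use w_le_gm[of K] w_pos[of K] p in auto)
      finally show ?thesis using gm_pos[of k] gm_pos[of K] by (simp add: powr_minus field_simps)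
    qed
    have "A * gm K powr - (1/p) * ?t K \<le> A * (gm k powr - (1/p) * (1/2) ^ k) * 2"
    proof (intro mult_mono mult_left_mono e)
      have "(1/2::real) ^ K \<le> 1" by (intro power_le_one) auto
      then show "top_lev h K + (1/2) ^ K \<le> 2" using top1[of K] by linarith
    qed (use A top0 in \<open>auto intro!: add_nonneg_nonneg\<close>)
    also have "\<dots> = 2 * A * gm k powr - (1/p) * (1/2) ^ k" by simp
    also have "\<dots> \<le> 2 * A * gm k powr - (1/p) * ?t k"
      using A top0 by (intro mult_left_mono) auto
    finally show ?thesis .
  qed
  finally have 1: "?S / gm K \<le> 2 * A * gm k powr - (1/p) * ?t k" .
  have "h z \<le> gm k powr - (1/p) * (1/2) ^ k"
  proof -
    have "k < Suc K" using K by simp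
    have "w (Suc K) powr (1/p) * h z \<le> w (Suc K) powr (1/p) * nth_largest (G (Suc K)) h 1"
      using le_nth_largest_1[OF finite_G K(2)] by (intro mult_left_mono) auto
    also have "\<dots> = lev h (Suc K) 0" by (simp add: lev_def)
    also have "\<dots> \<le> 1" using le1 by simp
    finally have "h z \<le> 1 / w (Suc K) powr (1/p)" using w_pos[of "Suc K"] by (simp add: field_simps)
    moreover have "gm k powr (1/p) \<le> (1/2) ^ k * w (Suc K) powr (1/p)"
    proof -
      have "gm k powr (1/p) \<le> (1/4) ^ Suc K * w (Suc K) powr (1/p)"
        using lac_powr[OF \<open>k < Suc K\<close>] \<open>k < Suc K\<close> p by (intro gm_powr_le) (auto simp: gm_def)
      also have "\<dots> \<le> (1/2) ^ k * w (Suc K) powr (1/p)"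
      proof (intro mult_right_mono)
        have "(1/2) ^ Suc K \<le> (1/2::real) ^ k" using K by (intro power_decreasing) auto
        then show "(1/4) ^ Suc K \<le> (1/2::real) ^ k" using quarter[of "Suc K"] by linarith
      qed auto
      finally show ?thesis .
    qed
    then have "1 / w (Suc K) powr (1/p) \<le> (1/2) ^ k / gm k powr (1/p)"
      using gm_pos[of k] w_pos[of "Suc K"] by (simp add: pos_divide_le_eq pos_le_divide_eq mult.commute)
    ultimately have "h z \<le> (1/2) ^ k / gm k powr (1/p)" by (rule order_trans)
    then show ?thesis by (simp only: powr_minus divide_inverse mult.commute)
  qed
  also have "\<dots> \<le> gm k powr - (1/p) * ?t k"
    using top0 by (intro mult_left_mono) auto
  finally have "?S / gm K + h z
      \<le> (2 * A + 1) * gm k powr - (1/p) * ?t k"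
    using 1 by (simp add: algebra_simps)
  then show ?thesis by (simp add: far_def far_const_def A_def)
qed

section \<open>Dyadic levels of the majorant\<close>

definition majorant :: "(real \<Rightarrow> real) \<Rightarrow> real \<Rightarrow> real" where
  "majorant f x = \<bar>f x\<bar> + link_avg f x + far (\<lambda>x. \<bar>f x\<bar>) (grp x)"

lemma far_nonneg: "(\<And>x. x \<in> X \<Longrightarrow> 0 \<le> h x) \<Longrightarrow> 0 \<le> far h k"
  unfolding far_def using top_lev_nonneg[of h k] far_const_pos by (intro mult_nonneg_nonneg add_nonneg_nonneg) auto

lemma majorant_nonneg: "0 \<le> majorant f x"
  unfolding majorant_def using link_avg_nonneg[of f x] far_nonneg[of "\<lambda>x. \<bar>f x\<bar>"] by simp

lemma max_c_le_majorant:
  assumes "\<And>k c. c \<le> a k \<Longrightarrow> lev (\<lambda>x. \<bar>f x\<bar>) k c \<le> 1" "x \<in> X"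
  shows "max_c X \<rho> M f x \<le> ennreal (majorant f x)"
  unfolding majorant_def
  using far_bound[of "\<lambda>x. \<bar>f x\<bar>", OF _ assms(1)] assms(2)
  by (intro max_c_le[OF mem_G_grp]) (auto simp: gm_def)

text \<open>The level of a source exceeded on the fraction \<open>2\<^sup>-\<^sup>i\<close> of it, rescaled by \<open>2\<^sup>-\<^sup>i\<^sup>/\<^sup>p\<close>. Once this
  fraction is less than an atom (\<open>a k < i\<close>), truncated subtraction selects the maximum.\<close>
definition spread :: "(real \<Rightarrow> real) \<Rightarrow> nat \<Rightarrow> nat \<Rightarrow> real" where
  "spread h k i = 2 powr - (real (i - a k) / p) * lev h k (a k - i)"

text \<open>The levels, at the fraction 2^-i of group k, of the three parts of
  \<open>majorant\<close>: own values, link averages and large balls.\<close>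

definition source :: "(real \<Rightarrow> real) \<Rightarrow> nat \<Rightarrow> nat \<Rightarrow> real" where
  "source h k i = lev h k (a k - i) + \<beta> k * (\<Sum>k'\<in>S k. spread h k' i)
     + far_const * 2 powr - (real i / p) * (top_lev h k + (1/2) ^ k)"

lemma spread_nonneg: "(\<And>x. x \<in> X \<Longrightarrow> 0 \<le> h x) \<Longrightarrow> 0 \<le> spread h k i"
  unfolding spread_def by (intro mult_nonneg_nonneg lev_nonneg) auto

lemma source_nonneg: "(\<And>x. x \<in> X \<Longrightarrow> 0 \<le> h x) \<Longrightarrow> 0 \<le> source h k i"
  unfolding source_def using \<beta>_pos[of k] far_const_pos
  by (intro add_nonneg_nonneg mult_nonneg_nonneg lev_nonneg sum_nonneg spread_nonneg top_lev_nonneg) auto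

text \<open>Lifting a level set from the source to the target multiplies its size by 2^(a k - a k'),
  so its fraction is unchanged. If i > a k', the level is the maximum over the source and is nowhere
  exceeded.\<close>

lemma card_linked_above:
  assumes k': "k' \<in> S k" and i: "i < a k"
  shows "card {x \<in> G k. nth_largest (G k') h (2 ^ (a k' - i)) < h (pt k' (idx x mod 2 ^ a k'))} \<le> 2 ^ (a k - i)"
proof -
  define t where "t = nth_largest (G k') h (2 ^ (a k' - i))"
  have ak: "a k' \<le> a k" using a_mono k' by simp
  have "{x \<in> G k. t < h (pt k' (idx x mod 2 ^ a k'))}
      = pt k ` {j. j < 2 ^ a k' * 2 ^ (a k - a k') \<and> t < h (pt k' (j mod 2 ^ a k'))}"
    using ak by (auto simp: G_def simp flip: power_add)
  then have "card {x \<in> G k. t < h (pt k' (idx x mod 2 ^ a k'))}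
      = card {j. j < 2 ^ a k' * 2 ^ (a k - a k') \<and> t < h (pt k' (j mod 2 ^ a k'))}"
    using inj_pt[of k] by (simp add: card_image inj_on_subset)
  also have "\<dots> = 2 ^ (a k - a k') * card {j. j < 2 ^ a k' \<and> t < h (pt k' j)}"
    by (rule card_mod_le)
  also have "card {j. j < 2 ^ a k' \<and> t < h (pt k' j)} = card {x \<in> G k'. t < h x}"
  proof -
    have "{x \<in> G k'. t < h x} = pt k' ` {j. j < 2 ^ a k' \<and> t < h (pt k' j)}" by (auto simp: G_def)
    then show ?thesis using inj_pt[of k'] by (simp add: card_image inj_on_subset)
  qed
  also have "2 ^ (a k - a k') * card {x \<in> G k'. t < h x} \<le> 2 ^ (a k - i)"
  proof (cases "i \<le> a k'")
    case True
    have "2 ^ (a k - a k') * card {x \<in> G k'. t < h x} \<le> 2 ^ (a k - a k') * 2 ^ (a k' - i)"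
      unfolding t_def by (intro mult_left_mono card_above_level) auto
    also have "\<dots> = 2 ^ (a k - i)" using True ak by (simp flip: power_add)
    finally show ?thesis .
  next
    case False
    then have "a k' - i = 0" by simp
    have "h x \<le> t" if "x \<in> G k'" for x
      using le_nth_largest_1[OF finite_G that, of h] unfolding t_def \<open>a k' - i = 0\<close> by simp
    then have "{x \<in> G k'. t < h x} = {}" by force
    then show ?thesis by (simp only: card.empty)
  qed
  finally show ?thesis by (simp add: t_def)
qed

text \<open>\<open>nth_largest_sum_le\<close> applied to the parts of the majorant. Normalising the
  levels multiplies its kernel 2^-(i-e) by 2^((i-e)/p), which leaves a ratio below 1 because p >
  1.\<close>

lemma lev_majorant_le:
  assumes e: "e \<le> a k"
  shows "lev (majorant f) k (a k - e)
     \<le> 2 * (\<Sum>i=e..a k. (2 powr (1/p - 1)) ^ (i - e) * source (\<lambda>x. \<bar>f x\<bar>) k i)"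
proof -
  define h where "h = (\<lambda>x. \<bar>f x\<bar>)"
  have h0: "0 \<le> h x" for x by (simp add: h_def)
  \<comment> \<open>Index k stands for the own values. Suc k is never a source of k and serves as a
    spare index for the constant part \<open>far\<close>.\<close>
  define I where "I = insert k (insert (Suc k) (S k))"
  define g where "g \<iota> x = (if \<iota> = k then h x else if \<iota> = Suc k then far h k
      else w \<iota> / w k * h (pt \<iota> (idx x mod 2 ^ a \<iota>)))" for \<iota> x
  define \<tau> where "\<tau> \<iota> i = (if \<iota> = k then nth_largest (G k) h (2 ^ (a k - i)) else if \<iota> = Suc k then far h k
      else w \<iota> / w k * nth_largest (G \<iota>) h (2 ^ (a \<iota> - i)))" for \<iota> i
  have notin: "k \<notin> S k" "Suc k \<notin> S k" using S_less by force+
  then have neq: "\<iota> \<noteq> k \<and> \<iota> \<noteq> Suc k" if "\<iota> \<in> S k" for \<iota> using that by auto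
  have sumI: "(\<Sum>\<iota>\<in>I. F \<iota>) = F k + (F (Suc k) + (\<Sum>\<iota>\<in>S k. F \<iota>))" for F :: "nat \<Rightarrow> real"
    unfolding I_def using notin by simp
  have "nth_largest (G k) (majorant f) (2 ^ (a k - e)) \<le> 2 * (\<Sum>i=e..a k. (1/2) ^ (i - e) * (\<Sum>\<iota>\<in>I. \<tau> \<iota> i))"
  proof (rule nth_largest_sum_le[where g=g])
    show "majorant f x \<le> (\<Sum>\<iota>\<in>I. g \<iota> x)" if "x \<in> G k" for x
    proof -
      have "(\<Sum>\<iota>\<in>S k. g \<iota> x) = (\<Sum>\<iota>\<in>S k. w \<iota> / w k * h (pt \<iota> (idx x mod 2 ^ a \<iota>)))"
        by (intro sum.cong) (auto simp: g_def dest: neq)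
      also have "\<dots> = link_avg f x"
        unfolding link_avg_def h_def using that by (simp add: sum_divide_distrib)
      finally show ?thesis unfolding sumI majorant_def using that by (simp add: g_def h_def)
    qed
    show "0 \<le> \<tau> \<iota> i" if "\<iota> \<in> I" for \<iota> i
      using w_pos[of k] w_pos[of \<iota>] h0 unfolding \<tau>_def
      by (auto intro!: nth_largest_nonneg far_nonneg mult_nonneg_nonneg divide_nonneg_pos)
    show "card {x \<in> G k. \<tau> \<iota> i < g \<iota> x} \<le> 2 ^ (a k - i)" if \<iota>I: "\<iota> \<in> I" and that: "i < a k" for \<iota> i
    proof -
      consider "\<iota> = k" | "\<iota> = Suc k" | "\<iota> \<in> S k" using \<iota>I by (auto simp: I_def)
      then show ?thesis
      proof cases
        case 1
        then show ?thesis by (simp add: \<tau>_def g_def card_above_level)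
      next
        case 2
        then show ?thesis by (simp add: \<tau>_def g_def)
      next
        case 3
        have "0 < w \<iota> / w k" using w_pos by simp
        then have "{x \<in> G k. \<tau> \<iota> i < g \<iota> x} = {x \<in> G k. nth_largest (G \<iota>) h (2 ^ (a \<iota> - i)) < h (pt \<iota> (idx x mod 2 ^ a \<iota>))}"
          using neq[OF 3] by (simp only: \<tau>_def g_def if_False mult_less_cancel_left_pos)
        then show ?thesis using card_linked_above[OF 3 that, of h] by simp
      qed
    qed
    show "g \<iota> x \<le> \<tau> \<iota> (a k)" if \<iota>I: "\<iota> \<in> I" and that: "x \<in> G k" for \<iota> x
    proof -
      consider "\<iota> = k" | "\<iota> = Suc k" | "\<iota> \<in> S k" using \<iota>I by (auto simp: I_def)
      then show ?thesis
      proof cases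
        case 1
        then show ?thesis using le_nth_largest_1[OF finite_G that, of h] by (simp add: \<tau>_def g_def)
      next
        case 2
        then show ?thesis by (simp add: \<tau>_def g_def)
      next
        case 3
        have z: "a \<iota> - a k = 0" using a_mono[OF 3] by simp
        have "pt \<iota> (idx x mod 2 ^ a \<iota>) \<in> G \<iota>" by (intro pt_mem_G) simp
        from le_nth_largest_1[OF finite_G this, of h] show ?thesis
          using neq[OF 3] w_pos[of k] w_pos[of \<iota>] by (simp add: \<tau>_def g_def z divide_right_mono)
      qed
    qed
  qed (use e in \<open>simp_all add: I_def\<close>)
  then have "lev (majorant f) k (a k - e)
     \<le> (w k * 2 ^ (a k - e)) powr (1/p) * (2 * (\<Sum>i=e..a k. (1/2) ^ (i - e) * (\<Sum>\<iota>\<in>I. \<tau> \<iota> i)))"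
    unfolding lev_def by (intro mult_left_mono) auto
  also have "\<dots> = 2 * (\<Sum>i=e..a k. (w k * 2 ^ (a k - e)) powr (1/p) * ((1/2) ^ (i - e) * (\<Sum>\<iota>\<in>I. \<tau> \<iota> i)))"
    by (simp add: sum_distrib_left mult.left_commute)
  also have "\<dots> = 2 * (\<Sum>i=e..a k. (2 powr (1/p - 1)) ^ (i - e) * source h k i)"
  proof -
    have "(w k * 2 ^ (a k - e)) powr (1/p) * ((1/2) ^ (i - e) * (\<Sum>\<iota>\<in>I. \<tau> \<iota> i))
       = (2 powr (1/p - 1)) ^ (i - e) * source h k i" if i: "i \<in> {e..a k}" for i
    proof -
      define s where "s = (w k * 2 ^ (a k - i)) powr (1/p)"
      have "(w k * 2 ^ (a k - e)) powr (1/p) = s * 2 powr (real (i - e) / p)"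
      proof -
        have "w k * 2 ^ (a k - e) = (w k * 2 ^ (a k - i)) * 2 ^ (i - e)"
          using i by (simp flip: power_add)
        then show ?thesis using w_pos[of k] by (simp add: s_def powr_mult powr_powr flip: powr_realpow)
      qed
      moreover have "2 powr (real (i - e) / p) * (1/2) ^ (i - e) = (2 powr (1/p - 1)) ^ (i - e)"
        by (simp add: powr_diff power_divide powr_power)
      ultimately have 1: "(w k * 2 ^ (a k - e)) powr (1/p) * (1/2) ^ (i - e) = s * (2 powr (1/p - 1)) ^ (i - e)"
        by (simp only: mult.assoc)
      have s: "s = gm k powr (1/p) * 2 powr - (real i / p)"
      proof -
        have "w k * 2 ^ (a k - i) = gm k * 2 powr - real i"
          using i by (simp add: gm_def power_diff powr_minus powr_realpow field_simps)
        then show ?thesis using gm_pos[of k] by (simp add: s_def powr_mult powr_powr)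
      qed
      have "s * (\<Sum>\<iota>\<in>I. \<tau> \<iota> i) = source h k i"
      proof -
        have o: "s * \<tau> k i = lev h k (a k - i)" by (simp add: s_def \<tau>_def lev_def)
        have u: "s * \<tau> (Suc k) i = far_const * 2 powr - (real i / p) * (top_lev h k + (1/2) ^ k)"
        proof -
          have "gm k powr (1/p) * gm k powr - (1/p) = 1" using gm_pos[of k] by (simp flip: powr_add)
          then show ?thesis unfolding s \<tau>_def far_def by (simp add: mult.left_commute flip: mult.assoc)
        qed
        \<comment> \<open>The masses cancel here: w \<iota> / w k * gm k^(1/p) = \<beta> k * w
          \<iota> by \<open>group_mass\<close>, and w \<iota> = gm \<iota>^(1/p) because \<beta> is
          1 on sources.\<close>
        have l: "s * \<tau> \<iota> i = \<beta> k * spread h \<iota> i" if \<iota>: "\<iota> \<in> S k" for \<iota>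
        proof -
          have wi: "w \<iota> = gm \<iota> powr (1/p)" using group_mass[of \<iota>] \<beta>_source[OF \<iota>] by (simp add: gm_def)
          \<comment> \<open>For i > a \<iota> truncated subtraction stops at a single atom, and the
            last factor supplies the missing power of 2.\<close>
          have "gm \<iota> * 2 powr - real i = w \<iota> * 2 ^ (a \<iota> - i) * 2 powr - real (i - a \<iota>)"
          proof (cases "i \<le> a \<iota>")
            case True
            then show ?thesis by (simp add: gm_def power_diff powr_minus powr_realpow field_simps)
          next
            case False
            then have "2 powr - real i = 2 powr - real (a \<iota>) * (2::real) powr - real (i - a \<iota>)"
              by (simp flip: powr_add)
            then show ?thesis using False by (simp add: gm_def powr_minus powr_realpow field_simps)
          qed
          then have "(gm \<iota> * 2 powr - real i) powr (1/p) = (w \<iota> * 2 ^ (a \<iota> - i) * 2 powr - real (i - a \<iota>)) powr (1/p)"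
            by simp
          then have *: "gm \<iota> powr (1/p) * 2 powr - (real i / p) = (w \<iota> * 2 ^ (a \<iota> - i)) powr (1/p) * 2 powr - (real (i - a \<iota>) / p)"
            using gm_pos[of \<iota>] w_pos[of \<iota>] by (simp add: powr_mult powr_powr)
          have "s * \<tau> \<iota> i = \<beta> k * (gm \<iota> powr (1/p) * 2 powr - (real i / p)) * nth_largest (G \<iota>) h (2 ^ (a \<iota> - i))"
            unfolding s using group_mass[of k] neq[OF \<iota>] w_pos[of k] wi by (simp add: gm_def \<tau>_def)
          also have "\<dots> = \<beta> k * spread h \<iota> i" unfolding * spread_def lev_def by simp
          finally show ?thesis .
        qed
        have "s * (\<Sum>\<iota>\<in>I. \<tau> \<iota> i) = s * \<tau> k i + s * \<tau> (Suc k) i + (\<Sum>\<iota>\<in>S k. s * \<tau> \<iota> i)"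
          unfolding sumI by (simp add: distrib_left sum_distrib_left)
        also have "(\<Sum>\<iota>\<in>S k. s * \<tau> \<iota> i) = \<beta> k * (\<Sum>\<iota>\<in>S k. spread h \<iota> i)"
          using l by (simp add: sum_distrib_left)
        finally show ?thesis unfolding o u source_def by simp
      qed
      then show ?thesis using 1 by (simp add: mult.assoc[symmetric])
    qed
    then show ?thesis by simp
  qed
  finally show ?thesis by (simp add: h_def)
qed

end

section \<open>Homogeneity and monotonicity of the norms\<close>

context lacunary_atoms
begin

lemma lev_cmult:
  assumes "0 < c" "n \<le> a k"
  shows "lev (\<lambda>x. c * h x) k n = c * lev h k n"
  using assms by (simp add: lev_def nth_largest_cmult power_increasing mult.left_commute)

lemma lev_norm_le_cmult:
  assumes h: "\<And>x. x \<in> X \<Longrightarrow> 0 \<le> h x" and c: "0 < c" "0 \<le> B" and le: "lev_norm_le q h B"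
  shows "lev_norm_le q (\<lambda>x. c * h x) (c * B)"
proof (cases "q = \<infinity>")
  case True
  then show ?thesis using le c by (simp add: lev_norm_le_def lev_cmult)
next
  case False
  define Q where "Q = enn2real q"
  have "lev_sum Q (\<lambda>x. c * h x) K \<le> (c * B) powr Q" for K
  proof -
    have "lev_sum Q (\<lambda>x. c * h x) K = (\<Sum>k<K. \<Sum>n\<le>a k. c powr Q * lev h k n powr Q)"
      using c h by (intro sum.cong refl) (simp add: lev_cmult powr_mult lev_nonneg)
    also have "\<dots> = c powr Q * lev_sum Q h K"
      by (simp add: sum_distrib_left)
    also have "\<dots> \<le> c powr Q * B powr Q"
      using le False by (intro mult_left_mono) (auto simp: lev_norm_le_def Q_def)
    also have "\<dots> = (c * B) powr Q" using c by (simp add: powr_mult)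
    finally show ?thesis .
  qed
  then show ?thesis using False by (simp add: lev_norm_le_def Q_def)
qed

lemma lev_le_1:
  assumes "1 \<le> q" "lev_norm_le q h 1" "c \<le> a k"
  shows "lev h k c \<le> 1"
proof (cases "q = \<infinity>")
  case True
  then show ?thesis using assms by (simp add: lev_norm_le_def)
next
  case False
  define Q where "Q = enn2real q"
  have Q: "1 \<le> Q" using one_le_enn2real[OF assms(1) False] by (simp add: Q_def)
  have "lev h k c powr Q \<le> (\<Sum>n\<le>a k. lev h k n powr Q)"
    using assms(3) by (intro member_le_sum) auto
  also have "\<dots> \<le> (\<Sum>k<Suc k. \<Sum>n\<le>a k. lev h k n powr Q)"
    by (simp add: sum_nonneg)
  also have "\<dots> \<le> 1 powr Q" using assms(2) False unfolding lev_norm_le_def Q_def by (metis (no_types))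
  finally have le: "lev h k c powr Q \<le> 1" by simp
  show ?thesis
  proof (rule ccontr)
    assume "\<not> ?thesis"
    then have "1 powr Q < lev h k c powr Q" using Q by (intro powr_less_mono2) auto
    then show False using le by simp
  qed
qed

lemma lorentz_norm_mono:
  assumes "1 \<le> q" "\<And>x. x \<in> X \<Longrightarrow> g x \<le> g' x"
  shows "lorentz_norm M p q g \<le> lorentz_norm M p q g'"
proof -
  have d: "epow (distrib M g t) (1/p) \<le> epow (distrib M g' t) (1/p)" for t
    unfolding distrib_def using assms(2) p
    by (intro epow_mono outer_measure_of_mono) (auto intro: less_le_trans)
  show ?thesis
  proof (cases "q = \<infinity>")
    case True
    have "(SUP t\<in>{0<..}. ennreal t * epow (distrib M g t) (1/p)) \<le> (SUP t\<in>{0<..}. ennreal t * epow (distrib M g' t) (1/p))"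
      by (intro SUP_mono') (simp add: d mult_left_mono)
    then show ?thesis using True by (simp add: lorentz_norm_def)
  next
    case False
    then have "1 \<le> enn2real q" using one_le_enn2real assms by blast
    then show ?thesis using False unfolding lorentz_norm_def
      by (auto intro!: mult_left_mono epow_mono nn_integral_mono divide_right_mono_ennreal d)
  qed
qed

end

section \<open>Norm bounds for the majorant\<close>

context linked_atoms
begin

definition ratio :: real where "ratio = 2 powr (1/p - 1)"

lemma ratio: "0 < ratio" "ratio < 1"
  using p by (auto simp: ratio_def powr_less_one)

lemma powr_spread:
  assumes "\<And>x. x \<in> X \<Longrightarrow> 0 \<le> h x" "0 < Q"
  shows "spread h k i powr Q = (2 powr - (Q/p)) ^ (i - a k) * lev h k (a k - i) powr Q"
  using assms lev_nonneg[of h "a k - i" k]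
  by (simp add: spread_def powr_mult powr_powr powr_power mult.commute)

lemma spread_powr_le:
  assumes "\<And>x. x \<in> X \<Longrightarrow> 0 \<le> h x" "0 < Q"
  shows "spread h k i powr Q \<le> (\<Sum>c\<le>a k. lev h k c powr Q)"
proof -
  have "2 powr - (Q/p) < (1::real)" using assms p by (intro powr_less_one) auto
  then have "(2 powr - (Q/p)) ^ (i - a k) \<le> (1::real)" by (intro power_le_one) auto
  then have "(2 powr - (Q/p)) ^ (i - a k) * lev h k (a k - i) powr Q \<le> 1 * lev h k (a k - i) powr Q"
    by (rule mult_right_mono) simp
  moreover have "spread h k i powr Q = (2 powr - (Q/p)) ^ (i - a k) * lev h k (a k - i) powr Q"
    using assms by (rule powr_spread)
  ultimately have "spread h k i powr Q \<le> 1 * lev h k (a k - i) powr Q" by simp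
  also have "\<dots> \<le> (\<Sum>c\<le>a k. lev h k c powr Q)"
    unfolding mult_1 by (rule member_le_sum) auto
  finally show ?thesis .
qed

text \<open>The 1 accounts for the levels i <= a k, the geometric series for those beyond, where
  \<open>spread\<close> decays from the maximum of the group.\<close>

definition spread_const :: "real \<Rightarrow> real" where
  "spread_const Q = 1 + 1 / (1 - 2 powr - (Q/p))"

lemma sum_spread_powr_le:
  assumes h: "\<And>x. x \<in> X \<Longrightarrow> 0 \<le> h x" and Q: "0 < Q"
  shows "(\<Sum>i\<le>N. spread h k i powr Q) \<le> spread_const Q * (\<Sum>c\<le>a k. lev h k c powr Q)"
proof -
  define x :: real where "x = 2 powr - (Q/p)"
  have x: "0 < x" "x < 1" using Q p by (auto simp: x_def powr_less_one)
  have "(\<Sum>i\<le>N. spread h k i powr Q) \<le> (\<Sum>i\<le>a k + N. spread h k i powr Q)"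
    by (intro sum_mono2) auto
  also have "\<dots> = (\<Sum>i\<le>a k. spread h k i powr Q) + (\<Sum>i=Suc (a k)..a k + N. spread h k i powr Q)"
    by (rule sum_up_index_split)
  also have "(\<Sum>i\<le>a k. spread h k i powr Q) = (\<Sum>i\<le>a k. lev h k (a k - i) powr Q)"
    using powr_spread[of h Q k, OF h Q] by (intro sum.cong) auto
  also have "\<dots> = (\<Sum>c\<le>a k. lev h k c powr Q)"
    by (rule sum_atMost_rev)
  also have "(\<Sum>i=Suc (a k)..a k + N. spread h k i powr Q) = (\<Sum>i=Suc (a k)..a k + N. x ^ (i - a k) * lev h k 0 powr Q)"
    using powr_spread[of h Q k, OF h Q] by (intro sum.cong) (auto simp: x_def)
  also have "\<dots> \<le> (\<Sum>i=a k..a k + N. x ^ (i - a k) * lev h k 0 powr Q)"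
    using x by (intro sum_mono2) auto
  also have "\<dots> \<le> 1 / (1 - x) * lev h k 0 powr Q"
    unfolding sum_distrib_right[symmetric] using x by (intro mult_right_mono geometric_sum_shift_le) auto
  also have "\<dots> \<le> 1 / (1 - x) * (\<Sum>c\<le>a k. lev h k c powr Q)"
    using x by (intro mult_left_mono member_le_sum) auto
  finally show ?thesis by (simp add: spread_const_def x_def algebra_simps)
qed

text \<open>The block structure enters only through \<open>links\<close>, where P k stands for the
  contribution of group k to the Q-th power of the norm of f. Own values and large balls are
  controlled for any links once Q <= R.\<close>

lemma majorant_norm_fin:
  assumes Q: "1 \<le> Q" "Q \<le> R" and B: "0 \<le> B"
    and links: "\<And>P K. (\<And>k. 0 \<le> P k) \<Longrightarrow> (\<And>K. (\<Sum>k<K. P k) \<le> 1) \<Longrightarrow>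
      (\<Sum>k<K. (\<beta> k * real (card (S k)) powr (1 - 1/Q)) powr R * (\<Sum>k'\<in>S k. P k')) \<le> B"
  shows "\<exists>C\<ge>0. \<forall>f. (\<forall>K. lev_sum Q (\<lambda>x. \<bar>f x\<bar>) K \<le> 1) \<longrightarrow>
     (\<forall>K. lev_sum R (majorant f) K \<le> C)"
proof -
  \<comment> \<open>E combines the factor 2 and the convolution of \<open>lev_majorant_le\<close>
    with the splitting into three parts; F is the cost of the large balls. In the final constant, 3
    is 1 for the norm of f plus 2 for the sum of the (1/2)^k.\<close>
  define E where "E = 2 powr R * (1 / (1 - ratio)) powr R * 3 powr (R - 1)"
  define F where "F = far_const powr R * (1 / (1 - 2 powr - (R/p))) * 3 powr (R - 1)"
  define D where "D = E * (1 + spread_const Q + F)"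
  have R: "1 \<le> R" using Q by simp
  have xR: "2 powr - (R/p) < (1::real)" using R p by (intro powr_less_one) auto
  have xQ: "2 powr - (Q/p) < (1::real)" using Q p by (intro powr_less_one) auto
  have E0: "0 \<le> E" by (simp add: E_def)
  have F0: "0 \<le> F" using xR by (simp add: F_def)
  have sc0: "0 \<le> spread_const Q" using xQ by (simp add: spread_const_def)
  have D0: "0 \<le> D" using E0 F0 sc0 by (simp add: D_def)
  show ?thesis
  proof (intro exI[of _ "D * (3 + B)"] conjI allI impI)
    show "0 \<le> D * (3 + B)" using D0 B by simp
    fix f :: "real \<Rightarrow> real" and K :: nat
    define h where "h = (\<lambda>x. \<bar>f x\<bar>)"
    define P where "P k = (\<Sum>c\<le>a k. lev h k c powr Q)" for k
    assume "\<forall>K. lev_sum Q (\<lambda>x. \<bar>f x\<bar>) K \<le> 1"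
    then have P1: "(\<Sum>k<K. P k) \<le> 1" for K by (simp add: P_def h_def)
    have P0: "0 \<le> P k" for k by (auto simp: P_def intro!: sum_nonneg)
    have h0: "0 \<le> h x" for x by (simp add: h_def)
    have norm1: "lev_norm_le (ennreal Q) h 1" using P1 Q by (simp add: lev_norm_le_def P_def)
    have le1: "lev h k c \<le> 1" if "c \<le> a k" for k c
      using lev_le_1[OF _ norm1 that] Q by simp
    have l0: "0 \<le> lev h k c" if "c \<le> a k" for k c using h0 that by (rule lev_nonneg)
    \<comment> \<open>Normalisation puts every level in [0, 1], so raising the exponent from Q to R
      decreases the powers.\<close>
    have levR: "lev h k c powr R \<le> lev h k c powr Q" if "c \<le> a k" for k c
      using le1[OF that] l0[OF that] Q by (intro powr_mono') auto
    have lev1: "lev h k c powr Q \<le> P k" if "c \<le> a k" for k c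
      unfolding P_def using that by (intro member_le_sum) auto
    have PS: "(\<Sum>k'\<in>S k. P k') \<le> 1" for k
    proof -
      have "(\<Sum>k'\<in>S k. P k') \<le> (\<Sum>k'<k. P k')" using S_less P0 by (intro sum_mono2) auto
      then show ?thesis using P1[of k] by simp
    qed
    define b where "b k = (\<beta> k * real (card (S k)) powr (1 - 1/Q)) powr R" for k
    have b0: "0 \<le> b k" for k by (simp add: b_def)
    have group: "(\<Sum>c\<le>a k. lev (majorant f) k c powr R) \<le> D * (P k + b k * (\<Sum>k'\<in>S k. P k') + (1/2) ^ k)" for k
    proof -
      let ?F = "\<lambda>i. far_const * 2 powr - (real i / p) * (top_lev h k + (1/2) ^ k)" and ?P = "\<Sum>k'\<in>S k. P k'"
      let ?s = "\<lambda>i. \<Sum>k'\<in>S k. spread h k' i"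
      have s0: "0 \<le> source h k i" for i by (rule source_nonneg[OF h0])
      have "(\<Sum>c\<le>a k. lev (majorant f) k c powr R) = (\<Sum>e\<le>a k. lev (majorant f) k (a k - e) powr R)"
        by (rule sum_atMost_rev[symmetric])
      also have "\<dots> \<le> (\<Sum>e\<le>a k. (2 * (\<Sum>i=e..a k. ratio ^ (i - e) * source h k i)) powr R)"
        using R lev_majorant_le[of _ k f] majorant_nonneg
        by (intro sum_mono powr_mono2) (auto simp: ratio_def h_def intro!: lev_nonneg)
      also have "\<dots> = 2 powr R * (\<Sum>e\<le>a k. (\<Sum>i=e..a k. ratio ^ (i - e) * source h k i) powr R)"
        using ratio s0 unfolding sum_distrib_left[of "2 powr R"] by (intro sum.cong refl powr_mult)
      also have "\<dots> \<le> 2 powr R * ((1 / (1 - ratio)) powr R * (\<Sum>i\<le>a k. source h k i powr R))"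
        using ratio s0 R by (intro mult_left_mono sum_powr_convolution_le) auto
      also have "(\<Sum>i\<le>a k. source h k i powr R)
         \<le> (\<Sum>i\<le>a k. 3 powr (R - 1) * (lev h k (a k - i) powr R + (\<beta> k * ?s i) powr R
              + (?F i) powr R))"
        unfolding source_def using R \<beta>_pos[of k] far_const_pos h0
        by (intro sum_mono powr_add3_le)
           (auto intro!: lev_nonneg mult_nonneg_nonneg sum_nonneg spread_nonneg top_lev_nonneg add_nonneg_nonneg)
      also have "\<dots> = 3 powr (R - 1) * ((\<Sum>i\<le>a k. lev h k (a k - i) powr R)
           + (\<Sum>i\<le>a k. (\<beta> k * ?s i) powr R)
           + (\<Sum>i\<le>a k. (?F i) powr R))"
        by (simp add: sum.distrib flip: sum_distrib_left)
      also have "\<dots> \<le> 3 powr (R - 1) * (P k + spread_const Q * (b k * ?P) + F * (P k + (1/2) ^ k))"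
      proof (intro mult_left_mono add_mono)
        have "(\<Sum>i\<le>a k. lev h k (a k - i) powr R) = (\<Sum>c\<le>a k. lev h k c powr R)"
          by (rule sum_atMost_rev)
        also have "\<dots> \<le> P k" unfolding P_def using levR by (intro sum_mono) auto
        finally show "(\<Sum>i\<le>a k. lev h k (a k - i) powr R) \<le> P k" .
        \<comment> \<open>Hoelder's inequality over the sources produces Y^(R/Q). Since Y <= 1 and Q
          <= R this is at most Y, which is linear in the contributions of the sources and can be
          summed over i.\<close>
        have "(\<beta> k * ?s i) powr R \<le> b k * (\<Sum>k'\<in>S k. spread h k' i powr Q)" for i
        proof -
          let ?n = "real (card (S k))"
          define Y where "Y = (\<Sum>k'\<in>S k. spread h k' i powr Q)"
          have Y0: "0 \<le> Y" by (simp add: Y_def sum_nonneg)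
          have Y1: "Y \<le> 1"
          proof -
            have "Y \<le> ?P"
              unfolding Y_def P_def using Q h0 by (intro sum_mono spread_powr_le) auto
            then show ?thesis using PS[of k] by simp
          qed
          have sp0: "0 \<le> ?s i" using h0 by (intro sum_nonneg spread_nonneg)
          have "?s i powr Q \<le> ?n powr (Q - 1) * Y"
            unfolding Y_def using Q h0 by (intro powr_sum_le_card spread_nonneg) auto
          then have "(?s i powr Q) powr (1/Q) \<le> (?n powr (Q - 1) * Y) powr (1/Q)"
            using Q by (intro powr_mono2) auto
          then have "?s i \<le> ?n powr (1 - 1/Q) * Y powr (1/Q)"
            using Q sp0 Y0 by (simp add: powr_mult powr_powr diff_divide_distrib)
          then have "(\<beta> k * ?s i) powr R \<le> (\<beta> k * (?n powr (1 - 1/Q) * Y powr (1/Q))) powr R"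
            using R \<beta>_pos[of k] sp0 by (intro powr_mono2 mult_left_mono) auto
          also have "\<dots> = b k * Y powr (R/Q)"
            using \<beta>_pos[of k] Y0 by (simp add: b_def powr_mult powr_powr)
          also have "\<dots> \<le> b k * Y powr 1"
            using Y0 Y1 Q b0 by (intro mult_left_mono powr_mono') auto
          finally show ?thesis using Y0 by (simp add: Y_def)
        qed
        then have "(\<Sum>i\<le>a k. (\<beta> k * ?s i) powr R)
            \<le> (\<Sum>i\<le>a k. b k * (\<Sum>k'\<in>S k. spread h k' i powr Q))" by (intro sum_mono)
        also have "\<dots> = b k * (\<Sum>k'\<in>S k. \<Sum>i\<le>a k. spread h k' i powr Q)"
          by (subst sum.swap) (simp add: sum_distrib_left)
        also have "\<dots> \<le> b k * (\<Sum>k'\<in>S k. spread_const Q * P k')"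
          unfolding P_def using Q h0 b0 by (intro mult_left_mono sum_mono sum_spread_powr_le) auto
        also have "\<dots> = spread_const Q * (b k * ?P)"
          by (simp add: sum_distrib_left mult.left_commute)
        finally show "(\<Sum>i\<le>a k. (\<beta> k * ?s i) powr R) \<le> spread_const Q * (b k * ?P)" .
        have t0: "0 \<le> top_lev h k" by (rule top_lev_nonneg[OF h0])
        have "(\<Sum>i\<le>a k. (?F i) powr R)
           = far_const powr R * (\<Sum>i\<le>a k. (2 powr - (R/p)) ^ i) * (top_lev h k + (1/2) ^ k) powr R"
          using far_const_pos t0
          by (simp add: powr_mult powr_powr powr_power sum_distrib_left sum_distrib_right mult.commute)
        also have "\<dots> \<le> far_const powr R * (1 / (1 - 2 powr - (R/p))) * (3 powr (R - 1) * (P k + (1/2) ^ k))"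
        proof (intro mult_mono mult_left_mono)
          show "(\<Sum>i\<le>a k. (2 powr - (R/p)) ^ i) \<le> 1 / (1 - (2::real) powr - (R/p))"
            unfolding lessThan_Suc_atMost[symmetric] using xR by (intro geometric_sum_le) auto
          have "(top_lev h k + (1/2) ^ k + 0) powr R \<le> 3 powr (R - 1) * (top_lev h k powr R + ((1/2) ^ k) powr R + 0 powr R)"
            using t0 R by (intro powr_add3_le) auto
          also have "\<dots> \<le> 3 powr (R - 1) * (P k + (1/2) ^ k)"
          proof (intro mult_left_mono)
            obtain c where c: "c \<le> a k" "top_lev h k = lev h k c" using top_lev_attained by blast
            have "top_lev h k powr R \<le> P k" using levR[OF c(1)] lev1[OF c(1)] c(2) by simp
            moreover have "((1/2::real) ^ k) powr R \<le> ((1/2) ^ k) powr 1"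
              using R by (intro powr_mono') (auto simp: power_le_one)
            ultimately show "top_lev h k powr R + ((1/2) ^ k) powr R + 0 powr R \<le> P k + (1/2) ^ k" by simp
          qed simp
          finally show "(top_lev h k + (1/2) ^ k) powr R \<le> 3 powr (R - 1) * (P k + (1/2) ^ k)" by simp
        qed (use xR in \<open>auto intro!: mult_nonneg_nonneg sum_nonneg\<close>)
        also have "\<dots> = F * (P k + (1/2) ^ k)" by (simp add: F_def)
        finally show "(\<Sum>i\<le>a k. (?F i) powr R) \<le> F * (P k + (1/2) ^ k)" .
      qed simp
      also have "\<dots> \<le> 3 powr (R - 1) * ((1 + spread_const Q + F) * (P k + b k * ?P + (1/2) ^ k))"
      proof (intro mult_left_mono)
        define T where "T = b k * ?P"
        have T0: "0 \<le> T" unfolding T_def using b0 P0 by (intro mult_nonneg_nonneg sum_nonneg)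
        have "(1 + spread_const Q + F) * (P k + T + (1/2) ^ k)
          = P k + spread_const Q * T + F * (P k + (1/2) ^ k) + (T + (1/2) ^ k + spread_const Q * P k + spread_const Q * (1/2) ^ k + F * T)"
          by (simp add: algebra_simps)
        also have "\<dots> \<ge> P k + spread_const Q * T + F * (P k + (1/2) ^ k)"
          using T0 sc0 F0 P0[of k] by simp
        finally show "P k + spread_const Q * (b k * ?P) + F * (P k + (1/2) ^ k)
           \<le> (1 + spread_const Q + F) * (P k + b k * ?P + (1/2) ^ k)" by (simp add: T_def)
      qed simp
      finally show ?thesis by (simp add: D_def E_def mult.assoc mult_left_mono)
    qed
    have "lev_sum R (majorant f) K
       \<le> (\<Sum>k<K. D * (P k + b k * (\<Sum>k'\<in>S k. P k') + (1/2) ^ k))"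
      by (intro sum_mono group)
    also have "\<dots> = D * ((\<Sum>k<K. P k) + (\<Sum>k<K. b k * (\<Sum>k'\<in>S k. P k')) + (\<Sum>k<K. (1/2) ^ k))"
      by (simp add: sum.distrib flip: sum_distrib_left)
    also have "\<dots> \<le> D * (1 + B + 2)"
      using P1[of K] links[of P K, OF P0 P1] geometric_sum_le[of "1/2" K] D0
      by (intro mult_left_mono add_mono) (auto simp: b_def)
    finally show "lev_sum R (majorant f) K \<le> D * (3 + B)" by (simp add: algebra_simps)
  qed
qed

text \<open>The endpoint r = infinity, with q = infinity allowed. Suprema replace sums over groups,
  so each target is estimated by itself.\<close>

lemma majorant_norm_top:
  assumes q: "1 \<le> q" and B: "0 \<le> B"
    and links: "\<And>k. \<beta> k * real (card (S k)) powr (1 - recip q) \<le> B"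
  shows "\<exists>C\<ge>0. \<forall>f. lev_norm_le q (\<lambda>x. \<bar>f x\<bar>) 1 \<longrightarrow> (\<forall>k. \<forall>c\<le>a k. lev (majorant f) k c \<le> C)"
proof (intro exI[of _ "2 * (1 / (1 - ratio) * (1 + B + far_const * 2))"] conjI allI impI)
  show "0 \<le> 2 * (1 / (1 - ratio) * (1 + B + far_const * 2))"
    using ratio B far_const_pos by simp
  fix f :: "real \<Rightarrow> real" and k c :: nat assume norm1: "lev_norm_le q (\<lambda>x. \<bar>f x\<bar>) 1" and c: "c \<le> a k"
  define h where "h = (\<lambda>x. \<bar>f x\<bar>)"
  have h0: "0 \<le> h x" for x by (simp add: h_def)
  have le1: "lev h k c \<le> 1" if "c \<le> a k" for k c
    using lev_le_1[OF q norm1 that] by (simp add: h_def)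
  have x1: "2 powr - (real i / p) \<le> (1::real)" for i
    using p powr_mono[of "- (real i / p)" 0 2] by simp
  have sp: "(\<Sum>k'\<in>S k. spread h k' i) \<le> real (card (S k)) powr (1 - recip q)" for i
  proof (cases "q = \<infinity>")
    case True
    have "spread h k' i \<le> 1" for k'
    proof -
      have "spread h k' i \<le> 1 * 1"
        unfolding spread_def using x1 le1 h0 by (intro mult_mono) (auto intro!: lev_nonneg)
      then show ?thesis by simp
    qed
    then have "(\<Sum>k'\<in>S k. spread h k' i) \<le> (\<Sum>k'\<in>S k. 1)" by (intro sum_mono)
    then show ?thesis using True by (simp add: recip_def)
  next
    case False
    define Q where "Q = enn2real q"
    have Q: "1 \<le> Q" using one_le_enn2real[OF q False] by (simp add: Q_def)
    have "(\<Sum>k'\<in>S k. spread h k' i) powr Q \<le> real (card (S k)) powr (Q - 1) * (\<Sum>k'\<in>S k. spread h k' i powr Q)"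
      using Q h0 by (intro powr_sum_le_card spread_nonneg) auto
    also have "\<dots> \<le> real (card (S k)) powr (Q - 1) * 1"
    proof (intro mult_left_mono)
      have "(\<Sum>k'\<in>S k. spread h k' i powr Q) \<le> (\<Sum>k'\<in>S k. \<Sum>c\<le>a k'. lev h k' c powr Q)"
        using Q h0 by (intro sum_mono spread_powr_le) auto
      also have "\<dots> \<le> (\<Sum>k'<k. \<Sum>c\<le>a k'. lev h k' c powr Q)"
        using S_less by (intro sum_mono2) (auto intro!: sum_nonneg)
      also have "\<dots> \<le> 1" using norm1 False by (simp add: lev_norm_le_def Q_def h_def)
      finally show "(\<Sum>k'\<in>S k. spread h k' i powr Q) \<le> 1" .
    qed simp
    finally have "((\<Sum>k'\<in>S k. spread h k' i) powr Q) powr (1/Q) \<le> (real (card (S k)) powr (Q - 1)) powr (1/Q)"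
      using Q by (intro powr_mono2) auto
    moreover have "0 \<le> (\<Sum>k'\<in>S k. spread h k' i)" using h0 by (intro sum_nonneg spread_nonneg)
    ultimately show ?thesis
      using Q False by (simp add: powr_powr diff_divide_distrib recip_def Q_def)
  qed
  have src: "source h k i \<le> 1 + B + far_const * 2" for i
    unfolding source_def
  proof (intro add_mono)
    show "lev h k (a k - i) \<le> 1" by (rule le1) simp
    have "\<beta> k * (\<Sum>k'\<in>S k. spread h k' i) \<le> \<beta> k * real (card (S k)) powr (1 - recip q)"
      using sp \<beta>_pos[of k] by (intro mult_left_mono) auto
    then show "\<beta> k * (\<Sum>k'\<in>S k. spread h k' i) \<le> B" using links[of k] by linarith
    have "top_lev h k \<le> 1" using top_lev_attained[of k h] le1 by auto
    moreover have "(1/2::real) ^ k \<le> 1" by (intro power_le_one) auto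
    ultimately have "2 powr - (real i / p) * (top_lev h k + (1/2) ^ k) \<le> 1 * 2"
      using x1[of i] top_lev_nonneg[of h k] h0 by (intro mult_mono) auto
    then have "far_const * (2 powr - (real i / p) * (top_lev h k + (1/2) ^ k)) \<le> far_const * 2"
      using far_const_pos by (intro mult_left_mono) auto
    then show "far_const * 2 powr - (real i / p) * (top_lev h k + (1/2) ^ k) \<le> far_const * 2" by (simp add: mult.assoc)
  qed
  define e where "e = a k - c"
  have "lev (majorant f) k (a k - e) \<le> 2 * (\<Sum>i=e..a k. ratio ^ (i - e) * source h k i)"
    using lev_majorant_le[of e k f] by (simp add: e_def ratio_def h_def)
  also have "\<dots> \<le> 2 * (\<Sum>i=e..a k. ratio ^ (i - e) * (1 + B + far_const * 2))"
    using ratio src by (intro mult_left_mono sum_mono) auto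
  also have "\<dots> = 2 * ((\<Sum>i=e..a k. ratio ^ (i - e)) * (1 + B + far_const * 2))"
    by (simp only: sum_distrib_right)
  also have "\<dots> \<le> 2 * (1 / (1 - ratio) * (1 + B + far_const * 2))"
    using ratio B far_const_pos by (intro mult_left_mono mult_right_mono geometric_sum_shift_le) auto
  finally show "lev (majorant f) k c \<le> 2 * (1 / (1 - ratio) * (1 + B + far_const * 2))"
    using c by (simp add: e_def)
qed

section \<open>From the majorant to the maximal operator\<close>

lemma max_c_scale:
  assumes "x \<in> X" "0 < c"
  shows "max_c X \<rho> M f x \<le> ennreal c * max_c X \<rho> M (\<lambda>x. f x / c) x"
  unfolding max_c_eq[OF assms(1)]
proof (rule SUP_least)
  fix s :: real assume s: "s \<in> {0<..}"
  have "ball_avg f x s = c * ball_avg (\<lambda>x. f x / c) x s"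
    using assms(2) by (simp add: ball_avg_def sum_divide_distrib[symmetric] abs_divide)
  then have "ennreal (ball_avg f x s) = ennreal c * ennreal (ball_avg (\<lambda>x. f x / c) x s)"
    using assms(2) by (simp add: ennreal_mult')
  also have "\<dots> \<le> ennreal c * (SUP s\<in>{0<..}. ennreal (ball_avg (\<lambda>x. f x / c) x s))"
    using s by (intro mult_left_mono SUP_upper) auto
  finally show "ennreal (ball_avg f x s) \<le> ennreal c * (SUP s\<in>{0<..}. ennreal (ball_avg (\<lambda>x. f x / c) x s))" .
qed

text \<open>\<open>majorant\<close> dominates the maximal function only for normalised functions, so
  a general f is first divided by a bound c for its discrete norm.\<close>

lemma max_const_finite:
  assumes q: "1 \<le> q" and r: "1 \<le> r" and C: "0 \<le> C"
    and bd: "\<And>f. lev_norm_le q (\<lambda>x. \<bar>f x\<bar>) 1 \<Longrightarrow> lev_norm_le r (majorant f) C"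
  shows "max_const p q r X \<rho> M < \<infinity>"
proof -
  obtain C1 where C1: "0 < C1" "\<And>g B. (\<forall>x\<in>X. 0 \<le> g x) \<Longrightarrow> 0 \<le> B \<Longrightarrow>
     lorentz_le q g B \<Longrightarrow> lev_norm_le q g (C1 * B)"
    using lev_norm_le_of_lorentz_norm_le[OF q] by blast
  obtain C2 where C2: "0 < C2" "\<And>g B. (\<forall>x\<in>X. 0 \<le> g x) \<Longrightarrow> 0 \<le> B \<Longrightarrow> lev_norm_le r g B \<Longrightarrow>
     lorentz_le r g (C2 * B)"
    using lorentz_norm_le_of_lev_norm_le[OF r] by blast
  define D where "D = C2 * C1 * C"
  have D: "0 \<le> D" using C1 C2 C by (simp add: D_def)
  have key: "lorentz_norm M p r (max_c X \<rho> M f) \<le> ennreal (D * l)"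
    if l: "0 < l" "lorentz_norm M p q (\<lambda>x. ennreal \<bar>f x\<bar>) \<le> ennreal l" for f l
  proof -
    define c where "c = C1 * l"
    have c: "0 < c" using C1 l by (simp add: c_def)
    define f' where "f' = (\<lambda>x. f x / c)"
    have "lev_norm_le q (\<lambda>x. \<bar>f x\<bar>) c" unfolding c_def using l by (intro C1) auto
    then have "lev_norm_le q (\<lambda>x. (1/c) * \<bar>f x\<bar>) ((1/c) * c)"
      using c by (intro lev_norm_le_cmult) auto
    then have n1: "lev_norm_le q (\<lambda>x. \<bar>f' x\<bar>) 1" using c by (simp add: f'_def abs_divide)
    have "max_c X \<rho> M f x \<le> ennreal (c * majorant f' x)" if x: "x \<in> X" for x
    proof -
      have "max_c X \<rho> M f x \<le> ennreal c * max_c X \<rho> M f' x" unfolding f'_def using x c by (rule max_c_scale)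
      also have "\<dots> \<le> ennreal c * ennreal (majorant f' x)"
        using lev_le_1[OF q n1] x by (intro mult_left_mono max_c_le_majorant) auto
      also have "\<dots> = ennreal (c * majorant f' x)" using c majorant_nonneg[of f' x] by (simp add: ennreal_mult)
      finally show ?thesis .
    qed
    then have "lorentz_norm M p r (max_c X \<rho> M f) \<le> lorentz_norm M p r (\<lambda>x. ennreal (c * majorant f' x))"
      by (rule lorentz_norm_mono[OF r])
    also have "\<dots> \<le> ennreal (C2 * (c * C))"
      using c C majorant_nonneg bd[OF n1] by (intro C2 lev_norm_le_cmult) auto
    also have "C2 * (c * C) = D * l" by (simp add: D_def c_def)
    finally show ?thesis .
  qed
  have "lorentz_norm M p r (max_c X \<rho> M f) \<le> ennreal D * lorentz_norm M p q (\<lambda>x. ennreal \<bar>f x\<bar>)"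
    if fin: "lorentz_norm M p q (\<lambda>x. ennreal \<bar>f x\<bar>) < \<infinity>" for f
  proof -
    obtain \<nu> where \<nu>: "lorentz_norm M p q (\<lambda>x. ennreal \<bar>f x\<bar>) = ennreal \<nu>" "0 \<le> \<nu>"
      using fin by (cases "lorentz_norm M p q (\<lambda>x. ennreal \<bar>f x\<bar>)") auto
    have "lorentz_norm M p r (max_c X \<rho> M f) \<le> ennreal (D * \<nu>)"
    proof (rule ennreal_le_epsilon)
      fix e :: real assume e: "0 < e"
      \<comment> \<open>Enlarging the norm slightly permits division by l even when the norm is 0.
        The increment costs at most e after multiplication by D.\<close>
      define l where "l = \<nu> + e / (D + 1)"
      have "D * (e / (D + 1)) \<le> e" using D e by (simp add: field_simps)
      then have "D * l \<le> D * \<nu> + e" by (simp add: l_def distrib_left)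
      moreover have "lorentz_norm M p r (max_c X \<rho> M f) \<le> ennreal (D * l)"
        using \<nu> e D by (intro key) (auto simp: l_def intro!: ennreal_leI add_nonneg_pos)
      ultimately have "lorentz_norm M p r (max_c X \<rho> M f) \<le> ennreal (D * \<nu> + e)"
        by (meson ennreal_leI order_trans)
      then show "lorentz_norm M p r (max_c X \<rho> M f) \<le> ennreal (D * \<nu>) + ennreal e"
        using D \<nu> e by simp
    qed
    then show ?thesis using \<nu> D by (simp add: ennreal_mult)
  qed
  then have "max_const p q r X \<rho> M \<le> ennreal D"
    unfolding max_const_def by (intro Inf_lower) auto
  then show ?thesis by (simp add: le_less_trans[OF _ ennreal_less_top])
qed

section \<open>Lower bounds for the maximal operator\<close>

text \<open>On each group of A this is the constant whose level at c = a k is 1, with geometric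
  decay for smaller c; its norm is comparable to card A ^ (1/q).\<close>

definition test_fun :: "nat set \<Rightarrow> real \<Rightarrow> real" where
  "test_fun A x = (if grp x \<in> A then gm (grp x) powr - (1/p) else 0)"

lemma test_fun_nonneg: "0 \<le> test_fun A x"
  by (simp add: test_fun_def)

lemma lev_test_fun:
  assumes "c \<le> a k"
  shows "lev (test_fun A) k c = (if k \<in> A then (2 powr - (1/p)) ^ (a k - c) else 0)"
proof -
  have "nth_largest (G k) (test_fun A) (2 ^ c) \<in> test_fun A ` G k"
    using assms by (intro nth_largest_in) (auto simp: power_increasing)
  then have eq: "nth_largest (G k) (test_fun A) (2 ^ c) = (if k \<in> A then gm k powr - (1/p) else 0)"
    by (auto simp: test_fun_def)
  have "(w k * 2 ^ c) powr (1/p) * gm k powr - (1/p) = (2 powr - (1/p)) ^ (a k - c)"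
  proof -
    have "w k * 2 ^ c = gm k * 2 powr - real (a k - c)"
      using assms by (simp add: gm_def powr_minus powr_realpow power_diff field_simps del: of_nat_diff)
    then have "(w k * 2 ^ c) powr (1/p) = gm k powr (1/p) * 2 powr - (real (a k - c) / p)"
      using gm_pos[of k] by (simp add: powr_mult powr_powr)
    moreover have "gm k powr (1/p) * gm k powr - (1/p) = 1" using gm_pos[of k] by (simp flip: powr_add)
    ultimately show ?thesis by (simp add: powr_power mult.commute mult.left_commute)
  qed
  then show ?thesis by (simp add: lev_def eq)
qed

lemma test_fun_norm_le:
  assumes q: "1 \<le> q"
  shows "\<exists>C>0. \<forall>A. finite A \<longrightarrow> A \<noteq> {} \<longrightarrow> lev_norm_le q (test_fun A) (C * real (card A) powr recip q)"
proof (cases "q = \<infinity>")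
  case True
  have "2 powr - (1/p) \<le> (1::real)" using p powr_mono[of "- (1/p)" 0 2] by simp
  then have "lev (test_fun A) k c \<le> 1" if "c \<le> a k" for A k c
    using that by (simp add: lev_test_fun power_le_one)
  then show ?thesis using True by (intro exI[of _ 1]) (auto simp: lev_norm_le_def recip_def)
next
  case False
  define Q where "Q = enn2real q"
  have Q: "1 \<le> Q" using one_le_enn2real[OF q False] by (simp add: Q_def)
  define x :: real where "x = 2 powr - (Q/p)"
  have x: "0 < x" "x < 1" using Q p by (auto simp: x_def powr_less_one)
  show ?thesis
  proof (intro exI[of _ "(1 / (1 - x)) powr (1/Q)"] conjI allI impI)
    fix A :: "nat set" assume A: "finite A" "A \<noteq> {}"
    have "lev_sum Q (test_fun A) K \<le> ((1 / (1 - x)) powr (1/Q) * real (card A) powr (1/Q)) powr Q" for K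
    proof -
      have g: "(\<Sum>c\<le>a k. lev (test_fun A) k c powr Q) \<le> (if k \<in> A then 1 / (1 - x) else 0)" for k
      proof (cases "k \<in> A")
        case True
        have "(\<Sum>c\<le>a k. lev (test_fun A) k c powr Q) = (\<Sum>c\<le>a k. x ^ (a k - c))"
        proof (intro sum.cong refl)
          fix c assume "c \<in> {..a k}"
          then show "lev (test_fun A) k c powr Q = x ^ (a k - c)"
            using True by (simp add: lev_test_fun x_def powr_powr powr_power mult.commute)
        qed
        also have "\<dots> = (\<Sum>c\<le>a k. x ^ c)"
          by (rule sum_atMost_rev)
        also have "\<dots> \<le> 1 / (1 - x)"
          unfolding lessThan_Suc_atMost[symmetric] using x by (intro geometric_sum_le) auto
        finally show ?thesis using True by simp
      qed (simp add: lev_test_fun)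
      have "lev_sum Q (test_fun A) K \<le> (\<Sum>k<K. if k \<in> A then 1 / (1 - x) else 0)"
        by (intro sum_mono g)
      also have "\<dots> = (\<Sum>k\<in>{..<K} \<inter> A. 1 / (1 - x))" by (rule sum.inter_restrict[symmetric]) simp
      also have "\<dots> \<le> (\<Sum>k\<in>A. 1 / (1 - x))" using A x by (intro sum_mono2) auto
      also have "\<dots> = ((1 / (1 - x)) powr (1/Q) * real (card A) powr (1/Q)) powr Q"
        using x Q by (simp add: powr_mult powr_powr)
      finally show ?thesis .
    qed
    then show "lev_norm_le q (test_fun A) ((1 / (1 - x)) powr (1/Q) * real (card A) powr recip q)"
      using False by (simp add: lev_norm_le_def recip_def Q_def)
  qed (use x in simp)
qed

lemma test_fun_norm_ge:
  assumes r: "1 \<le> r" and A: "finite A" "A \<noteq> {}" and B: "0 \<le> B" "lev_norm_le r (test_fun A) B"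
  shows "real (card A) powr recip r \<le> B"
proof -
  have top: "lev (test_fun A) k (a k) = 1" if "k \<in> A" for k using that by (simp add: lev_test_fun)
  show ?thesis
  proof (cases "r = \<infinity>")
    case True
    obtain k where "k \<in> A" using A by auto
    then have "1 \<le> B" using B(2) True top[of k] unfolding lev_norm_le_def by (metis order_refl)
    moreover have "0 < card A" using A by (simp add: card_gt_0_iff)
    ultimately show ?thesis using True by (simp add: recip_def)
  next
    case False
    define R where "R = enn2real r"
    have R: "1 \<le> R" using one_le_enn2real[OF r False] by (simp add: R_def)
    obtain K where K: "A \<subseteq> {..<K}" using A(1) finite_nat_iff_bounded by auto
    have "real (card A) = (\<Sum>k\<in>A. lev (test_fun A) k (a k) powr R)" using top by simp
    also have "\<dots> \<le> (\<Sum>k\<in>A. \<Sum>c\<le>a k. lev (test_fun A) k c powr R)"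
      by (intro sum_mono member_le_sum) auto
    also have "\<dots> \<le> lev_sum R (test_fun A) K"
      using K by (intro sum_mono2) (auto intro!: sum_nonneg)
    also have "\<dots> \<le> B powr R" using B False by (simp add: lev_norm_le_def R_def)
    finally have "real (card A) powr (1/R) \<le> (B powr R) powr (1/R)" using R by (intro powr_mono2) auto
    then show ?thesis using R B False by (simp add: powr_powr recip_def R_def)
  qed
qed

text \<open>Boundedness reduces to an inequality between cardinalities whenever the maximal function
  of one test function dominates a multiple of another. It is applied with A = A', and with the
  sources and targets of a block.\<close>

lemma max_const_finiteD:
  assumes q: "1 \<le> q" and r: "1 \<le> r" and fin: "max_const p q r X \<rho> M < \<infinity>"
  obtains C where "0 < C" "\<And>A A' \<kappa>. finite A \<Longrightarrow> A \<noteq> {} \<Longrightarrow> finite A' \<Longrightarrow> A' \<noteq> {} \<Longrightarrow> 0 < \<kappa> \<Longrightarrow>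
    (\<And>x. x \<in> X \<Longrightarrow> ennreal (\<kappa> * test_fun A' x) \<le> max_c X \<rho> M (test_fun A) x) \<Longrightarrow>
    \<kappa> * real (card A') powr recip r \<le> C * real (card A) powr recip q"
proof -
  from fin obtain c where c: "c < \<infinity>" "\<And>f. f \<in> borel_measurable M \<Longrightarrow>
        lorentz_norm M p q (\<lambda>x. ennreal \<bar>f x\<bar>) < \<infinity> \<Longrightarrow>
        lorentz_norm M p r (max_c X \<rho> M f) \<le> c * lorentz_norm M p q (\<lambda>x. ennreal \<bar>f x\<bar>)"
    unfolding max_const_def Inf_less_iff by auto
  obtain d where d: "c = ennreal d" "0 \<le> d" using c(1) by (cases c) auto
  obtain C1 where C1: "0 < C1" "\<And>g B. (\<forall>x\<in>X. 0 \<le> g x) \<Longrightarrow> 0 \<le> B \<Longrightarrow>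
     lorentz_le r g B \<Longrightarrow> lev_norm_le r g (C1 * B)"
    using lev_norm_le_of_lorentz_norm_le[OF r] by blast
  obtain C2 where C2: "0 < C2" "\<And>g B. (\<forall>x\<in>X. 0 \<le> g x) \<Longrightarrow> 0 \<le> B \<Longrightarrow> lev_norm_le q g B \<Longrightarrow>
     lorentz_le q g (C2 * B)"
    using lorentz_norm_le_of_lev_norm_le[OF q] by blast
  obtain C3 where C3: "0 < C3" "\<And>A. finite A \<Longrightarrow> A \<noteq> {} \<Longrightarrow> lev_norm_le q (test_fun A) (C3 * real (card A) powr recip q)"
    using test_fun_norm_le[OF q] by blast
  \<comment> \<open>The summand 1 keeps the constant positive when d = 0.\<close>
  have "\<kappa> * real (card A') powr recip r \<le> (C1 * d * C2 * C3 + 1) * real (card A) powr recip q"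
    if A: "finite A" "A \<noteq> {}" "finite A'" "A' \<noteq> {}" "0 < \<kappa>"
      and le: "\<And>x. x \<in> X \<Longrightarrow> ennreal (\<kappa> * test_fun A' x) \<le> max_c X \<rho> M (test_fun A) x" for A A' \<kappa>
  proof -
    define B where "B = C2 * (C3 * real (card A) powr recip q)"
    have B: "0 \<le> B" using C2 C3 by (simp add: B_def)
    have n: "lorentz_norm M p q (\<lambda>x. ennreal (test_fun A x)) \<le> ennreal B"
      unfolding B_def using C3 A test_fun_nonneg by (intro C2) auto
    have meas: "test_fun A \<in> borel_measurable M"
      by (auto simp: measurable_def)
    have "lorentz_norm M p r (\<lambda>x. ennreal (\<kappa> * test_fun A' x)) \<le> lorentz_norm M p r (max_c X \<rho> M (test_fun A))"
      using le by (rule lorentz_norm_mono[OF r])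
    also have "\<dots> \<le> c * lorentz_norm M p q (\<lambda>x. ennreal (test_fun A x))"
      using c(2)[OF meas] n test_fun_nonneg[of A] by (simp add: le_less_trans[OF _ ennreal_less_top])
    also have "\<dots> \<le> ennreal d * ennreal B" unfolding d(1) using n by (rule mult_left_mono) simp
    also have "\<dots> = ennreal (d * B)" using d B by (simp add: ennreal_mult)
    finally have "lev_norm_le r (\<lambda>x. \<kappa> * test_fun A' x) (C1 * (d * B))"
      using d B A test_fun_nonneg by (intro C1) auto
    then have "lev_norm_le r (\<lambda>x. (1/\<kappa>) * (\<kappa> * test_fun A' x)) ((1/\<kappa>) * (C1 * (d * B)))"
      using d B A C1 test_fun_nonneg by (intro lev_norm_le_cmult) auto
    then have "lev_norm_le r (test_fun A') ((1/\<kappa>) * (C1 * (d * B)))" using A by simp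
    then have "real (card A') powr recip r \<le> (1/\<kappa>) * (C1 * (d * B))"
      using A d B C1 by (intro test_fun_norm_ge[OF r]) auto
    then have "\<kappa> * real (card A') powr recip r \<le> C1 * (d * B)" using A by (simp add: field_simps)
    also have "\<dots> \<le> (C1 * d * C2 * C3 + 1) * real (card A) powr recip q"
      by (simp add: B_def algebra_simps)
    finally show ?thesis .
  qed
  moreover have "0 < C1 * d * C2 * C3 + 1" using C1 C2 C3 d by (simp add: add_nonneg_pos)
  ultimately show ?thesis using that by blast
qed

end

section \<open>Spaces with prescribed block norms\<close>

text \<open>Sources of a block have smaller positions than its targets; hence they are earlier
  groups, as \<open>S_less\<close> demands.\<close>

lemma prod_encode_strict_mono: "t < t' \<Longrightarrow> prod_encode (i, t) < prod_encode (i, t')"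
proof -
  assume "t < t'"
  have "strict_mono triangle" by (rule strict_mono_Suc_iff[THEN iffD2]) (simp add: triangle_Suc)
  then have "triangle (i + t) < triangle (i + t')" using \<open>t < t'\<close> by (simp add: strict_mono_def)
  then show ?thesis by (simp add: prod_encode_def)
qed

lemma exists_linked_atoms:
  fixes p :: real and \<beta> :: "nat \<Rightarrow> real"
  assumes p: "1 < p" and \<beta>: "\<And>k. 0 < \<beta> k"
    and S: "\<And>k k'. k' \<in> S k \<Longrightarrow> k' < k" "\<And>k k'. k' \<in> S k \<Longrightarrow> \<beta> k' = 1"
  shows "\<exists>a w. linked_atoms p a w S \<beta>"
proof -
  \<comment> \<open>The solution w of (2^r * w)^(1/p) = \<beta> k * w. It is unbounded in r, so
    lacunarity can be enforced by choosing the group sizes large.\<close>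
  define W where "W k r = (2 ^ r * \<beta> k powr - p) powr (1 / (p - 1))" for k r :: nat
  have W0: "0 < W k r" for k r using \<beta>[of k] by (simp add: W_def)
  \<comment> \<open>Both \<zeta> / p and \<zeta> * (1 - 1/p) are at least 1, so the single growth
    condition \<open>bd\<close> yields all three lacunarity assumptions.\<close>
  define \<zeta> where "\<zeta> = max p (p / (p - 1))"
  define bd where "bd f K k = 2 ^ f k * W k (f k) * (4 ^ K) powr \<zeta>" for f :: "nat \<Rightarrow> nat" and K k
  have bd0: "0 \<le> bd f K k" for f K k using W0[of k "f k"] by (simp add: bd_def)
  have "\<exists>f. \<forall>K. K \<le> f K \<and> (\<forall>k<K. f k \<le> f K \<and> bd f K k \<le> W K (f K))"
  proof (rule dependent_wellorder_choice)
    fix f K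
    define V where "V = (\<Sum>k<K. bd f K k)"
    have V0: "0 \<le> V" unfolding V_def by (intro sum_nonneg bd0)
    \<comment> \<open>W K r >= V amounts to 2^r >= V^(p-1) * \<beta> K^p. The further summands of r
      ensure K <= r and that r is at least all earlier sizes.\<close>
    obtain r0 where r0: "V powr (p - 1) / \<beta> K powr - p < 2 ^ r0"
      using real_arch_pow[of 2 "V powr (p - 1) / \<beta> K powr - p"] by auto
    define r where "r = r0 + K + (\<Sum>k<K. f k)"
    have "V powr (p - 1) \<le> 2 ^ r0 * \<beta> K powr - p"
      using r0 \<beta>[of K] by (simp add: field_simps)
    also have "\<dots> \<le> 2 ^ r * \<beta> K powr - p"
      by (intro mult_right_mono power_increasing) (auto simp: r_def)
    finally have "(V powr (p - 1)) powr (1 / (p - 1)) \<le> W K r"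
      unfolding W_def using p by (intro powr_mono2) auto
    then have VW: "V \<le> W K r" using p V0 by (simp add: powr_powr)
    have "f k \<le> r \<and> bd f K k \<le> W K r" if "k < K" for k
    proof
      have "f k \<le> (\<Sum>k<K. f k)" using that by (intro member_le_sum) auto
      then show "f k \<le> r" by (simp add: r_def)
      have "bd f K k \<le> V" unfolding V_def using that bd0 by (intro member_le_sum) auto
      then show "bd f K k \<le> W K r" using VW by simp
    qed
    moreover have "K \<le> r" by (simp add: r_def)
    ultimately show "\<exists>r. K \<le> r \<and> (\<forall>k<K. f k \<le> r \<and> bd f K k \<le> W K r)" by blast
  next
    fix r :: nat and f g :: "nat \<Rightarrow> nat" and K
    assume "\<And>y. y < K \<Longrightarrow> f y = g y"
    then show "(K \<le> r \<and> (\<forall>k<K. f k \<le> r \<and> bd f K k \<le> W K r)) = (K \<le> r \<and> (\<forall>k<K. g k \<le> r \<and> bd g K k \<le> W K r))"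
      by (auto simp: bd_def)
  qed
  then obtain a where a: "\<And>K. K \<le> a K" "\<And>k K. k < K \<Longrightarrow> a k \<le> a K" "\<And>k K. k < K \<Longrightarrow> bd a K k \<le> W K (a K)"
    by blast
  define w where "w k = W k (a k)" for k
  have w0: "0 < w k" for k by (simp add: w_def W0)
  have small: "2 ^ a k * w k / w K \<le> ((1/4) ^ K) powr \<zeta>" if "k < K" for k K
  proof -
    have "((1/4::real) ^ K) powr \<zeta> = 1 / (4 ^ K) powr \<zeta>" by (simp add: power_one_over powr_divide)
    moreover have "2 ^ a k * w k * (4 ^ K) powr \<zeta> \<le> w K" using a(3)[OF that] by (simp add: bd_def w_def)
    moreover have "0 < (4 ^ K :: real) powr \<zeta>" by simp
    ultimately show ?thesis using w0[of K] by (simp only: pos_divide_le_eq pos_le_divide_eq) (simp add: field_simps)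
  qed
  have power: "(2 ^ a k * w k / w K) powr s \<le> (1/4) ^ K" if "k < K" "0 < s" "1 \<le> \<zeta> * s" for k K s
  proof -
    have "(2 ^ a k * w k / w K) powr s \<le> (((1/4) ^ K) powr \<zeta>) powr s"
      using small[OF that(1)] that w0[of k] w0[of K] by (intro powr_mono2) auto
    also have "\<dots> = ((1/4) ^ K) powr (\<zeta> * s)" by (simp add: powr_powr)
    also have "\<dots> \<le> ((1/4) ^ K) powr 1"
      using that by (intro powr_mono') (auto simp: power_le_one)
    finally show ?thesis by simp
  qed
  have "linked_atoms p a w S \<beta>"
  proof
    show "(2 ^ a k * w k) powr (1/p) = \<beta> k * w k" for k
    proof -
      define V where "V = 2 ^ a k * \<beta> k powr - p"
      have V: "0 < V" using \<beta>[of k] by (simp add: V_def)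
      have w: "w k = V powr (1 / (p - 1))" by (simp add: w_def W_def V_def)
      have "\<beta> k powr p * \<beta> k powr - p = 1" using \<beta>[of k] by (simp flip: powr_add)
      then have "2 ^ a k = \<beta> k powr p * V" by (simp add: V_def)
      moreover have "V * w k = w k powr p"
      proof -
        have "V * w k = V powr (1 + 1 / (p - 1))" using V by (simp add: w powr_add)
        also have "1 + 1 / (p - 1) = 1 / (p - 1) * p" using p by (simp add: field_simps)
        finally show ?thesis by (simp add: w powr_powr)
      qed
      ultimately have "2 ^ a k * w k = \<beta> k powr p * w k powr p" by simp
      then show ?thesis using \<beta>[of k] w0[of k] p by (simp add: powr_mult powr_powr)
    qed
    show "2 ^ a k * w k * 4 ^ K \<le> w K" if "k < K" for k K
    proof -
      have z: "1 \<le> \<zeta> * 1" using p by (simp add: \<zeta>_def)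
      have "2 ^ a k * w k / w K \<le> (1/4) ^ K"
        using power[OF that _ z] w0[of k] w0[of K] by simp
      then show ?thesis using w0[of K] by (simp add: power_one_over field_simps)
    qed
    show "(2 ^ a k * w k / w K) powr (1/p) \<le> (1/4) ^ K" if "k < K" for k K
    proof (rule power[OF that])
      show "1 \<le> \<zeta> * (1/p)" using p by (simp add: \<zeta>_def)
    qed (use p in auto)
    show "(2 ^ a k * w k / w K) powr (1 - 1/p) \<le> (1/4) ^ K" if "k < K" for k K
    proof (rule power[OF that])
      have "1 = p / (p - 1) * (1 - 1/p)" using p by (simp add: field_simps)
      also have "\<dots> \<le> \<zeta> * (1 - 1/p)" using p by (intro mult_right_mono) (auto simp: \<zeta>_def)
      finally show "1 \<le> \<zeta> * (1 - 1/p)" .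
    qed (use p in auto)
  qed (use p \<beta> S w0 a in auto)
  then show ?thesis by blast
qed

lemma recip_bounds:
  assumes "1 \<le> q"
  shows "0 \<le> recip q" "recip q \<le> 1"
  using assms by (cases q; simp add: recip_def)+

lemma recip_eq_0_iff:
  assumes "1 \<le> q"
  shows "recip q = 0 \<longleftrightarrow> q = \<infinity>"
  using assms by (cases q) (auto simp: recip_def)

theorem exists_space_with_block_norms:
  fixes p :: real and m n :: "nat \<Rightarrow> nat" and A :: "nat \<Rightarrow> real"
  assumes p: "1 < p" and m: "\<And>i. 1 \<le> m i" and n: "\<And>i. 1 \<le> n i" and A: "\<And>i. 0 < A i"
  shows "\<exists>X \<rho> M. metric_measure_space X \<rho> M \<and> \<not> doubling X \<rho> M \<and>
     (\<forall>q r. 1 \<le> q \<longrightarrow> 1 \<le> r \<longrightarrow> (max_const p q r X \<rho> M < \<infinity> \<longleftrightarrow>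
        recip r \<le> recip q \<and> (\<exists>C. \<forall>i. A i * real (m i) powr recip r * real (n i) powr - recip q \<le> C)))"
proof -
  \<comment> \<open>Group (i, t) belongs to block i. Positions t < n i are sources, the next m i are
    targets, and all later ones are idle groups without links.\<close>
  define blk where "blk k = fst (prod_decode k)" for k
  define pos where "pos k = snd (prod_decode k)" for k
  have dec: "prod_encode (blk k, pos k) = k" for k by (simp add: blk_def pos_def)
  have blk_enc [simp]: "blk (prod_encode (i, t)) = i" and pos_enc [simp]: "pos (prod_encode (i, t)) = t" for i t
    by (simp_all add: blk_def pos_def)
  define tgt where "tgt k \<longleftrightarrow> n (blk k) \<le> pos k \<and> pos k < n (blk k) + m (blk k)" for k
  define Src where "Src i = (\<lambda>t. prod_encode (i, t)) ` {..<n i}" for i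
  define Tgt where "Tgt i = (\<lambda>t. prod_encode (i, t)) ` {n i..<n i + m i}" for i
  define S where "S k = (if tgt k then Src (blk k) else {})" for k
  \<comment> \<open>Dividing by the number of sources turns the sum over normalised sources into A
    times their mean.\<close>
  define \<beta> where "\<beta> k = (if tgt k then A (blk k) / real (n (blk k)) else 1)" for k
  have inj: "inj_on (\<lambda>t. prod_encode (i, t)) T" for i T by (auto simp: inj_on_def)
  have fin [simp]: "finite (Src i)" "finite (Tgt i)" for i by (simp_all add: Src_def Tgt_def)
  have card_Src [simp]: "card (Src i) = n i" for i by (simp add: Src_def card_image[OF inj])
  have card_Tgt [simp]: "card (Tgt i) = m i" for i by (simp add: Tgt_def card_image[OF inj])
  have blk_Src: "k \<in> Src i \<Longrightarrow> blk k = i" for k i by (auto simp: Src_def)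
  have Tgt_iff: "k \<in> Tgt i \<longleftrightarrow> tgt k \<and> blk k = i" for k i
  proof
    assume "tgt k \<and> blk k = i"
    then have "pos k \<in> {n i..<n i + m i}" "k = prod_encode (i, pos k)" using dec[of k] by (auto simp: tgt_def)
    then show "k \<in> Tgt i" unfolding Tgt_def by (intro image_eqI)
  qed (auto simp: Tgt_def tgt_def)
  have Src_not_tgt: "k \<in> Src i \<Longrightarrow> \<not> tgt k" for k i by (auto simp: Src_def tgt_def)
  have \<beta>0: "0 < \<beta> k" for k using A[of "blk k"] n[of "blk k"] by (simp add: \<beta>_def)
  have S_less: "k' < k" if "k' \<in> S k" for k k'
  proof -
    have "tgt k" "k' \<in> Src (blk k)" using that by (auto simp: S_def split: if_splits)
    then obtain t where t: "k' = prod_encode (blk k, t)" "t < pos k" by (auto simp: Src_def tgt_def)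
    have "prod_encode (blk k, t) < prod_encode (blk k, pos k)" using t by (intro prod_encode_strict_mono)
    then show ?thesis using t dec by simp
  qed
  have \<beta>1: "\<beta> k' = 1" if "k' \<in> S k" for k k'
    using that Src_not_tgt by (auto simp: S_def \<beta>_def split: if_splits)
  have "\<exists>a w. linked_atoms p a w S \<beta>"
    using p \<beta>0 by (rule exists_linked_atoms) (erule S_less \<beta>1)+
  then obtain a w where "linked_atoms p a w S \<beta>" by (elim exE)
  then interpret linked_atoms p a w S \<beta> .
  have gm_root: "gm k powr (1/p) = \<beta> k * w k" for k using group_mass by (simp add: gm_def)
  have weight: "\<beta> k * real (card (S k)) powr (1 - u) \<le> (if tgt k then A (blk k) * real (n (blk k)) powr - u else 0)" for k u
  proof (cases "tgt k")
    case True
    have "real (n (blk k)) powr (1 - u) = real (n (blk k)) * real (n (blk k)) powr - u"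
      using n[of "blk k"] by (simp add: powr_diff powr_minus divide_inverse)
    then show ?thesis using True n[of "blk k"] by (simp add: \<beta>_def S_def)
  qed (simp add: S_def)
  have finite_dir: "max_const p q r X \<rho> M < \<infinity>"
    if q: "1 \<le> q" and r: "1 \<le> r" and rq: "recip r \<le> recip q"
      and bd: "\<And>i. A i * real (m i) powr recip r * real (n i) powr - recip q \<le> C" for q r C
  proof -
    have "0 \<le> A 0 * real (m 0) powr recip r * real (n 0) powr - recip q"
      using A[of 0] by simp
    then have C: "0 \<le> C" using bd[of 0] by linarith
    show ?thesis
    proof (cases "r = \<infinity>")
      case True
      have "\<beta> k * real (card (S k)) powr (1 - recip q) \<le> C" for k
        using weight[of k "recip q"] bd[of "blk k"] C True m[of "blk k"]
        by (auto simp: recip_def split: if_splits)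
      from majorant_norm_top[OF q C this] obtain C' where
        "0 \<le> C'" "\<And>f. lev_norm_le q (\<lambda>x. \<bar>f x\<bar>) 1 \<Longrightarrow> (\<forall>k. \<forall>c\<le>a k. lev (majorant f) k c \<le> C')" by blast
      then show ?thesis using True by (intro max_const_finite[OF q r, of C']) (auto simp: lev_norm_le_def)
    next
      case False
      then have "recip r \<noteq> 0" using recip_eq_0_iff[OF r] by simp
      then have "recip q \<noteq> 0" using rq recip_bounds(1)[OF r] by linarith
      then have qf: "q \<noteq> \<infinity>" using recip_eq_0_iff[OF q] by simp
      define Q where "Q = enn2real q"
      define R where "R = enn2real r"
      have QR: "1 \<le> Q" "1 \<le> R" using one_le_enn2real q r qf False by (auto simp: Q_def R_def)
      have rec: "recip q = 1/Q" "recip r = 1/R" using qf False by (auto simp: recip_def Q_def R_def)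
      have QleR: "Q \<le> R" using rq QR by (simp add: rec field_simps)
      \<comment> \<open>Summing over the m i targets of a block yields the R-th power of its weight,
        hence at most C^R. The source sets of different blocks are disjoint, so their total
        contribution is at most 1.\<close>
      have links: "(\<Sum>k<K. (\<beta> k * real (card (S k)) powr (1 - 1/Q)) powr R * (\<Sum>k'\<in>S k. P k')) \<le> C powr R"
        if P0: "\<And>k. 0 \<le> P k" and P1: "\<And>K. (\<Sum>k<K. P k) \<le> 1" for P :: "nat \<Rightarrow> real" and K
      proof -
        define e where "e i = (A i * real (n i) powr - (1/Q)) powr R * (\<Sum>k'\<in>Src i. P k')" for i
        have e0: "0 \<le> e i" for i unfolding e_def using P0 by (intro mult_nonneg_nonneg sum_nonneg) auto
        have "(\<Sum>k<K. (\<beta> k * real (card (S k)) powr (1 - 1/Q)) powr R * (\<Sum>k'\<in>S k. P k'))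
          \<le> (\<Sum>k<K. if tgt k then e (blk k) else 0)"
        proof (intro sum_mono)
          fix k
          show "(\<beta> k * real (card (S k)) powr (1 - 1/Q)) powr R * (\<Sum>k'\<in>S k. P k') \<le> (if tgt k then e (blk k) else 0)"
          proof (cases "tgt k")
            case True
            then show ?thesis unfolding e_def using weight[of k "1/Q"] QR P0 \<beta>0[of k] True
              by (simp add: S_def) (intro mult_right_mono powr_mono2, auto intro!: sum_nonneg)
          qed (simp add: S_def)
        qed
        also have "\<dots> = (\<Sum>k\<in>{k \<in> {..<K}. tgt k}. e (blk k))" by (rule sum.inter_filter[symmetric]) simp
        also have "\<dots> \<le> (\<Sum>k\<in>(\<Union>i<K. Tgt i). e (blk k))"
        proof (intro sum_mono2)
          have "blk k \<le> k" for k using le_prod_encode_1[of "blk k" "pos k"] dec[of k] by simp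
          then show "{k \<in> {..<K}. tgt k} \<subseteq> (\<Union>i<K. Tgt i)" using le_less_trans[OF \<open>\<And>k. blk k \<le> k\<close>] by (auto simp: Tgt_iff)
        qed (use e0 in auto)
        also have "\<dots> = (\<Sum>i<K. \<Sum>k\<in>Tgt i. e (blk k))"
          by (intro sum.UNION_disjoint) (auto simp: Tgt_iff)
        also have "\<dots> = (\<Sum>i<K. \<Sum>k\<in>Tgt i. e i)"
          by (intro sum.cong refl) (auto simp: Tgt_iff)
        also have "\<dots> = (\<Sum>i<K. real (m i) * e i)" by simp
        also have "\<dots> \<le> (\<Sum>i<K. C powr R * (\<Sum>k'\<in>Src i. P k'))"
        proof (intro sum_mono)
          fix i
          have "real (m i) * (A i * real (n i) powr - (1/Q)) powr R = (A i * real (m i) powr (1/R) * real (n i) powr - (1/Q)) powr R"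
            using A[of i] m[of i] QR by (simp add: powr_mult powr_powr)
          also have "\<dots> \<le> C powr R"
            using bd[of i] A[of i] QR by (intro powr_mono2) (auto simp: rec)
          finally show "real (m i) * e i \<le> C powr R * (\<Sum>k'\<in>Src i. P k')"
            unfolding e_def mult.assoc[symmetric] using P0 by (intro mult_right_mono sum_nonneg) auto
        qed
        also have "\<dots> = C powr R * (\<Sum>i<K. \<Sum>k'\<in>Src i. P k')" by (simp add: sum_distrib_left)
        also have "(\<Sum>i<K. \<Sum>k'\<in>Src i. P k') = (\<Sum>k'\<in>(\<Union>i<K. Src i). P k')"
          by (intro sum.UNION_disjoint[symmetric]) (auto dest: blk_Src)
        also have "\<dots> \<le> 1"
        proof -
          have "finite (\<Union>i<K. Src i)" by simp
          then obtain N where "(\<Union>i<K. Src i) \<subseteq> {..<N}" using finite_nat_iff_bounded by blast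
          then have "(\<Sum>k'\<in>(\<Union>i<K. Src i). P k') \<le> (\<Sum>k'<N. P k')" using P0 by (intro sum_mono2) auto
          then show ?thesis using P1[of N] by simp
        qed
        finally show ?thesis by (simp add: mult_left_mono)
      qed
      have "\<exists>C'\<ge>0. \<forall>f. (\<forall>K. lev_sum Q (\<lambda>x. \<bar>f x\<bar>) K \<le> 1) \<longrightarrow>
          (\<forall>K. lev_sum R (majorant f) K \<le> C')"
        by (rule majorant_norm_fin[OF QR(1) QleR _ links]) simp
      then obtain C' where C': "0 \<le> C'"
        "\<forall>f. (\<forall>K. lev_sum Q (\<lambda>x. \<bar>f x\<bar>) K \<le> 1) \<longrightarrow>
          (\<forall>K. lev_sum R (majorant f) K \<le> C')"
        by (elim exE conjE) (rule that)
      have CR: "(C' powr (1/R)) powr R = C'" using C'(1) QR by (simp add: powr_powr)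
      show ?thesis
      proof (rule max_const_finite[OF q r, of "C' powr (1/R)"])
        fix f assume "lev_norm_le q (\<lambda>x. \<bar>f x\<bar>) 1"
        then have "\<forall>K. lev_sum Q (\<lambda>x. \<bar>f x\<bar>) K \<le> 1"
          using qf by (simp add: lev_norm_le_def Q_def)
        with C'(2) have "\<forall>K. lev_sum R (majorant f) K \<le> C'" by blast
        then show "lev_norm_le r (majorant f) (C' powr (1/R))"
          using False CR unfolding lev_norm_le_def R_def by simp
      qed simp
    qed
  qed
  have infinite_dir: "recip r \<le> recip q \<and> (\<exists>C. \<forall>i. A i * real (m i) powr recip r * real (n i) powr - recip q \<le> C)"
    if q: "1 \<le> q" and r: "1 \<le> r" and fin: "max_const p q r X \<rho> M < \<infinity>" for q r
  proof -
    obtain C where C: "0 < C" "\<And>B B' \<kappa>. finite B \<Longrightarrow> B \<noteq> {} \<Longrightarrow> finite B' \<Longrightarrow> B' \<noteq> {} \<Longrightarrow> 0 < \<kappa> \<Longrightarrow>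
      (\<And>x. x \<in> X \<Longrightarrow> ennreal (\<kappa> * test_fun B' x) \<le> max_c X \<rho> M (test_fun B) x) \<Longrightarrow>
      \<kappa> * real (card B') powr recip r \<le> C * real (card B) powr recip q"
      using max_const_finiteD[OF q r fin] by blast
    \<comment> \<open>Singletons are balls, so the maximal function dominates f. A test function on
      K groups then gives K^(1/r - 1/q) <= C for every K.\<close>
    have "recip r \<le> recip q"
    proof (rule ccontr)
      assume "\<not> ?thesis"
      define d where "d = recip r - recip q"
      have d: "0 < d" using \<open>\<not> recip r \<le> recip q\<close> by (simp add: d_def)
      obtain K :: nat where K: "max 1 (C powr (1/d)) < real K" using reals_Archimedean2 by blast
      have "1 * real (card {..<K}) powr recip r \<le> C * real (card {..<K}) powr recip q"
      proof (rule C(2))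
        show "ennreal (1 * test_fun {..<K} x) \<le> max_c X \<rho> M (test_fun {..<K}) x" if "x \<in> X" for x
          using le_max_c[OF that, of "test_fun {..<K}"] test_fun_nonneg[of "{..<K}" x] by simp
      qed (use K in auto)
      then have "real K powr d \<le> C" using K by (simp add: d_def powr_diff field_simps)
      moreover have "(C powr (1/d)) powr d < real K powr d" using K d by (intro powr_less_mono2) auto
      ultimately show False using C d by (simp add: powr_powr)
    qed
    \<comment> \<open>The factor 2 is the loss in \<open>link_avg_le_max_c\<close>.\<close>
    moreover have "A i * real (m i) powr recip r * real (n i) powr - recip q \<le> 2 * C" for i
    proof -
      have "(A i / 2) * real (card (Tgt i)) powr recip r \<le> C * real (card (Src i)) powr recip q"
      proof (rule C(2))
        show "Src i \<noteq> {}" "Tgt i \<noteq> {}"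
          using m[of i] n[of i] card_Src[of i] card_Tgt[of i] by (metis card.empty not_one_le_zero)+
        show "0 < A i / 2" using A by simp
        fix x assume x: "x \<in> X"
        show "ennreal (A i / 2 * test_fun (Tgt i) x) \<le> max_c X \<rho> M (test_fun (Src i)) x"
        proof (cases "grp x \<in> Tgt i")
          case False
          then show ?thesis by (simp add: test_fun_def)
        next
          case True
          define k where "k = grp x"
          have k: "tgt k" "blk k = i" using True by (auto simp: k_def Tgt_iff)
          then have Sk: "S k = Src i" by (simp add: S_def)
          have "w k' * \<bar>test_fun (Src i) (pt k' (idx x mod 2 ^ a k'))\<bar> = 1" if k': "k' \<in> Src i" for k'
          proof -
            have "\<beta> k' = 1" using Src_not_tgt[OF k'] by (simp add: \<beta>_def)
            then have "w k' = gm k' powr (1/p)" using gm_root[of k'] by simp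
            then have "w k' * gm k' powr - (1/p) = 1" using gm_pos[of k'] by (simp flip: powr_add)
            then show ?thesis using k' by (simp add: test_fun_def)
          qed
          then have "link_avg (test_fun (Src i)) x = real (n i) / w k"
            unfolding link_avg_def k_def[symmetric] Sk by simp
          moreover have "A i * gm k powr - (1/p) = real (n i) / w k"
          proof -
            have "gm k powr (1/p) = A i / real (n i) * w k" using gm_root[of k] k by (simp add: \<beta>_def)
            then have "gm k powr - (1/p) = inverse (A i / real (n i) * w k)" by (simp only: powr_minus)
            then show ?thesis using A[of i] n[of i] w_pos[of k] by (simp add: field_simps)
          qed
          ultimately have "A i / 2 * test_fun (Tgt i) x = link_avg (test_fun (Src i)) x / 2"
            using True by (simp add: test_fun_def k_def)
          then show ?thesis using link_avg_le_max_c[OF x, of "test_fun (Src i)"] by simp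
        qed
      qed auto
      then show ?thesis using n[of i] by (simp add: powr_minus field_simps)
    qed
    ultimately show ?thesis by blast
  qed
  show ?thesis
    using metric_measure_space_X not_doubling_X finite_dir infinite_dir
    by (intro exI[of _ X] exI[of _ \<rho>] exI[of _ M]) blast
qed

section \<open>Separation of the admissible region\<close>

text \<open>Since x * ln m <= m^x. The bound is free of K, whereas the left side would be K at x =
  0: this tells a boundary point from the points beyond it.\<close>

lemma powr_neg_le_inverse:
  fixes K m x :: real
  assumes "1 \<le> m" "K \<le> ln m" "0 < x" "0 \<le> K"
  shows "K * m powr - x \<le> 1 / x"
proof -
  have "K * x \<le> x * ln m" using mult_left_mono[OF assms(2), of x] assms(3) by (simp add: mult.commute)
  also have "\<dots> \<le> exp (x * ln m)" using exp_ge_add_one_self[of "x * ln m"] by linarith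
  also have "\<dots> = m powr x" using assms by (simp add: powr_def)
  finally show ?thesis using assms by (simp add: powr_minus field_simps)
qed

lemma exists_nat_ln_ge: "\<exists>m::nat. 1 \<le> m \<and> K \<le> ln (real m)"
proof -
  obtain m :: nat where m: "exp (max K 0) \<le> real m" using real_arch_simple by blast
  have "0 < exp (max K 0)" "1 \<le> exp (max K 0)" by simp_all
  then have "1 \<le> real m" using m by linarith
  moreover have "max K 0 \<le> ln (real m)" using m calculation ln_ge_iff[of "real m" "max K 0"] by linarith
  ultimately show ?thesis by (intro exI[of _ m]) auto
qed

lemma exists_nat_powr_ge:
  assumes "0 < s"
  shows "\<exists>m::nat. 1 \<le> m \<and> K \<le> real m powr s"
proof -
  obtain m :: nat where m: "1 \<le> m" "max K 1 / s \<le> ln (real m)" using exists_nat_ln_ge by blast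
  have "max K 1 \<le> s * ln (real m)" using m assms by (simp add: field_simps)
  also have "\<dots> \<le> exp (s * ln (real m))" using exp_ge_add_one_self[of "s * ln (real m)"] by linarith
  also have "\<dots> = real m powr s" using m by (simp add: powr_def)
  finally show ?thesis using m by auto
qed

definition region :: "bool \<Rightarrow> real set \<Rightarrow> (real \<Rightarrow> real) \<Rightarrow> real \<Rightarrow> real \<Rightarrow> bool" where
  "region strict D F u v \<longleftrightarrow> u \<in> D \<and> (if strict then v < F u else v \<le> F u)"

text \<open>The budget is finite on the region. The first term leaves room for an open left endpoint and a
  jump of \<open>F\<close> there, the second one for the strict inequality.\<close>
definition budget :: "real \<Rightarrow> (real \<Rightarrow> real) \<Rightarrow> real \<Rightarrow> real \<Rightarrow> real" where
  "budget \<delta> F u v = 1 + (if \<delta> < u then 1 / (u - \<delta>) else 0) + (if v < F u then 1 / (F u - v) else 0)"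

lemma budget_ge:
  "1 \<le> budget \<delta> F u v"
  "\<delta> < u \<Longrightarrow> 1 / (u - \<delta>) \<le> budget \<delta> F u v"
  "v < F u \<Longrightarrow> 1 / (F u - v) \<le> budget \<delta> F u v"
  by (auto simp: budget_def)

abbreviation gap_bound :: "real \<Rightarrow> real" where
  "gap_bound t \<equiv> if 0 < t then max 1 (1 / t) else 1"

text \<open>s is the excess v - F u at a point to be excluded, t the gap F u - v at a point of the
  region. If s may vanish, size comes from c = K with ln m >= K, and
  \<open>powr_neg_le_inverse\<close> controls positive gaps; otherwise m^s alone is made
  large.\<close>

lemma gap_weight:
  fixes s K :: real
  assumes "if strict then 0 \<le> s else 0 < s" "0 < K"
  obtains m :: nat and c :: real where "1 \<le> m" "0 < c" "K \<le> c * real m powr s"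
    "\<And>t::real. (if strict then 0 < t else 0 \<le> t) \<Longrightarrow> c * real m powr - t \<le> gap_bound t"
proof (cases strict)
  case True
  obtain m :: nat where m: "1 \<le> m" "K \<le> ln (real m)" using exists_nat_ln_ge by blast
  show ?thesis
  proof (rule that[of m K])
    have "1 \<le> real m powr s" using m(1) assms True by (intro ge_one_powr_ge_zero) auto
    then show "K \<le> K * real m powr s" using assms by simp
    fix t :: real assume "if strict then 0 < t else 0 \<le> t"
    then have "0 < t" using True by simp
    then show "K * real m powr - t \<le> gap_bound t"
      using powr_neg_le_inverse[of "real m" K t] m assms by auto
  qed (use m assms in auto)
next
  case False
  then obtain m :: nat where m: "1 \<le> m" "K \<le> real m powr s" using assms exists_nat_powr_ge by auto
  show ?thesis
  proof (rule that[of m 1])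
    fix t :: real assume "if strict then 0 < t else 0 \<le> t"
    then have "0 \<le> t" using False by simp
    then have "real m powr - t \<le> 1" using powr_mono[of "- t" 0 "real m"] m by simp
    then show "1 * real m powr - t \<le> gap_bound t" by auto
  qed (use m in auto)
qed

text \<open>At interior points it comes from the convexity of -F, and the slope is nonnegative
  because F is nondecreasing. The endpoint 1 is not interior; there slope 0 works by
  monotonicity.\<close>

lemma supergradient:
  fixes F :: "real \<Rightarrow> real"
  assumes D: "D = {\<delta>..1} \<or> D = {\<delta><..1}" and F: "concave_on D F" "mono_on D F"
    and u: "u \<in> D" "\<delta> < u"
  obtains \<alpha> where "0 \<le> \<alpha>" "\<And>y. y \<in> D \<Longrightarrow> F y \<le> F u + \<alpha> * (y - u)"
proof (cases "u = 1")
  case True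
  have "F y \<le> F u" if "y \<in> D" for y
    using F(2) that u D True by (auto simp: mono_on_def)
  then show ?thesis by (intro that[of 0]) auto
next
  case False
  then have u1: "u < 1" "1 \<in> D" using u D by auto
  have "u \<in> {\<delta><..<1}" "{\<delta><..<1} \<subseteq> D" using u u1 D by auto
  then have int: "u \<in> interior D" by (metis interior_maximal open_greaterThanLessThan subsetD)
  define I where "I = Inf ((\<lambda>t. (- F u - - F t) / (u - t)) ` ({u<..} \<inter> D))"
  have *: "- F y \<ge> - F u + I * (y - u)" if "y \<in> D" for y
    unfolding I_def using F(1) int that unfolding concave_on_def
    by (rule convex_le_Inf_differential)
  have "F u \<le> F 1" using F(2) u u1 by (auto simp: mono_on_def)
  then have "0 \<le> - I * (1 - u)" using *[OF u1(2)] by simp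
  then have "0 \<le> - I" using u1 mult_less_0_iff[of "- I" "1 - u"] by (simp add: zero_le_mult_iff)
  moreover have "F y \<le> F u + - I * (y - u)" if "y \<in> D" for y using *[OF that] by simp
  ultimately show ?thesis by (intro that)
qed

text \<open>Four positions of u: left of D, at a missing left endpoint, at an attained left
  endpoint, where F may jump or have infinite slope so that a supporting line can fail to exist, and
  right of it, where such a line prescribes the weight. The factor 1/2 pays for rounding n to an
  integer.\<close>

lemma separating_block:
  fixes F :: "real \<Rightarrow> real"
  assumes \<delta>: "0 \<le> \<delta>" and D: "D = {\<delta>..1} \<or> D = {\<delta><..1}"
    and F: "concave_on D F" "mono_on D F" "\<forall>u\<in>D. 0 \<le> F u \<and> F u \<le> 1"
    and uv: "0 \<le> u" "u \<le> 1" "0 \<le> v" "\<not> region strict D F u v" and K: "0 < K"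
  obtains m n :: nat and A :: real where "1 \<le> m" "1 \<le> n" "0 < A" "K / 2 \<le> A * real m powr v * real n powr - u"
    "\<And>u' v'. region strict D F u' v' \<Longrightarrow> 0 \<le> v' \<Longrightarrow> A * real m powr v' * real n powr - u' \<le> budget \<delta> F u' v'"
proof -
  have reg: "u' \<in> D" "\<delta> \<le> u'" "u' \<le> 1" "if strict then 0 < F u' - v' else 0 \<le> F u' - v'" "v' \<le> F u'" "F u' \<le> 1"
    if "region strict D F u' v'" for u' v'
    using that D F(3) by (auto simp: region_def split: if_splits)
  consider "u < \<delta>" | "u = \<delta>" "\<delta> \<notin> D" | "u = \<delta>" "u \<in> D" | "u \<in> D" "\<delta> < u" using D uv by fastforce
  then show ?thesis
  proof cases
    case 1
    obtain n :: nat where n: "1 \<le> n" "K \<le> real n powr (\<delta> - u)" using exists_nat_powr_ge[of "\<delta> - u" K] 1 by auto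
    show ?thesis
    proof (rule that[of 1 n "real n powr \<delta>"])
      show "K / 2 \<le> real n powr \<delta> * real 1 powr v * real n powr - u"
        using n K by (simp flip: powr_add)
      fix u' v' assume r: "region strict D F u' v'"
      have "real n powr \<delta> * real n powr - u' = real n powr (\<delta> - u')" by (simp flip: powr_add)
      also have "\<dots> \<le> real n powr 0" using n reg(2)[OF r] by (intro powr_mono) auto
      also have "\<dots> \<le> budget \<delta> F u' v'" using n budget_ge(1) by simp
      finally show "real n powr \<delta> * real 1 powr v' * real n powr - u' \<le> budget \<delta> F u' v'" by simp
    qed (use n in auto)
  next
    case 2
    obtain n :: nat where n: "1 \<le> n" "K \<le> ln (real n)" using exists_nat_ln_ge by blast
    show ?thesis
    proof (rule that[of 1 n "K * real n powr \<delta>"])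
      show "K / 2 \<le> K * real n powr \<delta> * real 1 powr v * real n powr - u"
        using n K 2 by (simp add: mult.assoc flip: powr_add)
      fix u' v' assume r: "region strict D F u' v'"
      then have "\<delta> < u'" using 2 reg(1,2)[OF r] by (metis order_le_less)
      then have "K * real n powr - (u' - \<delta>) \<le> 1 / (u' - \<delta>)" using n K by (intro powr_neg_le_inverse) auto
      also have "\<dots> \<le> budget \<delta> F u' v'" using \<open>\<delta> < u'\<close> by (rule budget_ge)
      finally show "K * real n powr \<delta> * real 1 powr v' * real n powr - u' \<le> budget \<delta> F u' v'"
        by (simp add: mult.assoc flip: powr_add)
    qed (use n K in auto)
  next
    case 3
    have s: "if strict then 0 \<le> v - F u else 0 < v - F u" using uv 3 by (auto simp: region_def split: if_splits)
    obtain m :: nat and c :: real where m: "1 \<le> m" "0 < c" "K \<le> c * real m powr (v - F u)"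
      "\<And>t. (if strict then 0 < t else 0 \<le> t) \<Longrightarrow> c * real m powr - t \<le> gap_bound t"
      using gap_weight[OF s K] by blast
    \<comment> \<open>n is chosen after m: right of \<delta> the first factors are at most c * m,
      because v' - F u <= 1, and n^-(u' - \<delta>) suppresses this by
      \<open>powr_neg_le_inverse\<close>.\<close>
    obtain n :: nat where n: "1 \<le> n" "c * real m \<le> ln (real n)" using exists_nat_ln_ge by blast
    have eq: "c * real m powr - F u * real n powr \<delta> * real m powr v' * real n powr - u'
        = c * real m powr (v' - F u) * real n powr - (u' - \<delta>)" for u' v'
    proof -
      have "real m powr (v' - F u) = real m powr - F u * real m powr v'" by (simp flip: powr_add)
      moreover have "real n powr - (u' - \<delta>) = real n powr \<delta> * real n powr - u'" by (simp flip: powr_add)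
      ultimately show ?thesis by simp
    qed
    show ?thesis
    proof (rule that[of m n "c * real m powr - F u * real n powr \<delta>"])
      show "K / 2 \<le> c * real m powr - F u * real n powr \<delta> * real m powr v * real n powr - u"
        unfolding eq using m n K 3 by simp
      fix u' v' assume r: "region strict D F u' v'" and v': "0 \<le> v'"
      show "c * real m powr - F u * real n powr \<delta> * real m powr v' * real n powr - u' \<le> budget \<delta> F u' v'"
      proof (cases "u' = \<delta>")
        case True
        have "c * real m powr - (F u' - v') \<le> gap_bound (F u' - v')"
          using reg(4)[OF r] by (rule m(4))
        also have "\<dots> \<le> budget \<delta> F u' v'" using budget_ge(1)[of \<delta> F u' v'] budget_ge(3)[of v' F u' \<delta>] by auto
        finally show ?thesis unfolding eq using True 3 n by simp
      next
        case False
        then have u': "\<delta> < u'" using reg(2)[OF r] by simp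
        have "real m powr (v' - F u) \<le> real m powr 1"
          using m reg(5,6)[OF r] F(3) 3 by (intro powr_mono) force+
        then have "c * real m powr (v' - F u) * real n powr - (u' - \<delta>) \<le> c * real m * real n powr - (u' - \<delta>)"
          using m by (intro mult_right_mono mult_left_mono) auto
        also have "\<dots> \<le> 1 / (u' - \<delta>)" using n m u' by (intro powr_neg_le_inverse) auto
        also have "\<dots> \<le> budget \<delta> F u' v'" using u' by (rule budget_ge)
        finally show ?thesis unfolding eq .
      qed
    qed (use m n in auto)
  next
    case 4
    have s: "if strict then 0 \<le> v - F u else 0 < v - F u" using uv 4 by (auto simp: region_def split: if_splits)
    obtain m :: nat and c :: real where m: "1 \<le> m" "0 < c" "K \<le> c * real m powr (v - F u)"
      "\<And>t. (if strict then 0 < t else 0 \<le> t) \<Longrightarrow> c * real m powr - t \<le> gap_bound t"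
      using gap_weight[OF s K] by blast
    obtain \<alpha> where \<alpha>: "0 \<le> \<alpha>" "\<And>y. y \<in> D \<Longrightarrow> F y \<le> F u + \<alpha> * (y - u)"
      using supergradient[OF D F(1,2) 4] by blast
    \<comment> \<open>n replaces m^\<alpha>, so that the weight is constant along lines of slope
      \<alpha>, up to rounding. As \<alpha> >= 0, rounding up at most doubles it, and u <= 1 keeps
      the loss in n^u at 2.\<close>
    define n where "n = nat \<lceil>real m powr \<alpha>\<rceil>"
    have ma: "1 \<le> real m powr \<alpha>" using m(1) \<alpha>(1) by (intro ge_one_powr_ge_zero) auto
    then have n: "real m powr \<alpha> \<le> real n" "real n \<le> 2 * real m powr \<alpha>" "1 \<le> n"
      unfolding n_def by linarith+
    let ?A = "c * real m powr - F u * real m powr (\<alpha> * u)"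
    show ?thesis
    proof (rule that[of m n ?A])
      have "real m powr - (\<alpha> * u) / 2 \<le> real n powr - u"
      proof -
        have "real n powr u \<le> (2 * real m powr \<alpha>) powr u" using n uv by (intro powr_mono2) auto
        also have "\<dots> = 2 powr u * real m powr (\<alpha> * u)" by (simp add: powr_mult powr_powr)
        also have "\<dots> \<le> 2 powr 1 * real m powr (\<alpha> * u)" using uv by (intro mult_right_mono powr_mono) auto
        finally show ?thesis using n m(1) by (simp add: powr_minus field_simps)
      qed
      then have "?A * real m powr v * (real m powr - (\<alpha> * u) / 2)
        \<le> ?A * real m powr v * real n powr - u"
        using m by (intro mult_left_mono) auto
      moreover have "?A * real m powr v * (real m powr - (\<alpha> * u) / 2)
        = c * real m powr (v - F u) / 2"
      proof -
        have "real m powr (v - F u) = real m powr - F u * real m powr v" by (simp flip: powr_add)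
        moreover have "real m powr (\<alpha> * u) * real m powr - (\<alpha> * u) = 1" using m(1) by (simp flip: powr_add)
        ultimately show ?thesis by (simp add: mult.left_commute mult.commute)
      qed
      ultimately show "K / 2 \<le> ?A * real m powr v * real n powr - u"
        using m(3) by linarith
      fix u' v' assume r: "region strict D F u' v'" and v': "0 \<le> v'"
      have "real n powr - u' \<le> real m powr - (\<alpha> * u')"
      proof -
        have "(real m powr \<alpha>) powr u' \<le> real n powr u'" using n reg(2)[OF r] \<delta> by (intro powr_mono2) auto
        then show ?thesis using m(1) n by (simp add: powr_powr powr_minus)
      qed
      then have "?A * real m powr v' * real n powr - u'
        \<le> ?A * real m powr v' * real m powr - (\<alpha> * u')"
        using m by (intro mult_left_mono) auto
      also have "\<dots> = c * real m powr (- F u + \<alpha> * u + v' + - (\<alpha> * u'))"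
        by (simp only: powr_add mult.assoc)
      also have "\<dots> \<le> c * real m powr - (F u' - v')"
      proof (intro mult_left_mono powr_mono)
        show "- F u + \<alpha> * u + v' + - (\<alpha> * u') \<le> - (F u' - v')"
          using \<alpha>(2)[OF reg(1)[OF r]] by (simp add: algebra_simps)
      qed (use m in auto)
      also have "\<dots> \<le> gap_bound (F u' - v')"
        using reg(4)[OF r] by (rule m(4))
      also have "\<dots> \<le> budget \<delta> F u' v'" using budget_ge(1)[of \<delta> F u' v'] budget_ge(3)[of v' F u' \<delta>] by auto
      finally show "?A * real m powr v' * real n powr - u' \<le> budget \<delta> F u' v'" .
    qed (use m n in auto)
  qed
qed

lemma exists_separating_blocks:
  fixes F :: "real \<Rightarrow> real"
  assumes \<delta>: "0 \<le> \<delta>" and D: "D = {\<delta>..1} \<or> D = {\<delta><..1}"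
    and F: "concave_on D F" "mono_on D F" "\<forall>u\<in>D. 0 \<le> F u \<and> F u \<le> 1" "\<forall>u\<in>D. F u \<le> u"
  obtains m n :: "nat \<Rightarrow> nat" and A :: "nat \<Rightarrow> real" where "\<And>i. 1 \<le> m i" "\<And>i. 1 \<le> n i" "\<And>i. 0 < A i"
    "\<And>u v. 0 \<le> u \<Longrightarrow> u \<le> 1 \<Longrightarrow> 0 \<le> v \<Longrightarrow>
       (v \<le> u \<and> (\<exists>C. \<forall>i. A i * real (m i) powr v * real (n i) powr - u \<le> C)) \<longleftrightarrow> region strict D F u v"
proof -
  \<comment> \<open>All blocks that stay within the budget on the whole region. Rational A makes the
    family countable, so it can be enumerated as the blocks of one space.\<close>
  define Adm :: "(nat \<times> nat \<times> rat) set" where "Adm = {(m, n, A). 1 \<le> m \<and> 1 \<le> n \<and> 0 < A \<and>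
    (\<forall>u v. region strict D F u v \<longrightarrow> 0 \<le> v \<longrightarrow> of_rat A * real m powr v * real n powr - u \<le> budget \<delta> F u v)}"
  have ne: "(1, 1, 1) \<in> Adm" using budget_ge(1) by (auto simp: Adm_def)
  define b where "b = from_nat_into Adm"
  have range_b: "range b = Adm" unfolding b_def using ne by (intro range_from_nat_into) auto
  define m where "m i = fst (b i)" for i
  define n where "n i = fst (snd (b i))" for i
  define A where "A i = real_of_rat (snd (snd (b i)))" for i
  have bi: "(m i, n i, snd (snd (b i))) \<in> Adm" for i using range_b by (auto simp: m_def n_def)
  have pos: "1 \<le> m i" "1 \<le> n i" "0 < A i" for i using bi[of i] by (auto simp: Adm_def A_def)
  show ?thesis
  proof (rule that[of m n A])
    fix u v :: real assume uv: "0 \<le> u" "u \<le> 1" "0 \<le> v"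
    show "(v \<le> u \<and> (\<exists>C. \<forall>i. A i * real (m i) powr v * real (n i) powr - u \<le> C)) \<longleftrightarrow> region strict D F u v"
    proof
      assume r: "region strict D F u v"
      then have "v \<le> u" using F(4) by (force simp: region_def split: if_splits)
      moreover have "A i * real (m i) powr v * real (n i) powr - u \<le> budget \<delta> F u v" for i
        using bi[of i] r uv by (auto simp: Adm_def A_def)
      ultimately show "v \<le> u \<and> (\<exists>C. \<forall>i. A i * real (m i) powr v * real (n i) powr - u \<le> C)" by blast
    next
      assume "v \<le> u \<and> (\<exists>C. \<forall>i. A i * real (m i) powr v * real (n i) powr - u \<le> C)"
      then obtain C where C: "\<And>i. A i * real (m i) powr v * real (n i) powr - u \<le> C" by blast
      show "region strict D F u v"
      proof (rule ccontr)
        assume nr: "\<not> region strict D F u v"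
        \<comment> \<open>This size survives two halvings, the one in
          \<open>separating_block\<close> and the one from approximating A' by a rational, and still
          exceeds C.\<close>
        obtain m' n' :: nat and A' :: real where b': "1 \<le> m'" "1 \<le> n'" "0 < A'"
          "(4 * max C 0 + 4) / 2 \<le> A' * real m' powr v * real n' powr - u"
          "\<And>u' v'. region strict D F u' v' \<Longrightarrow> 0 \<le> v' \<Longrightarrow> A' * real m' powr v' * real n' powr - u' \<le> budget \<delta> F u' v'"
          by (rule separating_block[OF \<delta> D F(1,2,3) uv nr, of "4 * max C 0 + 4"]) (auto intro: that)
        obtain A'' where A'': "A' / 2 < of_rat A''" "real_of_rat A'' < A'"
          using of_rat_dense[of "A' / 2" A'] b'(3) by auto
        have "(m', n', A'') \<in> Adm"
        proof -
          have "of_rat A'' * real m' powr v' * real n' powr - u' \<le> budget \<delta> F u' v'"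
            if "region strict D F u' v'" "0 \<le> v'" for u' v'
          proof -
            have "of_rat A'' * real m' powr v' * real n' powr - u' \<le> A' * real m' powr v' * real n' powr - u'"
              using A'' by (intro mult_right_mono) auto
            then show ?thesis using b'(5)[OF that] by linarith
          qed
          moreover have "0 < real_of_rat A''" using A'' b'(3) by linarith
          ultimately show ?thesis using b' by (auto simp: Adm_def)
        qed
        then obtain i where "b i = (m', n', A'')" using range_b by (metis imageE)
        then have "of_rat A'' * real m' powr v * real n' powr - u \<le> C" using C[of i] by (simp add: m_def n_def A_def)
        moreover have "A' / 2 * real m' powr v * real n' powr - u \<le> of_rat A'' * real m' powr v * real n' powr - u"
          using A'' by (intro mult_right_mono) auto
        ultimately have "A' * real m' powr v * real n' powr - u \<le> 2 * C" by simp
        then have "(4 * max C 0 + 4) / 2 \<le> 2 * C" by (rule order_trans[OF b'(4)])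
        then show False by (simp add: max_def split: if_splits)
      qed
    qed
  qed (use pos in auto)
qed

lemma exists_space_for_region:
  fixes p \<delta> :: real and D :: "real set" and F :: "real \<Rightarrow> real"
  assumes p: "1 < p" and \<delta>: "0 \<le> \<delta>" and D: "D = {\<delta>..1} \<or> D = {\<delta><..1}"
    and F: "concave_on D F" "mono_on D F" "\<forall>u\<in>D. 0 \<le> F u \<and> F u \<le> 1" "\<forall>u\<in>D. F u \<le> u"
  shows "\<exists>X \<rho> M. metric_measure_space X \<rho> M \<and> \<not> doubling X \<rho> M \<and>
     (\<forall>q r. 1 \<le> q \<longrightarrow> 1 \<le> r \<longrightarrow> (max_const p q r X \<rho> M < \<infinity> \<longleftrightarrow> region strict D F (recip q) (recip r)))"
proof -
  obtain m n :: "nat \<Rightarrow> nat" and A :: "nat \<Rightarrow> real" where b: "\<And>i. 1 \<le> m i" "\<And>i. 1 \<le> n i" "\<And>i. 0 < A i"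
    "\<And>u v. 0 \<le> u \<Longrightarrow> u \<le> 1 \<Longrightarrow> 0 \<le> v \<Longrightarrow>
       (v \<le> u \<and> (\<exists>C. \<forall>i. A i * real (m i) powr v * real (n i) powr - u \<le> C)) \<longleftrightarrow> region strict D F u v"
    by (rule exists_separating_blocks[OF \<delta> D F, of strict]) (rule that; assumption)
  obtain X \<rho> M where s: "metric_measure_space X \<rho> M" "\<not> doubling X \<rho> M"
    "\<And>q r. 1 \<le> q \<Longrightarrow> 1 \<le> r \<Longrightarrow> max_const p q r X \<rho> M < \<infinity> \<longleftrightarrow>
        recip r \<le> recip q \<and> (\<exists>C. \<forall>i. A i * real (m i) powr recip r * real (n i) powr - recip q \<le> C)"
    using exists_space_with_block_norms[OF p, of m n A] b(1-3) by blast
  have "max_const p q r X \<rho> M < \<infinity> \<longleftrightarrow> region strict D F (recip q) (recip r)" if "1 \<le> q" "1 \<le> r" for q r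
    unfolding s(3)[OF that] using recip_bounds that by (intro b(4)) auto
  then show ?thesis using s(1,2) by blast
qed

theorem theorem4p4p2:
  fixes p \<delta> :: real and D :: "real set" and F :: "real \<Rightarrow> real"
  assumes "1 < p"
    and "(0 \<le> \<delta> \<and> \<delta> \<le> 1 \<and> D = {\<delta>..1}) \<or> (0 \<le> \<delta> \<and> \<delta> < 1 \<and> D = {\<delta><..1})"
    and "\<forall>u\<in>D. 0 \<le> F u \<and> F u \<le> 1"
    and "concave_on D F"
    and "mono_on D F"
    and "\<forall>u\<in>D. F u \<le> u"
  shows "(\<exists>X \<rho> M. metric_measure_space X \<rho> M \<and> \<not> doubling X \<rho> M \<and>
            (\<forall>q r. 1 \<le> q \<longrightarrow> 1 \<le> r \<longrightarrow>
               (max_const p q r X \<rho> M < \<infinity> \<longleftrightarrow> recip q \<in> D \<and> recip r \<le> F (recip q))))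
       \<and> (\<exists>X \<rho> M. metric_measure_space X \<rho> M \<and> \<not> doubling X \<rho> M \<and>
            (\<forall>q r. 1 \<le> q \<longrightarrow> 1 \<le> r \<longrightarrow>
               (max_const p q r X \<rho> M < \<infinity> \<longleftrightarrow> recip q \<in> D \<and> recip r < F (recip q))))"
proof -
  have "0 \<le> \<delta>" "D = {\<delta>..1} \<or> D = {\<delta><..1}" using assms(2) by auto
  note space = exists_space_for_region[OF assms(1) this assms(4,5,3,6)]
  show ?thesis
    using space[of False] space[of True] unfolding region_def by simp
qed

end
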